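(* Let $\alpha\in[1,2]$ and fix a choice of sign $\pm$. The Cauchy problem $$\mathrm{i}w_t+\partial_x^2w\pm|w|^{\alpha-1}w=0\quad\text{on }\mathbb T\times\mathbb R,\qquad w(\cdot,0)=w_0,$$ is globally well-posed in $H^1(\mathbb T)$, i.e. for every $w_0\in H^1(\mathbb T)$ there is a unique mild solution $w\in C(\mathbb R,H^1(\mathbb T))$; moreover, the solution enjoys energy conservation: $E(w(\cdot,t))=E(w_0)$ for all $t\in\mathbb R$, where $$E(f):=\int_{\mathbb T}\Big(\tfrac12|\partial_xf(x)|^2\mp\tfrac1{\alpha+1}|f(x)|^{\alpha+1}\Big)\,\mathrm dx.$$
   Context: $\mathbb T=\mathbb R/2\pi\mathbb Z$. The signs are coupled: the upper sign in the equation corresponds to the upper sign in $E$. The function $z\mapsto|z|^{\alpha-1}z$ is $0$ at $z=0$. A mild solution satisfies $w(\cdot,t)=e^{\mathrm{i}t\partial_x^2}w_0\pm\mathrm{i}\int_0^te^{\mathrm{i}(t-\tau)\partial_x^2}(|w|^{\alpha-1}w)(\cdot,\tau)\,\mathrm d\tau$ for all $t$. *)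

theory Defs
  imports "HOL-Analysis.Analysis"
begin

text \<open>
  Functions on the torus \<open>\<real>/2\<pi>\<int>\<close> are \<open>2\<pi>\<close>-periodic functions on the real line, and
  \<open>{0..2 * pi}\<close> is used as fundamental domain. Elements of \<open>L\<^sup>2\<close> and \<open>H\<^sup>1\<close> are represented by
  arbitrary Borel representatives; equality of elements is equality almost everywhere.
\<close>

definition L2_torus :: "(real \<Rightarrow> complex) set" where
  "L2_torus = {f. f \<in> borel_measurable borel \<and> (\<forall>x. f (x + 2 * pi) = f x) \<and>
     set_integrable lborel {0..2 * pi} (\<lambda>x. (cmod (f x))\<^sup>2)}"

definition torus_test_function :: "(real \<Rightarrow> complex) \<Rightarrow> bool" where
  "torus_test_function \<phi> \<longleftrightarrow> (\<forall>x. \<phi> (x + 2 * pi) = \<phi> x) \<and>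
     (\<exists>D :: nat \<Rightarrow> real \<Rightarrow> complex. D 0 = \<phi> \<and>
        (\<forall>n x. (D n has_vector_derivative D (Suc n) x) (at x)))"

definition is_weak_deriv :: "(real \<Rightarrow> complex) \<Rightarrow> (real \<Rightarrow> complex) \<Rightarrow> bool" where
  "is_weak_deriv f g \<longleftrightarrow> (\<forall>\<phi>. torus_test_function \<phi> \<longrightarrow>
     (LINT x:{0..2 * pi}|lborel. f x * vector_derivative \<phi> (at x)) =
       - (LINT x:{0..2 * pi}|lborel. g x * \<phi> x))"

definition H1_torus :: "(real \<Rightarrow> complex) set" where
  "H1_torus = {f \<in> L2_torus. \<exists>g \<in> L2_torus. is_weak_deriv f g}"

text \<open>A choice of representative; the weak derivative is unique up to null sets.\<close>

definition weak_deriv :: "(real \<Rightarrow> complex) \<Rightarrow> real \<Rightarrow> complex" where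
  "weak_deriv f = (SOME g. g \<in> L2_torus \<and> is_weak_deriv f g)"

definition H1_norm :: "(real \<Rightarrow> complex) \<Rightarrow> real" where
  "H1_norm f = sqrt (LINT x:{0..2 * pi}|lborel. (cmod (f x))\<^sup>2 + (cmod (weak_deriv f x))\<^sup>2)"

text \<open>The space \<open>C(\<real>, H\<^sup>1)\<close>; the time variable is the first argument.\<close>

definition C_H1 :: "(real \<Rightarrow> real \<Rightarrow> complex) set" where
  "C_H1 = {w. (\<forall>t. w t \<in> H1_torus) \<and>
     (\<forall>t. ((\<lambda>s. H1_norm (\<lambda>x. w s x - w t x)) \<longlongrightarrow> 0) (at t))}"

definition fourier_coeff :: "(real \<Rightarrow> complex) \<Rightarrow> int \<Rightarrow> complex" where
  "fourier_coeff f k =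
     (LINT x:{0..2 * pi}|lborel. f x * cis (- (of_int k * x))) / of_real (2 * pi)"

text \<open>
  The group generated by \<open>\<i> \<partial>\<^sub>x\<^sup>2\<close>, i.e. the Fourier multiplier with symbol \<open>exp (- \<i> t k\<^sup>2)\<close>.
  For \<open>f\<close> in \<open>H\<^sup>1\<close> the series converges absolutely, and its value does not depend on the
  representative \<open>f\<close>; the result is the continuous representative.
\<close>

definition schrodinger_group :: "real \<Rightarrow> (real \<Rightarrow> complex) \<Rightarrow> real \<Rightarrow> complex" where
  "schrodinger_group t f x =
     (\<Sum>\<^sub>\<infinity>k\<in>(UNIV :: int set).
        cis (- (t * (of_int k)\<^sup>2)) * fourier_coeff f k * cis (of_int k * x))"

text \<open>At \<open>z = 0\<close> the value is \<open>0\<close> for every \<open>\<alpha>\<close>, because of the second factor.\<close>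

definition nonlinearity :: "real \<Rightarrow> complex \<Rightarrow> complex" where
  "nonlinearity \<alpha> z = of_real (cmod z powr (\<alpha> - 1)) * z"

text \<open>
  The parameter \<open>\<sigma>\<close> is \<open>1\<close> for the upper and \<open>-1\<close> for the lower choice of the coupled signs.
  For \<open>w\<close> in \<open>C(\<real>, H\<^sup>1)\<close> and \<open>1 \<le> \<alpha>\<close> the Duhamel integrand is a continuous function of \<open>\<tau>\<close> with
  values in \<open>H\<^sup>1\<close>, given by its continuous representative. As evaluation at a point is continuous
  on \<open>H\<^sup>1\<close>, its vector-valued integral is the function obtained by integrating for each fixed
  \<open>x\<close>. The interval integral is oriented, so \<open>t < 0\<close> is covered.
\<close>

definition mild_solution ::
  "real \<Rightarrow> real \<Rightarrow> (real \<Rightarrow> complex) \<Rightarrow> (real \<Rightarrow> real \<Rightarrow> complex) \<Rightarrow> bool" where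
  "mild_solution \<alpha> \<sigma> w0 w \<longleftrightarrow> w \<in> C_H1 \<and>
     (\<forall>t. AE x in lborel. w t x =
        schrodinger_group t w0 x +
        of_real \<sigma> * \<i> * (LBINT \<tau>=ereal 0..ereal t.
          schrodinger_group (t - \<tau>) (\<lambda>y. nonlinearity \<alpha> (w \<tau> y)) x))"

definition energy :: "real \<Rightarrow> real \<Rightarrow> (real \<Rightarrow> complex) \<Rightarrow> real" where
  "energy \<alpha> \<sigma> f = (LINT x:{0..2 * pi}|lborel.
     1 / 2 * (cmod (weak_deriv f x))\<^sup>2 - \<sigma> * (1 / (\<alpha> + 1)) * cmod (f x) powr (\<alpha> + 1))"

end

theory Submission imports Defs
begin

text \<open>The equation is treated on the Fourier side. In the interaction picture
  \<open>u\<^sub>k(t) = e\<^bsup>itk^2\<^esup> w\<^sub>k(t)\<close> it becomes an ordinary differential equation without unbounded terms.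
  The power nonlinearity is first truncated at height \<open>R\<close>, which makes it globally Lipschitz: then
  Picard iteration in \<open>\<ell>\<^sup>2\<close> converges for all times, and the \<open>H\<^sup>1\<close> norms of the iterates stay
  bounded because a Lipschitz map enlarges difference quotients at most by its Lipschitz constant.
  Mass and energy are conserved by the truncated flow: for finite frequency truncations the energy
  is differentiable, and its derivative tends to zero boundedly as the truncation is removed.
  Since \<open>\<alpha> \<le> 2\<close>, the conservation laws bound the supremum of the solution independently of \<open>R\<close>, so
  that for \<open>R\<close> large the truncation is invisible. Two mild solutions are bounded on compact time
  intervals, hence solve the same truncated equation there and agree.\<close>

text \<open>For 1 < \<alpha> < 2 the derivative of the power is only Hoelder continuous at 0, and
  for \<alpha> > 1 the truncation has a kink at modulus \<open>R\<close>, so a Lipschitz estimate in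
  H^1 cannot be expected. This is why differences are measured in l^2 throughout and H^1 enters
  through bounds. Continuity in H^1 is recovered afterwards: a Duhamel integral whose integrand is
  bounded in H^1 is locally Lipschitz in time with values in H^1. At this regularity the time
  derivative of a solution in general lies only in H^-1, so the energy cannot be differentiated
  directly. After a frequency cutoff let A be the gradient of the cut-off energy. The flow then
  reads -i (A - \<sigma> D), where D is the error of cutting off inside the nonlinearity. The part
  from A drops out, as -i |A|^2 is imaginary, and a pairing of A with D remains. D tends to 0 only
  in l^2, while A contains k^2 w_k; but D stays bounded in H^1, so the pairing vanishes by weak
  convergence.\<close>

subsection \<open>Weighted square sums over the integers\<close>

text \<open>Bounding all finite partial sums, rather than an infinite sum, makes the bounds stable under
  coordinatewise limits and integration in time without any summability argument.\<close>

definition wl2 :: "(int \<Rightarrow> real) \<Rightarrow> (int \<Rightarrow> complex) \<Rightarrow> real \<Rightarrow> bool" where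
  "wl2 w a B \<longleftrightarrow> (\<forall>F. finite F \<longrightarrow> (\<Sum>k\<in>F. w k * (cmod (a k))\<^sup>2) \<le> B)"

text \<open>The H^1 weight: \<open>2 * pi\<close> times the full \<open>sob\<close>-weighted square
  sum of the Fourier coefficients is the squared H^1 norm.\<close>

definition sob :: "int \<Rightarrow> real" where "sob k = 1 + (of_int k)\<^sup>2"

lemma sob_pos: "0 < sob k" and sob_ge1: "1 \<le> sob k"
  unfolding sob_def by (auto simp: add_pos_nonneg)

lemma sob_nonneg: "0 \<le> sob k" using sob_pos[of k] by simp

lemma wl2D: "wl2 w a B \<Longrightarrow> finite F \<Longrightarrow> (\<Sum>k\<in>F. w k * (cmod (a k))\<^sup>2) \<le> B"
  by (simp add: wl2_def)

lemma wl2_nonneg: "wl2 w a B \<Longrightarrow> 0 \<le> B"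
  using wl2D[of w a B "{}"] by simp

lemma wl2_mono: "wl2 w a B \<Longrightarrow> B \<le> C \<Longrightarrow> wl2 w a C"
  unfolding wl2_def by force

lemma wl2_weight_mono:
  assumes "wl2 w a B" and "\<And>k. v k \<le> w k"
  shows "wl2 v a B"
  unfolding wl2_def
proof (intro allI impI)
  fix F :: "int set" assume F: "finite F"
  have "(\<Sum>k\<in>F. v k * (cmod (a k))\<^sup>2) \<le> (\<Sum>k\<in>F. w k * (cmod (a k))\<^sup>2)"
    by (intro sum_mono mult_right_mono assms) auto
  with wl2D[OF assms(1) F] show "(\<Sum>k\<in>F. v k * (cmod (a k))\<^sup>2) \<le> B" by simp
qed

lemma wl2_norm_mono:
  assumes "wl2 w b B" and "\<And>k. 0 \<le> w k" and "\<And>k. cmod (a k) \<le> cmod (b k)"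
  shows "wl2 w a B"
  unfolding wl2_def
proof (intro allI impI)
  fix F :: "int set" assume F: "finite F"
  have "(\<Sum>k\<in>F. w k * (cmod (a k))\<^sup>2) \<le> (\<Sum>k\<in>F. w k * (cmod (b k))\<^sup>2)"
    by (intro sum_mono mult_left_mono power_mono assms) auto
  with wl2D[OF assms(1) F] show "(\<Sum>k\<in>F. w k * (cmod (a k))\<^sup>2) \<le> B" by simp
qed

lemma norm_add_sq_le: "(cmod (x + y))\<^sup>2 \<le> 2 * (cmod x)\<^sup>2 + 2 * (cmod y)\<^sup>2"
proof -
  have "(cmod (x + y))\<^sup>2 \<le> (cmod x + cmod y)\<^sup>2"
    by (intro power_mono norm_triangle_ineq) auto
  also have "\<dots> \<le> 2 * (cmod x)\<^sup>2 + 2 * (cmod y)\<^sup>2"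
    using zero_le_power2[of "cmod x - cmod y"] by (simp add: power2_eq_square algebra_simps)
  finally show ?thesis .
qed

lemma wl2_add:
  assumes "wl2 w a A" and "wl2 w b B" and "\<And>k. 0 \<le> w k"
  shows "wl2 w (\<lambda>k. a k + b k) (2 * A + 2 * B)"
  unfolding wl2_def
proof (intro allI impI)
  fix F :: "int set" assume F: "finite F"
  have "(\<Sum>k\<in>F. w k * (cmod (a k + b k))\<^sup>2)
      \<le> (\<Sum>k\<in>F. 2 * (w k * (cmod (a k))\<^sup>2) + 2 * (w k * (cmod (b k))\<^sup>2))"
    by (rule sum_mono) (use mult_left_mono[OF norm_add_sq_le assms(3)] in \<open>simp add: algebra_simps\<close>)
  also have "\<dots> = 2 * (\<Sum>k\<in>F. w k * (cmod (a k))\<^sup>2) + 2 * (\<Sum>k\<in>F. w k * (cmod (b k))\<^sup>2)"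
    by (simp add: sum.distrib sum_distrib_left)
  also have "\<dots> \<le> 2 * A + 2 * B"
    using wl2D[OF assms(1) F] wl2D[OF assms(2) F] by simp
  finally show "(\<Sum>k\<in>F. w k * (cmod (a k + b k))\<^sup>2) \<le> 2 * A + 2 * B" .
qed

lemma wl2_minus: "wl2 w (\<lambda>k. - a k) B \<longleftrightarrow> wl2 w a B"
  by (simp add: wl2_def)

lemma wl2_diff:
  assumes "wl2 w a A" and "wl2 w b B" and "\<And>k. 0 \<le> w k"
  shows "wl2 w (\<lambda>k. a k - b k) (2 * A + 2 * B)"
  using wl2_add[OF assms(1) _ assms(3), of "\<lambda>k. - b k" B] assms(2) by (simp add: wl2_minus)

text \<open>Fatou's lemma for these norms: only finite sums have to pass to the limit, so
  convergence in each coordinate suffices.\<close>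

lemma wl2_limit:
  assumes "\<forall>\<^sub>F n in sequentially. wl2 w (a n) B" and "\<And>k. (\<lambda>n. a n k) \<longlonglongrightarrow> b k"
  shows "wl2 w b B"
  unfolding wl2_def
proof (intro allI impI)
  fix F :: "int set" assume F: "finite F"
  have "(\<lambda>n. \<Sum>k\<in>F. w k * (cmod (a n k))\<^sup>2) \<longlonglongrightarrow> (\<Sum>k\<in>F. w k * (cmod (b k))\<^sup>2)"
    by (intro tendsto_intros assms)
  then show "(\<Sum>k\<in>F. w k * (cmod (b k))\<^sup>2) \<le> B"
    by (rule tendsto_upperbound) (use assms(1) wl2D F in \<open>auto elim: eventually_mono\<close>)
qed

lemma wl2_summable:
  assumes "wl2 w a B" and "\<And>k. 0 \<le> w k"
  shows "(\<lambda>k. w k * (cmod (a k))\<^sup>2) summable_on UNIV"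
  by (rule nonneg_bdd_above_summable_on)
     (use assms in \<open>auto simp: bdd_above_def wl2_def intro!: exI[of _ B]\<close>)

lemma wl2_infsum_le:
  assumes "wl2 w a B" and "\<And>k. 0 \<le> w k"
  shows "(\<Sum>\<^sub>\<infinity>k. w k * (cmod (a k))\<^sup>2) \<le> B"
  by (rule infsum_le_finite_sums[OF wl2_summable[OF assms]]) (use assms(1) in \<open>auto simp: wl2_def\<close>)

lemma wl2_infsum:
  assumes "(\<lambda>k. w k * (cmod (a k))\<^sup>2) summable_on UNIV" and "\<And>k. 0 \<le> w k"
  shows "wl2 w a (\<Sum>\<^sub>\<infinity>k. w k * (cmod (a k))\<^sup>2)"
  unfolding wl2_def
proof (intro allI impI)
  fix F :: "int set" assume "finite F"
  then show "(\<Sum>k\<in>F. w k * (cmod (a k))\<^sup>2) \<le> (\<Sum>\<^sub>\<infinity>k. w k * (cmod (a k))\<^sup>2)"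
    by (intro finite_sum_le_infsum assms) (use assms(2) in auto)
qed

text \<open>Symmetric intervals exhaust the integers. This turns unordered sums into limits of
  sequences, the form that dominated convergence needs.\<close>

lemma int_intervals_filterlim:
  "filterlim (\<lambda>n. {- int n..int n}) (finite_subsets_at_top UNIV) sequentially"
  unfolding filterlim_finite_subsets_at_top
proof (intro allI impI)
  fix X :: "int set" assume X: "finite X \<and> X \<subseteq> UNIV"
  obtain N where N: "\<And>k. k \<in> X \<Longrightarrow> nat \<bar>k\<bar> \<le> N"
    using X finite_nat_set_iff_bounded_le[of "(\<lambda>k. nat \<bar>k\<bar>) ` X"] by auto
  show "\<forall>\<^sub>F n in sequentially. finite {- int n..int n} \<and> X \<subseteq> {- int n..int n} \<and> {- int n..int n} \<subseteq> UNIV"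
    using eventually_ge_at_top[of N]
  proof eventually_elim
    case (elim n)
    have "k \<in> {- int n..int n}" if "k \<in> X" for k using N[OF that] elim by auto
    then show ?case by auto
  qed
qed

lemma infsum_int_LIMSEQ:
  fixes g :: "int \<Rightarrow> 'a :: {topological_comm_monoid_add, t2_space}"
  assumes "g summable_on UNIV"
  shows "(\<lambda>n. \<Sum>k\<in>{- int n..int n}. g k) \<longlonglongrightarrow> (\<Sum>\<^sub>\<infinity>k. g k)"
  using filterlim_compose[OF has_sum_infsum[OF assms, unfolded has_sum_def] int_intervals_filterlim]
  by simp

lemma finite_int_subset_interval:
  assumes "finite (F :: int set)" obtains n :: nat where "F \<subseteq> {- int n..int n}"
  using int_intervals_filterlim[unfolded filterlim_finite_subsets_at_top, rule_format, of F] assms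
  by (auto dest: eventually_happens)

text \<open>The sum over all integers is pi * coth pi, slightly above 3; the rounder 7 comes from
  telescoping. The correction \<open>4 / (real n + 1)\<close> makes the induction close, since
  enlarging the interval adds two terms of total size at most
  \<open>4 / ((real n + 1) * (real n + 2))\<close>.\<close>

lemma sum_inverse_sob_le: "finite F \<Longrightarrow> (\<Sum>k\<in>F. 1 / sob k) \<le> 7"
proof -
  assume F: "finite F"
  obtain n where n: "F \<subseteq> {- int n..int n}" using finite_int_subset_interval[OF F] .
  have *: "(\<Sum>k\<in>{- int n..int n}. 1 / sob k) \<le> 7 - 4 / (real n + 1)" for n
  proof (induction n)
    case (Suc n)
    have "{- int (Suc n)..int (Suc n)} = insert (- int (Suc n)) (insert (int (Suc n)) {- int n..int n})"
      by auto
    then have "(\<Sum>k\<in>{- int (Suc n)..int (Suc n)}. 1 / sob k)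
        = 2 / (1 + (real n + 1)\<^sup>2) + (\<Sum>k\<in>{- int n..int n}. 1 / sob k)"
      by (simp add: sob_def power2_eq_square algebra_simps)
    also have "\<dots> \<le> 2 / (1 + (real n + 1)\<^sup>2) + (7 - 4 / (real n + 1))" using Suc by simp
    also have "\<dots> \<le> 7 - 4 / (real (Suc n) + 1)"
    proof -
      have "2 / (1 + (real n + 1)\<^sup>2) \<le> 4 / ((real n + 1) * (real n + 2))"
      proof -
        have "2 / (1 + (real n + 1)\<^sup>2) = 4 / (2 * (1 + (real n + 1)\<^sup>2))"
          using mult_divide_mult_cancel_left[of "2::real" 2 "1 + (real n + 1)\<^sup>2"] by simp
        also have "\<dots> \<le> 4 / ((real n + 1) * (real n + 2))"
          by (rule divide_left_mono) (auto simp: power2_eq_square algebra_simps add_pos_nonneg)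
        finally show ?thesis .
      qed
      also have "\<dots> = 4 / (real n + 1) - 4 / (real n + 2)" by (simp add: field_simps)
      finally show ?thesis by (simp add: algebra_simps)
    qed
    finally show ?case .
  qed (simp add: sob_def)
  have "(\<Sum>k\<in>F. 1 / sob k) \<le> (\<Sum>k\<in>{- int n..int n}. 1 / sob k)"
    by (intro sum_mono2 n) (auto simp: sob_nonneg)
  also have "\<dots> \<le> 7 - 4 / (real n + 1)" by (rule *)
  also have "\<dots> \<le> 7" by simp
  finally show ?thesis .
qed

lemma sum_mult_le_sqrt:
  fixes f g :: "'a \<Rightarrow> real"
  assumes "(\<Sum>k\<in>F. (f k)\<^sup>2) \<le> A" and "(\<Sum>k\<in>F. (g k)\<^sup>2) \<le> B"
  shows "(\<Sum>k\<in>F. f k * g k) \<le> sqrt A * sqrt B"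
proof -
  have "(\<Sum>k\<in>F. f k * g k)\<^sup>2 \<le> (\<Sum>k\<in>F. (f k)\<^sup>2) * (\<Sum>k\<in>F. (g k)\<^sup>2)" by (rule Cauchy_Schwarz_ineq_sum)
  also have "\<dots> \<le> A * B" by (intro mult_mono assms order_trans[OF _ assms(1)] sum_nonneg) auto
  finally show ?thesis by (metis real_le_rsqrt real_sqrt_mult)
qed

text \<open>Cauchy--Schwarz with weights: \<open>(u k)\<^sup>2 \<le> w k * v k\<close> is what lets
  the weight \<open>u\<close> be shared between the two factors. It serves the pairing with weight
  k^2 against two \<open>sob\<close> bounds as well as the unweighted one.\<close>

lemma wl2_sum_mult_le:
  assumes "wl2 w a A" and "wl2 v b B" and "\<And>k. 0 \<le> w k" and "\<And>k. 0 \<le> v k" and "finite F"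
    and "\<And>k. (u k)\<^sup>2 \<le> w k * v k"
  shows "(\<Sum>k\<in>F. u k * (cmod (a k) * cmod (b k))) \<le> sqrt A * sqrt B"
proof -
  have "(\<Sum>k\<in>F. u k * (cmod (a k) * cmod (b k)))
      \<le> (\<Sum>k\<in>F. (sqrt (w k) * cmod (a k)) * (sqrt (v k) * cmod (b k)))"
  proof (rule sum_mono)
    fix k
    have "u k \<le> sqrt (w k * v k)" using assms(6) by (rule real_le_rsqrt)
    then have "u k * (cmod (a k) * cmod (b k)) \<le> sqrt (w k * v k) * (cmod (a k) * cmod (b k))"
      by (rule mult_right_mono) auto
    then show "u k * (cmod (a k) * cmod (b k)) \<le> (sqrt (w k) * cmod (a k)) * (sqrt (v k) * cmod (b k))"
      by (simp add: real_sqrt_mult mult_ac)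
  qed
  also have "\<dots> \<le> sqrt A * sqrt B"
    by (rule sum_mult_le_sqrt)
       (use assms wl2D[OF assms(1,5)] wl2D[OF assms(2,5)] in \<open>auto simp: power_mult_distrib\<close>)
  finally show ?thesis .
qed

text \<open>The Sobolev embedding of H^1 into the bounded functions, in summed form: split off the
  factor \<open>1 / sqrt (sob k)\<close>, whose squares sum to at most 7.\<close>

lemma wl2_sob_sum_norm_le:
  assumes "wl2 sob a B" and "finite F"
  shows "(\<Sum>k\<in>F. cmod (a k)) \<le> sqrt (7 * B)"
proof -
  have "(\<Sum>k\<in>F. cmod (a k)) = (\<Sum>k\<in>F. (1 / sqrt (sob k)) * (sqrt (sob k) * cmod (a k)))"
  proof (intro sum.cong refl)
    fix k
    have "sqrt (sob k) \<noteq> 0" using sob_pos[of k] by simp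
    then show "cmod (a k) = (1 / sqrt (sob k)) * (sqrt (sob k) * cmod (a k))" by simp
  qed
  also have "\<dots> \<le> sqrt 7 * sqrt B"
    using sum_inverse_sob_le[OF assms(2)] wl2D[OF assms]
    by (intro sum_mult_le_sqrt) (auto simp: power_mult_distrib power_divide sob_nonneg)
  finally show ?thesis by (simp add: real_sqrt_mult)
qed

lemma wl2_sob_abs_summable:
  assumes "wl2 sob a B"
  shows "(\<lambda>k. cmod (a k)) summable_on UNIV"
  by (rule nonneg_bdd_above_summable_on)
     (use wl2_sob_sum_norm_le[OF assms] in \<open>auto simp: bdd_above_def\<close>)

lemma wl2_sob_infsum_norm_le:
  assumes "wl2 sob a B"
  shows "(\<Sum>\<^sub>\<infinity>k. cmod (a k)) \<le> sqrt (7 * B)"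
  by (rule infsum_le_finite_sums[OF wl2_sob_abs_summable[OF assms]])
     (use wl2_sob_sum_norm_le[OF assms] in auto)

lemma wl2_sob_one: "wl2 sob a B \<Longrightarrow> wl2 (\<lambda>_. 1) a B"
  by (erule wl2_weight_mono) (rule sob_ge1)

subsection \<open>Exchanging sums and integrals\<close>

text \<open>Dominated convergence along symmetric partial sums. One bound on the finite sums of
  norms yields pointwise summability, domination by \<open>B\<close> and summability of the
  integrals.\<close>

lemma integral_infsum_int:
  fixes c :: "int \<Rightarrow> 'a \<Rightarrow> complex"
  assumes meas: "\<And>k. c k \<in> borel_measurable M"
    and bound: "\<And>x F. x \<in> space M \<Longrightarrow> finite F \<Longrightarrow> (\<Sum>k\<in>F. cmod (c k x)) \<le> B x"
    and B: "integrable M B"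
  shows "integrable M (c k)"
    and "(\<lambda>k. cmod (\<integral>x. c k x \<partial>M)) summable_on UNIV"
    and "integrable M (\<lambda>x. \<Sum>\<^sub>\<infinity>k. c k x)"
    and "(\<integral>x. (\<Sum>\<^sub>\<infinity>k. c k x) \<partial>M) = (\<Sum>\<^sub>\<infinity>k. \<integral>x. c k x \<partial>M)"
proof -
  have ck: "integrable M (c k)" for k
    by (rule Bochner_Integration.integrable_bound[OF B meas])
       (use bound[of _ "{k}"] in \<open>auto intro!: AE_I2 intro: order_trans[OF _ abs_ge_self]\<close>)
  show "integrable M (c k)" by (rule ck)
  have sm: "(\<lambda>k. c k x) summable_on UNIV" if "x \<in> space M" for x
    by (rule abs_summable_summable, rule nonneg_bdd_above_summable_on)
       (use bound[OF that] in \<open>auto simp: bdd_above_def\<close>)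
  show sI: "(\<lambda>k. cmod (\<integral>x. c k x \<partial>M)) summable_on UNIV"
  proof (rule nonneg_bdd_above_summable_on)
    have "(\<Sum>k\<in>F. cmod (\<integral>x. c k x \<partial>M)) \<le> (\<integral>x. B x \<partial>M)" if F: "finite F" for F
    proof -
      have "(\<Sum>k\<in>F. cmod (\<integral>x. c k x \<partial>M)) \<le> (\<Sum>k\<in>F. \<integral>x. cmod (c k x) \<partial>M)"
        by (intro sum_mono integral_norm_bound)
      also have "\<dots> = (\<integral>x. (\<Sum>k\<in>F. cmod (c k x)) \<partial>M)"
        by (rule Bochner_Integration.integral_sum[symmetric]) (use ck in auto)
      also have "\<dots> \<le> (\<integral>x. B x \<partial>M)"
        by (rule integral_mono) (use ck B bound[OF _ F] in auto)
      finally show ?thesis .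
    qed
    then show "bdd_above (sum (\<lambda>k. cmod (\<integral>x. c k x \<partial>M)) ` {F. F \<subseteq> UNIV \<and> finite F})"
      by (auto simp: bdd_above_def)
  qed auto
  let ?s = "\<lambda>n x. \<Sum>k\<in>{- int n..int n}. c k x"
  have lim: "AE x in M. (\<lambda>n. ?s n x) \<longlonglongrightarrow> (\<Sum>\<^sub>\<infinity>k. c k x)"
    by (intro AE_I2 infsum_int_LIMSEQ sm)
  have smeas: "?s n \<in> borel_measurable M" for n using meas by measurable
  have lmeas: "(\<lambda>x. \<Sum>\<^sub>\<infinity>k. c k x) \<in> borel_measurable M"
    by (rule borel_measurable_LIMSEQ_metric[where f = ?s])
       (use smeas infsum_int_LIMSEQ sm in auto)
  have bd: "AE x in M. cmod (?s n x) \<le> B x" for n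
    by (intro AE_I2 order_trans[OF norm_sum] bound) auto
  show "integrable M (\<lambda>x. \<Sum>\<^sub>\<infinity>k. c k x)"
    by (rule integrable_dominated_convergence[OF lmeas smeas B lim bd])
  have l1: "(\<lambda>n. \<integral>x. ?s n x \<partial>M) \<longlonglongrightarrow> (\<integral>x. (\<Sum>\<^sub>\<infinity>k. c k x) \<partial>M)"
    by (rule integral_dominated_convergence[OF lmeas smeas B lim bd])
  have l2: "(\<lambda>n. \<integral>x. ?s n x \<partial>M) = (\<lambda>n. \<Sum>k\<in>{- int n..int n}. \<integral>x. c k x \<partial>M)"
    by (intro ext Bochner_Integration.integral_sum) (rule ck)
  have l3: "(\<lambda>n. \<Sum>k\<in>{- int n..int n}. \<integral>x. c k x \<partial>M) \<longlonglongrightarrow> (\<Sum>\<^sub>\<infinity>k. \<integral>x. c k x \<partial>M)"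
    by (rule infsum_int_LIMSEQ[OF abs_summable_summable[OF sI]])
  show "(\<integral>x. (\<Sum>\<^sub>\<infinity>k. c k x) \<partial>M) = (\<Sum>\<^sub>\<infinity>k. \<integral>x. c k x \<partial>M)"
    by (rule LIMSEQ_unique[OF l1[unfolded l2] l3])
qed

subsection \<open>The measure space of the torus\<close>

text \<open>Restricting the measure rather than the integrand replaces set integrals over one period
  by integrals over a finite measure space.\<close>

definition tor :: "real measure" where "tor = restrict_space lborel {0..2 * pi}"

lemma space_tor: "space tor = {0..2 * pi}" by (simp add: tor_def space_restrict_space)

lemma finite_measure_tor: "finite_measure tor"
  unfolding tor_def by (intro finite_measureI) (simp add: emeasure_restrict_space space_restrict_space)

interpretation tor: finite_measure tor by (rule finite_measure_tor)

lemma measure_tor: "measure tor (space tor) = 2 * pi"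
  by (simp add: tor_def measure_restrict_space space_restrict_space)

lemma set_integral_tor:
  fixes f :: "real \<Rightarrow> 'a :: {banach, second_countable_topology}"
  shows "(LINT x:{0..2 * pi}|lborel. f x) = (\<integral>x. f x \<partial>tor)"
  unfolding tor_def set_lebesgue_integral_def by (rule integral_restrict_space[symmetric]) simp

lemma set_integrable_tor:
  fixes f :: "real \<Rightarrow> 'a :: {banach, second_countable_topology}"
  shows "set_integrable lborel {0..2 * pi} f \<longleftrightarrow> integrable tor f"
  unfolding tor_def set_integrable_def by (rule integrable_restrict_space[symmetric]) simp

lemma borel_tor: "f \<in> borel_measurable borel \<Longrightarrow> f \<in> borel_measurable tor"
  unfolding tor_def by (rule measurable_restrict_space1) simp

lemma continuous_integrable_tor:
  fixes f :: "real \<Rightarrow> 'a :: {banach, second_countable_topology}"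
  shows "continuous_on {0..2 * pi} f \<Longrightarrow> integrable tor f"
  unfolding set_integrable_tor[symmetric] by (intro borel_integrable_atLeastAtMost') 

lemma continuous_borel_tor:
  fixes f :: "real \<Rightarrow> 'a :: {banach, second_countable_topology}"
  shows "continuous_on {0..2 * pi} f \<Longrightarrow> f \<in> borel_measurable tor"
  by (rule borel_measurable_integrable[OF continuous_integrable_tor])

lemma AE_tor: "(AE x in tor. P x) \<longleftrightarrow> (AE x in lborel. x \<in> {0..2 * pi} \<longrightarrow> P x)"
  unfolding tor_def by (subst AE_restrict_space_iff) auto

lemma AE_lborel_tor: "(AE x in lborel. P x) \<Longrightarrow> (AE x in tor. P x)"
  unfolding AE_tor by auto

lemma integral_tor_const: "(\<integral>x. c \<partial>tor) = of_real (2 * pi) * (c :: complex)"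
  using measure_tor by (simp add: scaleR_conv_of_real)

lemma integral_tor_const_real: "(\<integral>x. c \<partial>tor) = 2 * pi * (c :: real)"
  using measure_tor by simp

lemma fourier_coeff_tor:
  "fourier_coeff f k = (\<integral>x. f x * cis (- (of_int k * x)) \<partial>tor) / of_real (2 * pi)"
  by (simp add: fourier_coeff_def set_integral_tor)

lemma fourier_coeff_cong_AE:
  assumes "AE x in tor. f x = g x" and "f \<in> borel_measurable tor" and "g \<in> borel_measurable tor"
  shows "fourier_coeff f k = fourier_coeff g k"
proof -
  have "(\<integral>x. f x * cis (- (of_int k * x)) \<partial>tor) = (\<integral>x. g x * cis (- (of_int k * x)) \<partial>tor)"
    by (intro integral_cong_AE borel_measurable_times assms continuous_borel_tor
      continuous_intros) (use assms(1) in auto)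
  then show ?thesis by (simp add: fourier_coeff_tor)
qed

lemma has_vector_derivative_cis:
  "((\<lambda>x. cis (c * x)) has_vector_derivative (\<i> * of_real c * cis (c * x))) (at x within S)"
proof -
  have "((\<lambda>z. exp (\<i> * of_real c * z)) has_field_derivative (\<i> * of_real c * exp (\<i> * of_real c * of_real x)))
      (at (of_real x))"
    by (auto intro!: derivative_eq_intros)
  from has_vector_derivative_real_field[OF this]
  show ?thesis by (simp add: cis_conv_exp mult_ac)
qed

lemma integral_cis: "(\<integral>x. cis (of_int k * x) \<partial>tor) = (if k = 0 then of_real (2 * pi) else 0)"
proof (cases "k = 0")
  case True
  then show ?thesis using integral_tor_const[of 1] by simp
next
  case False
  let ?G = "\<lambda>x. cis (of_int k * x) / (\<i> * of_int k)"
  have "((\<lambda>x. cis (of_int k * x)) has_integral (?G (2 * pi) - ?G 0)) {0..2 * pi}"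
  proof (rule fundamental_theorem_of_calculus)
    fix x
    from has_vector_derivative_divide[OF has_vector_derivative_cis]
    have "(?G has_vector_derivative \<i> * of_real (of_int k) * cis (of_int k * x) / (\<i> * of_int k))
        (at x within {0..2 * pi})" .
    then show "(?G has_vector_derivative cis (of_int k * x)) (at x within {0..2 * pi})"
      using False by simp
  qed simp
  moreover have "cis (of_int k * (2 * pi)) = 1"
    using cis_multiple_2pi[of "of_int k"] by (simp add: mult_ac)
  ultimately have "((\<lambda>x. cis (of_int k * x)) has_integral 0) {0..2 * pi}" by simp
  moreover have "(LINT x:{0..2 * pi}|lborel. cis (of_int k * x)) = integral {0..2 * pi} (\<lambda>x. cis (of_int k * x))"
    by (intro set_borel_integral_eq_integral borel_integrable_atLeastAtMost' continuous_intros)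
  ultimately show ?thesis using False by (simp add: set_integral_tor integral_unique)
qed

subsection \<open>Square integrable functions on the torus\<close>

text \<open>Weaker than \<open>L2_torus\<close>: nothing is asked outside one period, so
  exponentials and derivatives of test functions qualify as soon as they are continuous
  there.\<close>

definition sqint :: "(real \<Rightarrow> complex) \<Rightarrow> bool" where
  "sqint f \<longleftrightarrow> f \<in> borel_measurable tor \<and> integrable tor (\<lambda>x. (cmod (f x))\<^sup>2)"

lemma sqint_measurable: "sqint f \<Longrightarrow> f \<in> borel_measurable tor"
  and sqint_integrable_sq: "sqint f \<Longrightarrow> integrable tor (\<lambda>x. (cmod (f x))\<^sup>2)"
  by (auto simp: sqint_def)

lemma L2_torus_sqint: "f \<in> L2_torus \<Longrightarrow> sqint f"
  by (auto simp: L2_torus_def sqint_def borel_tor set_integrable_tor)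

lemma sqint_continuous: "continuous_on {0..2 * pi} f \<Longrightarrow> sqint f"
  unfolding sqint_def by (intro conjI continuous_borel_tor continuous_integrable_tor continuous_intros)

lemma two_mult_le_squares: "2 * (x * y) \<le> x\<^sup>2 + (y :: real)\<^sup>2"
  using zero_le_power2[of "x - y"] by (simp add: power2_eq_square algebra_simps)

lemma sqint_mult_integrable:
  assumes "sqint f" and "sqint g"
  shows "integrable tor (\<lambda>x. f x * g x)"
proof (rule Bochner_Integration.integrable_bound)
  show "integrable tor (\<lambda>x. (cmod (f x))\<^sup>2 + (cmod (g x))\<^sup>2)"
    using assms by (auto simp: sqint_def)
  show "(\<lambda>x. f x * g x) \<in> borel_measurable tor" using assms by (auto simp: sqint_def)
  show "AE x in tor. norm (f x * g x) \<le> norm ((cmod (f x))\<^sup>2 + (cmod (g x))\<^sup>2)"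
  proof (rule AE_I2)
    fix x
    have "cmod (f x) * cmod (g x) \<le> (cmod (f x))\<^sup>2 + (cmod (g x))\<^sup>2"
      using two_mult_le_squares[of "cmod (f x)" "cmod (g x)"]
        mult_nonneg_nonneg[OF norm_ge_zero[of "f x"] norm_ge_zero[of "g x"]] by linarith
    then show "norm (f x * g x) \<le> norm ((cmod (f x))\<^sup>2 + (cmod (g x))\<^sup>2)"
      by (simp add: norm_mult)
  qed
qed

lemma sqint_const: "sqint (\<lambda>x. c)"
  by (rule sqint_continuous) (intro continuous_intros)

lemma sqint_integrable: "sqint f \<Longrightarrow> integrable tor f"
  using sqint_mult_integrable[OF _ sqint_const[of 1], of f] by simp

lemma sqint_bound:
  assumes "integrable tor g" and "f \<in> borel_measurable tor"
    and "AE x in tor. (cmod (f x))\<^sup>2 \<le> g x"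
  shows "sqint f"
  unfolding sqint_def
proof
  show "integrable tor (\<lambda>x. (cmod (f x))\<^sup>2)"
    by (rule Bochner_Integration.integrable_bound[OF assms(1)]) (use assms(2,3) in auto)
qed fact

lemma sqint_norm_le:
  assumes "sqint g" and "f \<in> borel_measurable tor" and "AE x in tor. cmod (f x) \<le> C * cmod (g x)"
  shows "sqint f"
proof (rule sqint_bound)
  show "integrable tor (\<lambda>x. C\<^sup>2 * (cmod (g x))\<^sup>2)" using assms(1) by (simp add: sqint_def)
  show "AE x in tor. (cmod (f x))\<^sup>2 \<le> C\<^sup>2 * (cmod (g x))\<^sup>2"
    using assms(3)
  proof eventually_elim
    case (elim x)
    then show ?case unfolding power_mult_distrib[symmetric] by (rule power_mono) simp
  qed
qed fact

lemma sqint_add: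
  assumes "sqint f" and "sqint g"
  shows "sqint (\<lambda>x. f x + g x)"
proof (rule sqint_bound)
  show "integrable tor (\<lambda>x. 2 * (cmod (f x))\<^sup>2 + 2 * (cmod (g x))\<^sup>2)"
    using assms by (auto simp: sqint_def)
qed (use assms norm_add_sq_le in \<open>auto simp: sqint_def\<close>)

lemma sqint_cmult: "sqint f \<Longrightarrow> sqint (\<lambda>x. c * f x)"
  by (rule sqint_norm_le[where C = "cmod c"]) (auto simp: sqint_def norm_mult)

lemma sqint_minus: "sqint f \<Longrightarrow> sqint (\<lambda>x. - f x)"
  by (rule sqint_norm_le[where C = 1]) (auto simp: sqint_def)

lemma sqint_diff: "sqint f \<Longrightarrow> sqint g \<Longrightarrow> sqint (\<lambda>x. f x - g x)"
  using sqint_add[OF _ sqint_minus, of f g] by simp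

lemma sqint_cnj: "sqint f \<Longrightarrow> sqint (\<lambda>x. cnj (f x))"
proof (rule sqint_norm_le[where C = 1 and g = f])
  assume f: "sqint f"
  have "cnj \<in> borel_measurable borel" by (intro borel_measurable_continuous_onI continuous_intros)
  then show "(\<lambda>x. cnj (f x)) \<in> borel_measurable tor"
    by (rule measurable_compose[OF sqint_measurable[OF f]])
qed auto

lemma sqint_cis: "sqint (\<lambda>x. cis (c * x))" and sqint_cis_minus: "sqint (\<lambda>x. cis (- (c * x)))"
  by (rule sqint_continuous; intro continuous_intros)+

text \<open>The integral of \<open>(t * cmod (f x) - cmod (g x))\<^sup>2\<close> is a nonnegative
  quadratic polynomial in \<open>t\<close>; its value at the minimum \<open>t = C / A\<close> gives
  the claim.\<close>

lemma sqint_Cauchy_Schwarz: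
  assumes "sqint f" and "sqint g"
  shows "(cmod (\<integral>x. f x * g x \<partial>tor))\<^sup>2 \<le> (\<integral>x. (cmod (f x))\<^sup>2 \<partial>tor) * (\<integral>x. (cmod (g x))\<^sup>2 \<partial>tor)"
proof -
  define A where "A = (\<integral>x. (cmod (f x))\<^sup>2 \<partial>tor)"
  define B where "B = (\<integral>x. (cmod (g x))\<^sup>2 \<partial>tor)"
  define C where "C = (\<integral>x. cmod (f x) * cmod (g x) \<partial>tor)"
  have iC: "integrable tor (\<lambda>x. cmod (f x) * cmod (g x))"
    using integrable_norm[OF sqint_mult_integrable[OF assms]] by (simp add: norm_mult)
  have quad: "0 \<le> t\<^sup>2 * A - 2 * t * C + B" for t
  proof -
    have "0 \<le> (\<integral>x. (t * cmod (f x) - cmod (g x))\<^sup>2 \<partial>tor)" by simp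
    also have "\<dots> = (\<integral>x. t\<^sup>2 * (cmod (f x))\<^sup>2 - 2 * t * (cmod (f x) * cmod (g x)) + (cmod (g x))\<^sup>2 \<partial>tor)"
      by (simp add: power2_eq_square algebra_simps)
    also have "\<dots> = t\<^sup>2 * A - 2 * t * C + B"
      using iC assms by (simp add: A_def B_def C_def sqint_def)
    finally show ?thesis .
  qed
  have "C\<^sup>2 \<le> A * B"
  proof (cases "A = 0")
    case True
    have "C = 0"
    proof (rule ccontr)
      assume "C \<noteq> 0"
      \<comment> \<open>For \<open>A = 0\<close> the quadratic is affine in \<open>t\<close>; this
        \<open>t\<close> would give it the value -1.\<close>
      then show False using quad[of "(B + 1) / (2 * C)"] True by (simp add: field_simps)
    qed
    then show ?thesis using True by simp
  next
    case False
    then have A: "A > 0" by (simp add: A_def less_le)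
    have "0 \<le> (C / A)\<^sup>2 * A - 2 * (C / A) * C + B" by (rule quad)
    also have "\<dots> = B - C\<^sup>2 / A" using A by (simp add: power2_eq_square field_simps)
    finally show ?thesis using A by (simp add: field_simps)
  qed
  moreover have "cmod (\<integral>x. f x * g x \<partial>tor) \<le> C"
    using integral_norm_bound[of tor "\<lambda>x. f x * g x"] by (simp add: C_def norm_mult)
  ultimately show ?thesis unfolding A_def B_def
    by (meson norm_ge_zero order_trans power_mono)
qed

subsection \<open>Fourier coefficients and Bessel's inequality\<close>

lemma fourier_coeff_integral:
  "(\<integral>x. f x * cis (- (of_int k * x)) \<partial>tor) = of_real (2 * pi) * fourier_coeff f k"
  by (simp add: fourier_coeff_tor)

lemma integrable_mult_cis:
  assumes "integrable tor f"
  shows "integrable tor (\<lambda>x. f x * cis (c * x))" and "integrable tor (\<lambda>x. f x * cis (- (c * x)))"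
  by (rule Bochner_Integration.integrable_bound[OF assms];
      use borel_measurable_integrable[OF assms] sqint_measurable[OF sqint_cis]
        sqint_measurable[OF sqint_cis_minus] in \<open>auto simp: norm_mult\<close>)+

lemma fourier_coeff_diff:
  "integrable tor f \<Longrightarrow> integrable tor g \<Longrightarrow>
    fourier_coeff (\<lambda>x. f x - g x) k = fourier_coeff f k - fourier_coeff g k"
  by (simp add: fourier_coeff_tor left_diff_distrib integrable_mult_cis diff_divide_distrib)

lemma fourier_coeff_cmult: "fourier_coeff (\<lambda>x. c * f x) k = c * fourier_coeff f k"
  by (simp add: fourier_coeff_tor mult.assoc)

lemma fourier_coeff_sum:
  assumes "\<And>j. j \<in> F \<Longrightarrow> integrable tor (f j)"
  shows "fourier_coeff (\<lambda>x. \<Sum>j\<in>F. f j x) k = (\<Sum>j\<in>F. fourier_coeff (f j) k)"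
  using assms by (simp add: fourier_coeff_tor sum_distrib_right sum_divide_distrib integrable_mult_cis
    Bochner_Integration.integral_sum)

lemma fourier_coeff_cis: "fourier_coeff (\<lambda>x. cis (of_int j * x)) k = (if j = k then 1 else 0)"
proof -
  have "(\<lambda>x. cis (of_int j * x) * cis (- (of_int k * x))) = (\<lambda>x. cis (of_int (j - k) * x))"
    by (simp add: cis_mult algebra_simps)
  then have "fourier_coeff (\<lambda>x. cis (of_int j * x)) k = (\<integral>x. cis (of_int (j - k) * x) \<partial>tor) / of_real (2 * pi)"
    by (simp only: fourier_coeff_tor)
  then show ?thesis unfolding integral_cis by simp
qed

definition psum :: "int set \<Rightarrow> (int \<Rightarrow> complex) \<Rightarrow> real \<Rightarrow> complex" where
  "psum F c x = (\<Sum>k\<in>F. c k * cis (of_int k * x))"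

lemma continuous_psum: "continuous_on S (psum F c)"
  unfolding psum_def by (intro continuous_intros)

lemma sqint_psum: "sqint (psum F c)"
  by (rule sqint_continuous) (rule continuous_psum)

lemma fourier_coeff_psum: "finite F \<Longrightarrow> fourier_coeff (psum F c) k = (if k \<in> F then c k else 0)"
  unfolding psum_def
  by (subst fourier_coeff_sum)
     (auto simp: fourier_coeff_cmult fourier_coeff_cis sqint_integrable sqint_cmult sqint_cis
       if_distrib cong: if_cong)

lemma integral_cnj_psum:
  assumes "integrable tor f"
  shows "(\<integral>x. f x * cnj (psum F c x) \<partial>tor) = of_real (2 * pi) * (\<Sum>k\<in>F. cnj (c k) * fourier_coeff f k)"
proof -
  have "(\<integral>x. f x * cnj (psum F c x) \<partial>tor) = (\<integral>x. (\<Sum>k\<in>F. cnj (c k) * (f x * cis (- (of_int k * x)))) \<partial>tor)"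
    by (simp add: psum_def sum_distrib_left cis_cnj mult_ac)
  also have "\<dots> = (\<Sum>k\<in>F. \<integral>x. cnj (c k) * (f x * cis (- (of_int k * x))) \<partial>tor)"
    by (rule Bochner_Integration.integral_sum) (simp add: integrable_mult_cis assms)
  also have "\<dots> = (\<Sum>k\<in>F. cnj (c k) * (of_real (2 * pi) * fourier_coeff f k))"
    by (simp add: fourier_coeff_integral)
  finally show ?thesis by (simp add: sum_distrib_left mult_ac)
qed

lemma complex_norm_sq: "of_real ((cmod z)\<^sup>2) = z * cnj z"
  by (rule complex_norm_square)

lemma integral_of_real_complex: "(\<integral>x. complex_of_real (f x) \<partial>M) = of_real (\<integral>x. f x \<partial>M)"
  by (rule integral_complex_of_real)

lemma integral_norm_sq_psum:
  assumes "finite F"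
  shows "(\<integral>x. (cmod (psum F c x))\<^sup>2 \<partial>tor) = 2 * pi * (\<Sum>k\<in>F. (cmod (c k))\<^sup>2)"
proof -
  have "complex_of_real (\<integral>x. (cmod (psum F c x))\<^sup>2 \<partial>tor) = (\<integral>x. psum F c x * cnj (psum F c x) \<partial>tor)"
    unfolding integral_of_real_complex[symmetric] complex_norm_sq ..
  also have "\<dots> = of_real (2 * pi) * (\<Sum>k\<in>F. cnj (c k) * c k)"
    by (subst integral_cnj_psum) (auto simp: sqint_integrable sqint_psum fourier_coeff_psum assms)
  also have "\<dots> = of_real (2 * pi * (\<Sum>k\<in>F. (cmod (c k))\<^sup>2))"
    by (simp only: of_real_mult of_real_sum complex_norm_sq mult.commute)
  finally show ?thesis by (simp only: of_real_eq_iff)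
qed

lemma integral_norm_sq_diff:
  assumes "sqint f" and "sqint g"
  shows "(\<integral>x. (cmod (f x - g x))\<^sup>2 \<partial>tor) = (\<integral>x. (cmod (f x))\<^sup>2 \<partial>tor) + (\<integral>x. (cmod (g x))\<^sup>2 \<partial>tor)
    - 2 * Re (\<integral>x. f x * cnj (g x) \<partial>tor)"
proof -
  have i: "integrable tor (\<lambda>x. f x * cnj (g x))"
    by (rule sqint_mult_integrable[OF assms(1) sqint_cnj[OF assms(2)]])
  have "(cmod (a - b))\<^sup>2 = (cmod a)\<^sup>2 + (cmod b)\<^sup>2 - 2 * Re (a * cnj b)" for a b
    unfolding cmod_power2 by (simp add: power2_eq_square algebra_simps)
  then have "(\<integral>x. (cmod (f x - g x))\<^sup>2 \<partial>tor)
      = (\<integral>x. (cmod (f x))\<^sup>2 + (cmod (g x))\<^sup>2 - 2 * Re (f x * cnj (g x)) \<partial>tor)" by presburger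
  also have "\<dots> = (\<integral>x. (cmod (f x))\<^sup>2 \<partial>tor) + (\<integral>x. (cmod (g x))\<^sup>2 \<partial>tor) - 2 * (\<integral>x. Re (f x * cnj (g x)) \<partial>tor)"
    using sqint_integrable_sq[OF assms(1)] sqint_integrable_sq[OF assms(2)] integrable_Re[OF i]
    by (simp del: times_complex.sel)
  also have "(\<integral>x. Re (f x * cnj (g x)) \<partial>tor) = Re (\<integral>x. f x * cnj (g x) \<partial>tor)"
    using integral_Re[OF i] .
  finally show ?thesis .
qed

text \<open>Pythagoras: with these coefficients \<open>psum F c\<close> is the orthogonal projection
  of \<open>f\<close> onto finitely many exponentials. Nonnegativity of the left side gives Bessel's
  inequality, and approximability by such sums will give Parseval's identity.\<close>

lemma integral_norm_sq_diff_psum: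
  assumes "sqint f" and "finite F" and "\<And>k. k \<in> F \<Longrightarrow> c k = fourier_coeff f k"
  shows "(\<integral>x. (cmod (f x - psum F c x))\<^sup>2 \<partial>tor)
    = (\<integral>x. (cmod (f x))\<^sup>2 \<partial>tor) - 2 * pi * (\<Sum>k\<in>F. (cmod (c k))\<^sup>2)"
proof -
  have "(\<integral>x. f x * cnj (psum F c x) \<partial>tor) = of_real (2 * pi) * (\<Sum>k\<in>F. cnj (c k) * c k)"
    using assms(3) by (simp add: integral_cnj_psum sqint_integrable assms(1))
  also have "\<dots> = of_real (2 * pi * (\<Sum>k\<in>F. (cmod (c k))\<^sup>2))"
    by (simp only: of_real_mult of_real_sum complex_norm_sq mult.commute)
  finally have "Re (\<integral>x. f x * cnj (psum F c x) \<partial>tor) = 2 * pi * (\<Sum>k\<in>F. (cmod (c k))\<^sup>2)"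
    by (simp only: Re_complex_of_real)
  then show ?thesis
    using integral_norm_sq_diff[OF assms(1) sqint_psum, of F c] integral_norm_sq_psum[OF assms(2), of c]
    by simp
qed

lemma bessel: "sqint f \<Longrightarrow> wl2 (\<lambda>_. 1) (fourier_coeff f) ((\<integral>x. (cmod (f x))\<^sup>2 \<partial>tor) / (2 * pi))"
  unfolding wl2_def
proof (intro allI impI)
  fix F :: "int set" assume f: "sqint f" and F: "finite F"
  have "0 \<le> (\<integral>x. (cmod (f x - psum F (fourier_coeff f) x))\<^sup>2 \<partial>tor)" by simp
  then have "2 * pi * (\<Sum>k\<in>F. (cmod (fourier_coeff f k))\<^sup>2) \<le> (\<integral>x. (cmod (f x))\<^sup>2 \<partial>tor)"
    by (simp add: integral_norm_sq_diff_psum[OF f F])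
  then show "(\<Sum>k\<in>F. 1 * (cmod (fourier_coeff f k))\<^sup>2) \<le> (\<integral>x. (cmod (f x))\<^sup>2 \<partial>tor) / (2 * pi)"
    by (simp add: field_simps)
qed

subsection \<open>Absolutely convergent trigonometric series\<close>

definition trig :: "(int \<Rightarrow> complex) \<Rightarrow> real \<Rightarrow> complex" where
  "trig a x = (\<Sum>\<^sub>\<infinity>k. a k * cis (of_int k * x))"

lemma schrodinger_group_trig:
  "schrodinger_group t f = trig (\<lambda>k. cis (- (t * (of_int k)\<^sup>2)) * fourier_coeff f k)"
  by (simp add: fun_eq_iff schrodinger_group_def trig_def)

lemma trig_abs_summable:
  "(\<lambda>k. cmod (a k)) summable_on UNIV \<Longrightarrow> (\<lambda>k. cmod (a k * cis (of_int k * x))) summable_on UNIV"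
  by (simp add: norm_mult)

lemma trig_summable:
  "(\<lambda>k. cmod (a k)) summable_on UNIV \<Longrightarrow> (\<lambda>k. a k * cis (of_int k * x)) summable_on UNIV"
  by (rule abs_summable_summable[OF trig_abs_summable])

lemma norm_trig_le:
  assumes "(\<lambda>k. cmod (a k)) summable_on UNIV"
  shows "cmod (trig a x) \<le> (\<Sum>\<^sub>\<infinity>k. cmod (a k))"
  using norm_infsum_bound[OF trig_abs_summable[OF assms, of x]] by (simp add: trig_def norm_mult)

lemma trig_diff:
  assumes "(\<lambda>k. cmod (a k)) summable_on UNIV" and "(\<lambda>k. cmod (b k)) summable_on UNIV"
  shows "trig (\<lambda>k. a k - b k) x = trig a x - trig b x"
proof -
  have "((\<lambda>k. a k * cis (of_int k * x) + - (b k * cis (of_int k * x))) has_sum (trig a x + - trig b x)) UNIV"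
    unfolding trig_def
    by (intro has_sum_add has_sum_infsum trig_summable assms has_sum_uminus[THEN iffD2]) (simp add: has_sum_infsum trig_summable assms)
  then show ?thesis unfolding trig_def by (simp add: left_diff_distrib infsumI)
qed

lemma trig_add:
  assumes "(\<lambda>k. cmod (a k)) summable_on UNIV" and "(\<lambda>k. cmod (b k)) summable_on UNIV"
  shows "trig (\<lambda>k. a k + b k) x = trig a x + trig b x"
  unfolding trig_def distrib_right
  by (rule infsum_add[OF trig_summable[OF assms(1)] trig_summable[OF assms(2)]])

lemma trig_cmult: "trig (\<lambda>k. c * a k) x = c * trig a x"
  unfolding trig_def mult.assoc by (rule infsum_cmult_right')

lemma cis_int_periodic: "cis (of_int k * (x + 2 * pi)) = cis (of_int k * x)"
  using cis_multiple_2pi[of "of_int k"] by (simp add: distrib_left cis_mult[symmetric] mult_ac)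

lemma trig_periodic: "trig a (x + 2 * pi) = trig a x"
  by (simp only: trig_def cis_int_periodic)

lemma trig_shift: "trig a (x + h) = trig (\<lambda>k. cis (of_int k * h) * a k) x"
  unfolding trig_def by (intro infsum_cong) (simp add: distrib_left cis_mult[symmetric] mult_ac)

text \<open>Weierstrass test: the remainder after \<open>F\<close> is at most the tail of the norms,
  for all \<open>x\<close> at once because the exponentials are unimodular.\<close>

lemma psum_uniform_limit:
  assumes "(\<lambda>k. cmod (a k)) summable_on UNIV"
  shows "uniform_limit S (\<lambda>n. psum {- int n..int n} a) (trig a) sequentially"
proof -
  have le: "cmod (trig a x - psum F a x) \<le> (\<Sum>\<^sub>\<infinity>k. cmod (a k)) - (\<Sum>k\<in>F. cmod (a k))"
    if "finite F" for F x
  proof -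
    have "trig a x - psum F a x = (\<Sum>\<^sub>\<infinity>k\<in>UNIV - F. a k * cis (of_int k * x))"
      unfolding trig_def psum_def using that trig_summable[OF assms, of x]
      by (simp add: infsum_Diff)
    also have "cmod \<dots> \<le> (\<Sum>\<^sub>\<infinity>k\<in>UNIV - F. cmod (a k * cis (of_int k * x)))"
      by (rule norm_infsum_bound)
         (use trig_abs_summable[OF assms] in \<open>auto intro: summable_on_subset_banach\<close>)
    also have "\<dots> = (\<Sum>\<^sub>\<infinity>k\<in>UNIV - F. cmod (a k))" by (simp add: norm_mult)
    also have "\<dots> = (\<Sum>\<^sub>\<infinity>k. cmod (a k)) - (\<Sum>k\<in>F. cmod (a k))"
      using that assms by (simp add: infsum_Diff)
    finally show ?thesis .
  qed
  show ?thesis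
  proof (rule uniform_limitI)
    fix e :: real assume e: "0 < e"
    have "\<forall>\<^sub>F n in sequentially. \<bar>(\<Sum>k\<in>{- int n..int n}. cmod (a k)) - (\<Sum>\<^sub>\<infinity>k. cmod (a k))\<bar> < e"
      using tendstoD[OF infsum_int_LIMSEQ[OF assms] e] by (simp add: dist_norm)
    then show "\<forall>\<^sub>F n in sequentially. \<forall>x\<in>S. dist (psum {- int n..int n} a x) (trig a x) < e"
    proof eventually_elim
      case (elim n)
      show ?case
      proof
        fix x
        have "dist (psum {- int n..int n} a x) (trig a x) = cmod (trig a x - psum {- int n..int n} a x)"
          by (simp add: dist_norm norm_minus_commute)
        then show "dist (psum {- int n..int n} a x) (trig a x) < e"
          using le[of "{- int n..int n}" x] elim by simp
      qed
    qed
  qed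
qed

lemma continuous_trig: "(\<lambda>k. cmod (a k)) summable_on UNIV \<Longrightarrow> continuous_on S (trig a)"
  by (rule uniform_limit_theorem[OF _ psum_uniform_limit]) (auto simp: continuous_psum)

lemma sqint_trig: "(\<lambda>k. cmod (a k)) summable_on UNIV \<Longrightarrow> sqint (trig a)"
  by (rule sqint_continuous) (rule continuous_trig)

lemma trig_LIMSEQ:
  "(\<lambda>k. cmod (a k)) summable_on UNIV \<Longrightarrow> (\<lambda>n. psum {- int n..int n} a x) \<longlonglongrightarrow> trig a x"
  unfolding psum_def trig_def by (rule infsum_int_LIMSEQ[OF trig_summable])

text \<open>The partial sums of \<open>cnj (a k) * (f x * cis (- (of_int k * x)))\<close> are
  dominated by a constant multiple of \<open>cmod (f x)\<close>, so sum and integral may be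
  exchanged.\<close>

lemma integral_cnj_trig:
  assumes a: "(\<lambda>k. cmod (a k)) summable_on UNIV" and f: "integrable tor f"
  shows "(\<lambda>k. cmod (fourier_coeff f k * cnj (a k))) summable_on UNIV"
    and "(\<integral>x. f x * cnj (trig a x) \<partial>tor) = of_real (2 * pi) * (\<Sum>\<^sub>\<infinity>k. fourier_coeff f k * cnj (a k))"
proof -
  let ?c = "\<lambda>k x. cnj (a k) * (f x * cis (- (of_int k * x)))"
  have meas: "?c k \<in> borel_measurable tor" for k
    by (intro borel_measurable_times borel_measurable_const borel_measurable_integrable[OF f]
      sqint_measurable[OF sqint_cis_minus])
  have bound: "(\<Sum>k\<in>F. cmod (?c k x)) \<le> (\<Sum>\<^sub>\<infinity>k. cmod (a k)) * cmod (f x)" if "finite F" for F x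
  proof -
    have "(\<Sum>k\<in>F. cmod (?c k x)) = (\<Sum>k\<in>F. cmod (a k)) * cmod (f x)"
      by (simp add: norm_mult sum_distrib_right)
    also have "\<dots> \<le> (\<Sum>\<^sub>\<infinity>k. cmod (a k)) * cmod (f x)"
      by (intro mult_right_mono finite_sum_le_infsum a) (use that in auto)
    finally show ?thesis .
  qed
  have B: "integrable tor (\<lambda>x. (\<Sum>\<^sub>\<infinity>k. cmod (a k)) * cmod (f x))"
    using f by (intro integrable_mult_right integrable_norm)
  note E = integral_infsum_int[where c = ?c, OF meas bound B]
  have i: "(\<integral>x. ?c k x \<partial>tor) = of_real (2 * pi) * (fourier_coeff f k * cnj (a k))" for k
    unfolding integral_mult_right_zero fourier_coeff_integral by (simp add: mult_ac)
  have "(\<lambda>k. 2 * pi * cmod (fourier_coeff f k * cnj (a k))) summable_on UNIV"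
    using E(2) unfolding i by (simp add: norm_mult)
  from summable_on_cmult_right[OF this, of "1 / (2 * pi)"]
  show "(\<lambda>k. cmod (fourier_coeff f k * cnj (a k))) summable_on UNIV" by simp
  have "cnj (trig a x) = (\<Sum>\<^sub>\<infinity>k. cnj (a k * cis (of_int k * x)))" for x
    unfolding trig_def by (rule infsum_cnj[symmetric])
  then have "f x * cnj (trig a x) = (\<Sum>\<^sub>\<infinity>k. ?c k x)" for x
    by (simp add: infsum_cmult_right'[symmetric] cis_cnj mult_ac)
  then show "(\<integral>x. f x * cnj (trig a x) \<partial>tor) = of_real (2 * pi) * (\<Sum>\<^sub>\<infinity>k. fourier_coeff f k * cnj (a k))"
    using E(4) unfolding i by (simp add: infsum_cmult_right')
qed

text \<open>Obtained by pairing one exponential with the series and conjugating, which reuses the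
  exchange of sum and integral just proved.\<close>

lemma fourier_coeff_trig:
  assumes a: "(\<lambda>k. cmod (a k)) summable_on UNIV"
  shows "fourier_coeff (trig a) j = a j"
proof -
  let ?e = "\<lambda>x. cis (of_int j * x)"
  have "(\<integral>x. ?e x * cnj (trig a x) \<partial>tor) = of_real (2 * pi) * (\<Sum>\<^sub>\<infinity>k. (if j = k then 1 else 0) * cnj (a k))"
    using integral_cnj_trig(2)[OF a sqint_integrable[OF sqint_cis]] by (simp add: fourier_coeff_cis)
  also have "(\<Sum>\<^sub>\<infinity>k. (if j = k then 1 else 0) * cnj (a k)) = cnj (a j)"
    by (subst infsum_cong_neutral[where T = "{j}" and g = "\<lambda>k. cnj (a k)"]) auto
  finally have 0: "cnj (\<integral>x. ?e x * cnj (trig a x) \<partial>tor) = cnj (of_real (2 * pi) * cnj (a j))" by simp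
  have 1: "(\<integral>x. cnj (?e x * cnj (trig a x)) \<partial>tor) = of_real (2 * pi) * a j"
  proof -
    have "(\<integral>x. cnj (?e x * cnj (trig a x)) \<partial>tor) = cnj (\<integral>x. ?e x * cnj (trig a x) \<partial>tor)"
      by (rule Bochner_Integration.integral_cnj)
    then show ?thesis using 0 by simp
  qed
  have 2: "(\<lambda>x. cnj (?e x * cnj (trig a x))) = (\<lambda>x. trig a x * cis (- (of_int j * x)))"
    by (simp add: cis_cnj fun_eq_iff)
  have "(\<integral>x. trig a x * cis (- (of_int j * x)) \<partial>tor) = of_real (2 * pi) * a j"
    using 1 unfolding 2 .
  then show ?thesis by (simp add: fourier_coeff_tor)
qed

lemma parseval_trig:
  assumes a: "(\<lambda>k. cmod (a k)) summable_on UNIV"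
  shows "(\<lambda>k. (cmod (a k))\<^sup>2) summable_on UNIV"
    and "(\<integral>x. (cmod (trig a x))\<^sup>2 \<partial>tor) = 2 * pi * (\<Sum>\<^sub>\<infinity>k. (cmod (a k))\<^sup>2)"
proof -
  note E = integral_cnj_trig[OF a sqint_integrable[OF sqint_trig[OF a]]]
  show s: "(\<lambda>k. (cmod (a k))\<^sup>2) summable_on UNIV"
    using E(1) by (simp add: fourier_coeff_trig[OF a] norm_mult power2_eq_square)
  have "complex_of_real (\<integral>x. (cmod (trig a x))\<^sup>2 \<partial>tor) = (\<integral>x. trig a x * cnj (trig a x) \<partial>tor)"
    unfolding integral_of_real_complex[symmetric] complex_norm_sq ..
  also have "\<dots> = of_real (2 * pi) * (\<Sum>\<^sub>\<infinity>k. of_real ((cmod (a k))\<^sup>2))"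
    unfolding E(2) fourier_coeff_trig[OF a] complex_norm_sq ..
  also have "(\<Sum>\<^sub>\<infinity>k. complex_of_real ((cmod (a k))\<^sup>2)) = of_real (\<Sum>\<^sub>\<infinity>k. (cmod (a k))\<^sup>2)"
    by (rule infsumI[OF has_sum_bounded_linear[OF bounded_linear_of_real has_sum_infsum[OF s]]])
  finally have "complex_of_real (\<integral>x. (cmod (trig a x))\<^sup>2 \<partial>tor) = of_real (2 * pi * (\<Sum>\<^sub>\<infinity>k. (cmod (a k))\<^sup>2))"
    by simp
  then show "(\<integral>x. (cmod (trig a x))\<^sup>2 \<partial>tor) = 2 * pi * (\<Sum>\<^sub>\<infinity>k. (cmod (a k))\<^sup>2)"
    by (simp only: of_real_eq_iff)
qed

subsection \<open>Completeness of the trigonometric system\<close>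

text \<open>Both signs of \<open>k\<close> occur, so the class is closed under multiplication by
  exponentials, hence by polynomials in \<open>cis x\<close>. The vanishing of integrals then
  extends to continuous functions on the circle, to indicators of closed sets and to indicators of
  Borel sets.\<close>

definition annih :: "(real \<Rightarrow> complex) \<Rightarrow> bool" where
  "annih F \<longleftrightarrow> integrable tor F \<and> (\<forall>k::int. (\<integral>x. F x * cis (of_int k * x) \<partial>tor) = 0)"

lemma annih_add:
  assumes "annih F" and "annih G" shows "annih (\<lambda>x. F x + G x)"
  using assms by (simp add: annih_def distrib_right integrable_mult_cis)

lemma annih_cmult: "annih F \<Longrightarrow> annih (\<lambda>x. c * F x)"
  by (simp add: annih_def mult.assoc)

lemma annih_cis:
  assumes "annih F" shows "annih (\<lambda>x. cis (of_int j * x) * F x)"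
  unfolding annih_def
proof (intro conjI allI)
  have i: "integrable tor F" using assms by (simp add: annih_def)
  show "integrable tor (\<lambda>x. cis (of_int j * x) * F x)"
    using integrable_mult_cis(1)[OF i, of "of_int j"] by (simp add: mult.commute)
  fix k :: int
  have "(\<lambda>x. cis (of_int j * x) * F x * cis (of_int k * x)) = (\<lambda>x. F x * cis (of_int (j + k) * x))"
  proof
    fix x
    have "cis (of_int j * x) * cis (of_int k * x) = cis (of_int (j + k) * x)"
      by (simp add: cis_mult distrib_right)
    then show "cis (of_int j * x) * F x * cis (of_int k * x) = F x * cis (of_int (j + k) * x)"
      by (metis mult.assoc mult.commute)
  qed
  moreover have "(\<integral>x. F x * cis (of_int (j + k) * x) \<partial>tor) = 0" using assms by (simp only: annih_def)
  ultimately show "(\<integral>x. cis (of_int j * x) * F x * cis (of_int k * x) \<partial>tor) = 0" by simp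
qed

lemma annih_real_polynomial:
  fixes p :: "complex \<Rightarrow> real"
  assumes "real_polynomial_function p" and "annih F"
  shows "annih (\<lambda>x. of_real (p (cis x)) * F x)"
  using assms
proof (induction p arbitrary: F rule: real_polynomial_function.induct)
  case (linear f)
  \<comment> \<open>A real linear functional on the plane is a combination of \<open>z\<close> and
    \<open>cnj z\<close>, and \<open>cnj (cis x) = cis (- x)\<close> is again an
    exponential.\<close>
  define \<alpha> where "\<alpha> = (of_real (f 1) - \<i> * of_real (f \<i>)) / 2"
  define \<beta> where "\<beta> = (of_real (f 1) + \<i> * of_real (f \<i>)) / 2"
  have "of_real (f (cis x)) = \<alpha> * cis x + \<beta> * cis (- x)" for x
  proof -
    have "cis x = cos x *\<^sub>R 1 + sin x *\<^sub>R \<i>" by (simp add: complex_eq_iff)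
    then have "f (cis x) = cos x * f 1 + sin x * f \<i>"
      using linear(1) by (simp add: bounded_linear.linear linear_add linear_scale)
    then show ?thesis by (simp add: complex_eq_iff \<alpha>_def \<beta>_def field_simps)
  qed
  then have "(\<lambda>x. of_real (f (cis x)) * F x)
      = (\<lambda>x. \<alpha> * (cis (of_int 1 * x) * F x) + \<beta> * (cis (of_int (-1) * x) * F x))"
    by (simp add: fun_eq_iff distrib_right mult.assoc)
  then show ?case
    using annih_add[OF annih_cmult[OF annih_cis[OF linear(2), of 1], of \<alpha>]
      annih_cmult[OF annih_cis[OF linear(2), of "-1"], of \<beta>]] by simp
next
  case (const c)
  then show ?case by (intro annih_cmult)
next
  case (add f g)
  then show ?case using annih_add[OF add.IH(1) add.IH(2)] by (simp add: distrib_right)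
next
  case (mult f g)
  show ?case using mult.IH(1)[OF mult.IH(2)[OF mult.prems]] by (simp add: mult.assoc)
qed

lemma annih_polynomial:
  fixes p :: "complex \<Rightarrow> complex"
  assumes "polynomial_function p" and "annih F"
  shows "annih (\<lambda>x. p (cis x) * F x)"
proof -
  have "real_polynomial_function (Re \<circ> p)" "real_polynomial_function (Im \<circ> p)"
    using assms(1) bounded_linear_Re bounded_linear_Im by (auto simp: polynomial_function_def)
  from annih_add[OF annih_real_polynomial[OF this(1) assms(2)]
      annih_cmult[OF annih_real_polynomial[OF this(2) assms(2)], of \<i>]]
  have "annih (\<lambda>x. of_real (Re (p (cis x))) * F x + \<i> * (of_real (Im (p (cis x))) * F x))" by simp
  moreover have "of_real (Re z) * w + \<i> * (of_real (Im z) * w) = z * w" for z w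
    by (simp add: complex_eq_iff algebra_simps)
  ultimately show ?thesis by simp
qed

text \<open>Functions of \<open>cis x\<close> rather than of \<open>x\<close> are approximated:
  Stone--Weierstrass applies on the circle, and products of \<open>F\<close> with polynomials in
  \<open>cis x\<close> stay in the class, so their integrals vanish.\<close>

lemma annih_continuous:
  fixes \<phi> :: "complex \<Rightarrow> complex"
  assumes "continuous_on (sphere 0 1) \<phi>" and "annih F"
  shows "(\<integral>x. \<phi> (cis x) * F x \<partial>tor) = 0"
proof -
  have F: "integrable tor F" using assms(2) by (simp add: annih_def)
  have cont\<phi>: "continuous_on S (\<lambda>x. \<phi> (cis x))" for S
    by (rule continuous_on_compose2[OF assms(1)]) (auto intro!: continuous_intros)
  have i\<phi>: "integrable tor (\<lambda>x. \<phi> (cis x) * F x)"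
  proof -
    obtain B where B: "\<forall>z\<in>sphere 0 1. cmod (\<phi> z) \<le> B"
      using compact_imp_bounded[OF compact_continuous_image[OF assms(1)]] by (auto simp: bounded_iff)
    show ?thesis
    proof (rule Bochner_Integration.integrable_bound)
      show "integrable tor (\<lambda>x. B * cmod (F x))" using F by simp
      show "(\<lambda>x. \<phi> (cis x) * F x) \<in> borel_measurable tor"
        by (intro borel_measurable_times continuous_borel_tor cont\<phi> borel_measurable_integrable[OF F])
      show "AE x in tor. norm (\<phi> (cis x) * F x) \<le> norm (B * cmod (F x))"
        using B by (intro AE_I2) (auto simp: norm_mult abs_mult intro!: mult_right_mono
          intro: order_trans[OF _ abs_ge_self])
    qed
  qed
  have *: "cmod (\<integral>x. \<phi> (cis x) * F x \<partial>tor) \<le> e * (\<integral>x. cmod (F x) \<partial>tor)" if e: "0 < e" for e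
  proof -
    obtain p where p: "polynomial_function p" "\<And>z. z \<in> sphere 0 1 \<Longrightarrow> norm (\<phi> z - p z) < e"
      using Stone_Weierstrass_polynomial_function[OF _ assms(1) e] by auto
    have a: "annih (\<lambda>x. p (cis x) * F x)" by (rule annih_polynomial[OF p(1) assms(2)])
    then have 0: "(\<integral>x. p (cis x) * F x \<partial>tor) = 0" by (auto simp: annih_def dest: spec[of _ 0])
    have ip: "integrable tor (\<lambda>x. p (cis x) * F x)" using a by (simp add: annih_def)
    have "(\<integral>x. \<phi> (cis x) * F x \<partial>tor) = (\<integral>x. \<phi> (cis x) * F x - p (cis x) * F x \<partial>tor)"
      using i\<phi> ip 0 by simp
    also have "cmod \<dots> \<le> (\<integral>x. cmod (\<phi> (cis x) * F x - p (cis x) * F x) \<partial>tor)"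
      by (rule integral_norm_bound)
    also have "\<dots> \<le> (\<integral>x. e * cmod (F x) \<partial>tor)"
    proof (rule integral_mono)
      fix x
      have "cmod (\<phi> (cis x) - p (cis x)) \<le> e" using p(2)[of "cis x"] by simp
      then show "cmod (\<phi> (cis x) * F x - p (cis x) * F x) \<le> e * cmod (F x)"
        unfolding left_diff_distrib[symmetric] norm_mult by (rule mult_right_mono) simp
    qed (use i\<phi> ip F in auto)
    finally show ?thesis by simp
  qed
  have "cmod (\<integral>x. \<phi> (cis x) * F x \<partial>tor) \<le> 0"
  proof (rule field_le_epsilon)
    fix e :: real assume e: "0 < e"
    let ?I = "\<integral>x. cmod (F x) \<partial>tor"
    have I: "0 \<le> ?I" by simp
    have "cmod (\<integral>x. \<phi> (cis x) * F x \<partial>tor) \<le> (e / (?I + 1)) * ?I"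
      by (rule *) (use e I in \<open>simp add: add_nonneg_pos\<close>)
    also have "\<dots> = e * (?I / (?I + 1))" by simp
    also have "\<dots> \<le> e * 1"
    proof (rule mult_left_mono)
      have "0 < ?I + 1" using I by linarith
      then show "?I / (?I + 1) \<le> 1" by (simp only: divide_le_eq_1_pos)
    qed (use e in simp)
    finally show "cmod (\<integral>x. \<phi> (cis x) * F x \<partial>tor) \<le> 0 + e" by simp
  qed
  then show ?thesis by simp
qed

text \<open>The functions \<open>max 0 (1 - real n * infdist z A)\<close> are continuous, bounded by
  1 and tend to the indicator because \<open>A\<close> is closed; dominated convergence carries the
  vanishing over.\<close>

lemma annih_compact:
  fixes A :: "complex set"
  assumes "compact A" and "annih F"
  shows "(\<integral>x. of_real (indicator A (cis x)) * F x \<partial>tor) = 0"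
proof (cases "A = {}")
  case False
  have F: "integrable tor F" using assms(2) by (simp add: annih_def)
  define \<phi> where "\<phi> n z = max 0 (1 - real n * infdist z A)" for n and z :: complex
  have cont: "continuous_on S (\<phi> n)" for S n
    unfolding \<phi>_def by (intro continuous_intros)
  have z: "(\<integral>x. complex_of_real (\<phi> n (cis x)) * F x \<partial>tor) = 0" for n
    by (rule annih_continuous[OF _ assms(2)]) (intro continuous_intros cont)
  have lim: "(\<lambda>n. \<phi> n z) \<longlonglongrightarrow> indicator A z" for z
  proof (cases "z \<in> A")
    case True
    then show ?thesis by (simp add: \<phi>_def)
  next
    case False
    have pos: "infdist z A > 0"
      using False \<open>A \<noteq> {}\<close> in_closed_iff_infdist_zero[OF compact_imp_closed[OF assms(1)], of z]
        infdist_nonneg[of z A] by (auto simp: less_le)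
    obtain N :: nat where N: "1 / infdist z A \<le> real N" using real_arch_simple by blast
    have "\<forall>\<^sub>F n in sequentially. \<phi> n z = 0"
      using eventually_ge_at_top[of N]
    proof eventually_elim
      case (elim n)
      then have "1 / infdist z A \<le> real n" using N by simp
      then have "1 \<le> real n * infdist z A" using pos by (simp add: field_simps)
      then show ?case by (simp add: \<phi>_def)
    qed
    then show ?thesis using False by (simp add: tendsto_eventually)
  qed
  have meas: "(\<lambda>x. complex_of_real (\<phi> n (cis x)) * F x) \<in> borel_measurable tor" for n
  proof (intro borel_measurable_times borel_measurable_integrable[OF F] continuous_borel_tor)
    show "continuous_on {0..2 * pi} (\<lambda>x. complex_of_real (\<phi> n (cis x)))"
      unfolding \<phi>_def by (intro continuous_intros)
  qed
  have lim': "(\<lambda>n. complex_of_real (\<phi> n (cis x)) * F x) \<longlonglongrightarrow> of_real (indicator A (cis x)) * F x" for x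
    by (intro tendsto_intros lim)
  have "(\<lambda>n. \<integral>x. complex_of_real (\<phi> n (cis x)) * F x \<partial>tor) \<longlonglongrightarrow> (\<integral>x. of_real (indicator A (cis x)) * F x \<partial>tor)"
  proof (rule integral_dominated_convergence[where w = "\<lambda>x. cmod (F x)"])
    show "(\<lambda>x. complex_of_real (indicator A (cis x)) * F x) \<in> borel_measurable tor"
      by (rule borel_measurable_LIMSEQ_metric[OF meas lim'])
    show "AE x in tor. norm (complex_of_real (\<phi> n (cis x)) * F x) \<le> cmod (F x)" for n
    proof (rule AE_I2)
      fix x
      have "\<bar>\<phi> n (cis x)\<bar> \<le> 1" by (simp add: \<phi>_def infdist_nonneg)
      then show "norm (complex_of_real (\<phi> n (cis x)) * F x) \<le> cmod (F x)"
        by (simp add: norm_mult mult_left_le_one_le)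
    qed
  qed (use F meas lim' in auto)
  then show ?thesis by (simp add: z LIMSEQ_const_iff)
qed simp

lemma cis_eq_cis_imp_eq:
  assumes "cis x = cis y" and "0 < x" and "x < 2 * pi" and "0 \<le> y" and "y \<le> 2 * pi"
  shows "x = y"
proof -
  have "sin x = sin y \<and> cos x = cos y" using assms(1) by (simp add: complex_eq_iff)
  then obtain n :: int where n: "x = y + 2 * pi * n" using sin_cos_eq_iff by blast
  have "2 * pi * \<bar>real_of_int n\<bar> = \<bar>x - y\<bar>" using n by (simp add: abs_mult)
  also have "\<dots> < 2 * pi * 1" using assms by auto
  finally have "\<bar>real_of_int n\<bar> < 1" using pi_gt_zero by (simp only: mult_less_cancel_left_pos)
  then have "n = 0" by simp
  then show ?thesis using n by simp
qed

lemma annih_closed: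
  assumes "closed D" and "annih F"
  shows "(\<integral>x. indicat_real D x *\<^sub>R F x \<partial>tor) = 0"
proof -
  let ?A = "cis ` (D \<inter> {0..2 * pi})"
  have F: "integrable tor F" using assms(2) by (simp add: annih_def)
  have A: "compact ?A"
    by (intro compact_continuous_image continuous_intros closed_Int_compact assms) auto
  have mc: "(\<lambda>x. indicat_real ?A (cis x)) \<in> borel_measurable tor"
  proof (rule measurable_compose[of cis tor borel])
    show "cis \<in> measurable tor borel" by (rule continuous_borel_tor) (intro continuous_intros)
    show "indicat_real ?A \<in> borel_measurable borel"
      using A by (intro borel_measurable_indicator) (simp add: compact_imp_closed)
  qed
  have mD: "indicat_real D \<in> borel_measurable tor"
    by (intro borel_tor borel_measurable_indicator) (use assms(1) in auto)
  \<comment> \<open>The map \<open>cis\<close> glues the end points of the period together, so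
    membership in \<open>D\<close> and in its image may disagree there; they form a null
    set.\<close>
  have ne: "AE x in tor. x \<noteq> 0 \<and> x \<noteq> 2 * pi"
    by (rule AE_lborel_tor) (use AE_lborel_singleton[of "0::real"] AE_lborel_singleton[of "2 * pi"] in auto)
  have "(\<integral>x. indicat_real D x *\<^sub>R F x \<partial>tor) = (\<integral>x. of_real (indicator ?A (cis x)) * F x \<partial>tor)"
  proof (rule integral_cong_AE)
    show "AE x in tor. indicat_real D x *\<^sub>R F x = of_real (indicator ?A (cis x)) * F x"
      using ne AE_space
    proof eventually_elim
      case (elim x)
      then have x: "0 < x" "x < 2 * pi" by (auto simp: space_tor)
      have "cis x \<in> ?A \<longleftrightarrow> x \<in> D"
        using x cis_eq_cis_imp_eq[OF _ x] by (auto intro!: imageI)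
      then show ?case by (simp add: indicator_def)
    qed
  qed (use mc mD F in auto)
  then show ?thesis by (simp add: annih_compact[OF A assms(2)])
qed

text \<open>Dynkin's lemma: the closed sets are stable under intersection and generate the Borel
  sets. Complements work because the integral of \<open>F\<close> itself vanishes, the case
  \<open>k = 0\<close>.\<close>

lemma annih_borel:
  assumes A: "A \<in> sets (borel :: real measure)" and F: "annih F"
  shows "(\<integral>x. indicat_real A x *\<^sub>R F x \<partial>tor) = 0"
proof -
  have iF: "integrable tor F" using F by (simp add: annih_def)
  have 0: "(\<integral>x. F x \<partial>tor) = 0" using F by (auto simp: annih_def dest: spec[of _ 0])
  have int: "integrable tor (\<lambda>x. indicat_real A x *\<^sub>R F x)" if "A \<in> sets borel" for A
    by (rule Bochner_Integration.integrable_bound[OF iF])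
       (use borel_measurable_scaleR[OF borel_tor[OF borel_measurable_indicator[OF that]]
         borel_measurable_integrable[OF iF]] in \<open>auto simp: indicator_def\<close>)
  have gen: "sets (borel :: real measure) = sigma_sets UNIV {S. closed S}"
    by (subst borel_eq_closed) simp
  have "Int_stable {S :: real set. closed S}" by (auto simp: Int_stable_def)
  moreover have "{S :: real set. closed S} \<subseteq> Pow UNIV" by simp
  moreover have "A \<in> sigma_sets UNIV {S. closed S}" using A gen by simp
  ultimately show ?thesis
  proof (induction A rule: sigma_sets_induct_disjoint[consumes 3, case_names basic empty compl union])
    case (basic A)
    then show ?case by (intro annih_closed F) simp
  next
    case empty
    then show ?case by simp
  next
    case (compl A)
    then have "A \<in> sets borel" using gen by simp
    then have i: "integrable tor (\<lambda>x. indicat_real A x *\<^sub>R F x)" by (rule int)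
    have "(\<lambda>x. indicat_real (UNIV - A) x *\<^sub>R F x) = (\<lambda>x. F x - indicat_real A x *\<^sub>R F x)"
      by (auto simp: indicator_def fun_eq_iff)
    then show ?case using i iF compl 0 by simp
  next
    case (union A)
    have s: "A i \<in> sets borel" for i using union gen by auto
    have "(\<lambda>n. \<integral>x. (\<Sum>i<n. indicat_real (A i) x *\<^sub>R F x) \<partial>tor) \<longlonglongrightarrow> (\<integral>x. indicat_real (\<Union>i. A i) x *\<^sub>R F x \<partial>tor)"
    proof (rule integral_dominated_convergence[where w = "\<lambda>x. cmod (F x)"])
      have sumind: "(\<lambda>i. indicat_real (A i) x) sums indicat_real (\<Union>i. A i) x" for x
        using union by (intro indicator_sums) (auto simp: disjoint_family_on_def)
      show "AE x in tor. (\<lambda>n. \<Sum>i<n. indicat_real (A i) x *\<^sub>R F x) \<longlonglongrightarrow> indicat_real (\<Union>i. A i) x *\<^sub>R F x"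
        using sumind by (intro AE_I2) (auto simp: sums_def scaleR_left.sum[symmetric] intro!: tendsto_intros)
      show "AE x in tor. norm (\<Sum>i<n. indicat_real (A i) x *\<^sub>R F x) \<le> cmod (F x)" for n
      proof (rule AE_I2)
        fix x
        have "(\<Sum>i<n. indicat_real (A i) x) = indicat_real (\<Union>i<n. A i) x"
          using union by (intro indicator_UN_disjoint[symmetric])
            (auto simp: disjoint_family_on_def)
        then have "(\<Sum>i<n. indicat_real (A i) x *\<^sub>R F x) = indicat_real (\<Union>i<n. A i) x *\<^sub>R F x"
          by (simp add: scaleR_left.sum[symmetric])
        then show "norm (\<Sum>i<n. indicat_real (A i) x *\<^sub>R F x) \<le> cmod (F x)"
          by (simp add: indicator_def)
      qed
      show "(\<lambda>x. indicat_real (\<Union>i. A i) x *\<^sub>R F x) \<in> borel_measurable tor"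
        using s by (intro borel_measurable_integrable[OF int]) auto
      show "(\<lambda>x. \<Sum>i<n. indicat_real (A i) x *\<^sub>R F x) \<in> borel_measurable tor" for n
        by (intro borel_measurable_sum borel_measurable_integrable[OF int] s)
    qed (use iF in simp)
    moreover have "(\<integral>x. (\<Sum>i<n. indicat_real (A i) x *\<^sub>R F x) \<partial>tor) = 0" for n
      by (subst Bochner_Integration.integral_sum) (use int[OF s] union in auto)
    ultimately show ?case by (simp add: LIMSEQ_const_iff)
  qed
qed

text \<open>The integrals over all measurable sets vanish, so real and imaginary part define the
  same density as 0.\<close>

lemma fourier_coeff_zero_imp_AE_zero:
  assumes f: "integrable tor f" and zero: "\<And>k. fourier_coeff f k = 0"
  shows "AE x in tor. f x = 0"
proof -
  have "(\<integral>x. f x * cis (of_int k * x) \<partial>tor) = 0" for k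
    using fourier_coeff_integral[of f "- k"] zero by simp
  then have an: "annih f" using f by (simp add: annih_def)
  have zero': "(\<integral>x. indicat_real A x *\<^sub>R f x \<partial>tor) = 0" if "A \<in> sets tor" for A
  proof -
    have "A \<in> sets borel" using that by (auto simp: tor_def sets_restrict_space)
    then show ?thesis by (rule annih_borel[OF _ an])
  qed
  have ind: "integrable tor (\<lambda>x. indicat_real A x *\<^sub>R f x)" if "A \<in> sets tor" for A
    by (rule integrable_mult_indicator[OF that f])
  have "AE x in tor. Re (f x) = 0"
  proof (rule density_unique_real)
    fix A assume A: "A \<in> sets tor"
    show "(LINT x:A|tor. Re (f x)) = (LINT x:A|tor. 0)"
      using integral_Re[OF ind[OF A]] zero'[OF A] by (simp add: set_lebesgue_integral_def)
  qed (use f in auto)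
  moreover have "AE x in tor. Im (f x) = 0"
  proof (rule density_unique_real)
    fix A assume A: "A \<in> sets tor"
    show "(LINT x:A|tor. Im (f x)) = (LINT x:A|tor. 0)"
      using integral_Im[OF ind[OF A]] zero'[OF A] by (simp add: set_lebesgue_integral_def)
  qed (use f in auto)
  ultimately show ?thesis by eventually_elim (simp add: complex_eq_iff)
qed

lemma fourier_coeff_eq_imp_AE_eq:
  assumes "integrable tor f" and "integrable tor g" and "\<And>k. fourier_coeff f k = fourier_coeff g k"
  shows "AE x in tor. f x = g x"
  using fourier_coeff_zero_imp_AE_zero[of "\<lambda>x. f x - g x"] assms by (simp add: fourier_coeff_diff)

subsection \<open>The Riesz--Fischer theorem and Parseval's identity\<close>

lemma borel_psum: "psum F b \<in> borel_measurable borel"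
  by (intro borel_measurable_continuous_onI continuous_psum)

lemma psum_periodic: "psum F b (x + 2 * pi) = psum F b x"
  by (simp only: psum_def cis_int_periodic)

lemma psum_diff: "finite G \<Longrightarrow> F \<subseteq> G \<Longrightarrow> psum G b x - psum F b x = psum (G - F) b x"
  unfolding psum_def by (simp add: sum_diff)

lemma integral_norm_le_sqrt:
  assumes "sqint f" and "(\<integral>x. (cmod (f x))\<^sup>2 \<partial>tor) \<le> A\<^sup>2 * (2 * pi)" and "0 \<le> A"
  shows "(\<integral>x. cmod (f x) \<partial>tor) \<le> 2 * pi * A"
proof -
  have "sqint (\<lambda>x. of_real (cmod (f x)))"
    by (rule sqint_norm_le[OF assms(1), where C = 1]) (use sqint_measurable[OF assms(1)] in auto)
  from sqint_Cauchy_Schwarz[OF this sqint_const[of 1]]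
  have "(cmod (\<integral>x. complex_of_real (cmod (f x)) \<partial>tor))\<^sup>2 \<le> (\<integral>x. (cmod (f x))\<^sup>2 \<partial>tor) * (2 * pi)"
    using integral_tor_const_real[of 1] by simp
  also have "\<dots> \<le> A\<^sup>2 * (2 * pi) * (2 * pi)" using assms(2) by (intro mult_right_mono) auto
  also have "\<dots> = (2 * pi * A)\<^sup>2" by (simp add: power2_eq_square)
  finally have "(cmod (\<integral>x. complex_of_real (cmod (f x)) \<partial>tor))\<^sup>2 \<le> (2 * pi * A)\<^sup>2" .
  then have "cmod (\<integral>x. complex_of_real (cmod (f x)) \<partial>tor) \<le> 2 * pi * A"
    by (rule power2_le_imp_le) (use assms(3) in simp)
  moreover have "cmod (\<integral>x. complex_of_real (cmod (f x)) \<partial>tor) = (\<integral>x. cmod (f x) \<partial>tor)"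
    unfolding integral_of_real_complex norm_of_real by simp
  ultimately show ?thesis by simp
qed

text \<open>The sum of the increments has a finite integral, so it is finite almost everywhere, and
  there the sequence is a telescoping absolutely convergent series.\<close>

lemma AE_convergent_of_summable_norms:
  fixes f :: "nat \<Rightarrow> 'a \<Rightarrow> complex"
  assumes int: "\<And>n. integrable M (f n)"
    and le: "\<And>n. (\<integral>x. cmod (f (Suc n) x - f n x) \<partial>M) \<le> c n" and c: "summable c"
  shows "AE x in M. convergent (\<lambda>n. f n x)"
proof -
  let ?h = "\<lambda>n x. ennreal (cmod (f (Suc n) x - f n x))"
  have meas: "?h n \<in> borel_measurable M" for n
    using int by (intro measurable_compose[OF _ measurable_ennreal] borel_measurable_norm borel_measurable_diff) auto
  have i: "(\<integral>\<^sup>+x. ?h n x \<partial>M) \<le> ennreal (c n)" for n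
    using le[of n] int by (subst nn_integral_eq_integral) (auto intro!: ennreal_leI)
  have c0: "0 \<le> c n" for n by (rule order_trans[OF _ le]) simp
  have "(\<integral>\<^sup>+x. (\<Sum>n. ?h n x) \<partial>M) = (\<Sum>n. \<integral>\<^sup>+x. ?h n x \<partial>M)"
    by (rule nn_integral_suminf) (rule meas)
  also have "\<dots> \<le> (\<Sum>n. ennreal (c n))" by (intro suminf_le i) auto
  also have "\<dots> < \<infinity>"
    using suminf_ennreal2[OF c0 c] by (simp add: ennreal_less_top)
  finally have "AE x in M. (\<Sum>n. ?h n x) \<noteq> \<infinity>"
    by (intro nn_integral_PInf_AE) (use meas in auto)
  then show ?thesis
  proof eventually_elim
    case (elim x)
    then have "summable (\<lambda>n. cmod (f (Suc n) x - f n x))"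
      by (intro summable_suminf_not_top) auto
    then have "summable (\<lambda>n. f (Suc n) x - f n x)" by (rule summable_norm_cancel)
    then have "convergent (\<lambda>n. (\<Sum>i<n. f (Suc i) x - f i x) + f 0 x)"
      by (intro convergent_add convergent_const) (simp add: summable_iff_convergent)
    moreover have "(\<Sum>i<n. f (Suc i) x - f i x) + f 0 x = f n x" for n
      using sum_lessThan_telescope[of "\<lambda>i. f i x" n] by simp
    ultimately show ?case by simp
  qed
qed

text \<open>Fatou's lemma; it yields integrability of the limit along with the bound.\<close>

lemma integral_norm_sq_limit_le:
  assumes "\<And>n. sqint (f n)" and "g \<in> borel_measurable tor" and "AE x in tor. (\<lambda>n. f n x) \<longlonglongrightarrow> g x"
    and "\<forall>\<^sub>F n in sequentially. (\<integral>x. (cmod (f n x))\<^sup>2 \<partial>tor) \<le> C"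
  shows "sqint g" and "(\<integral>x. (cmod (g x))\<^sup>2 \<partial>tor) \<le> C"
proof -
  have C0: "0 \<le> C"
  proof -
    obtain n where "(\<integral>x. (cmod (f n x))\<^sup>2 \<partial>tor) \<le> C"
      using eventually_happens[OF assms(4)] by auto
    then show ?thesis by (rule order_trans[rotated]) simp
  qed
  have mf: "(\<lambda>x. ennreal ((cmod (f n x))\<^sup>2)) \<in> borel_measurable tor" for n
    using sqint_measurable[OF assms(1)] by simp
  have "(\<integral>\<^sup>+x. ennreal ((cmod (g x))\<^sup>2) \<partial>tor) = (\<integral>\<^sup>+x. liminf (\<lambda>n. ennreal ((cmod (f n x))\<^sup>2)) \<partial>tor)"
  proof (rule nn_integral_cong_AE)
    show "AE x in tor. ennreal ((cmod (g x))\<^sup>2) = liminf (\<lambda>n. ennreal ((cmod (f n x))\<^sup>2))"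
      using assms(3)
    proof eventually_elim
      case (elim x)
      then have "(\<lambda>n. ennreal ((cmod (f n x))\<^sup>2)) \<longlonglongrightarrow> ennreal ((cmod (g x))\<^sup>2)"
        by (intro tendsto_ennrealI tendsto_intros)
      then show ?case by (rule lim_imp_Liminf[OF sequentially_bot, symmetric])
    qed
  qed
  also have "\<dots> \<le> liminf (\<lambda>n. \<integral>\<^sup>+x. ennreal ((cmod (f n x))\<^sup>2) \<partial>tor)"
    by (rule nn_integral_liminf) (rule mf)
  also have "\<dots> \<le> ennreal C"
  proof (rule Liminf_le)
    show "\<forall>\<^sub>F n in sequentially. (\<integral>\<^sup>+x. ennreal ((cmod (f n x))\<^sup>2) \<partial>tor) \<le> ennreal C"
      using assms(4)
      by eventually_elim
         (use sqint_integrable_sq[OF assms(1)] in \<open>auto simp: nn_integral_eq_integral intro!: ennreal_leI\<close>)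
  qed simp
  finally have *: "(\<integral>\<^sup>+x. ennreal ((cmod (g x))\<^sup>2) \<partial>tor) \<le> ennreal C" .
  have i: "integrable tor (\<lambda>x. (cmod (g x))\<^sup>2)"
    by (rule integrableI_bounded) (use assms(2) * in \<open>auto intro: le_less_trans simp: ennreal_less_top\<close>)
  then show "sqint g" using assms(2) by (simp add: sqint_def)
  show "(\<integral>x. (cmod (g x))\<^sup>2 \<partial>tor) \<le> C"
    using * C0 nn_integral_eq_integral[OF i] by simp
qed

lemma wl2_small_tail:
  assumes "wl2 w b B" and "\<And>k. 0 \<le> w k" and "0 < e"
  obtains n :: nat where "\<And>F. finite F \<Longrightarrow> F \<inter> {- int n..int n} = {} \<Longrightarrow> (\<Sum>k\<in>F. w k * (cmod (b k))\<^sup>2) \<le> e"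
proof -
  let ?g = "\<lambda>k. w k * (cmod (b k))\<^sup>2"
  have s: "?g summable_on UNIV" by (rule wl2_summable[OF assms(1,2)])
  obtain n where n: "\<bar>(\<Sum>k\<in>{- int n..int n}. ?g k) - (\<Sum>\<^sub>\<infinity>k. ?g k)\<bar> < e"
    using eventually_happens[OF tendstoD[OF infsum_int_LIMSEQ[OF s] assms(3)]]
    by (auto simp: dist_norm)
  show thesis
  proof (rule that)
    fix F :: "int set" assume F: "finite F" "F \<inter> {- int n..int n} = {}"
    have "(\<Sum>k\<in>F. ?g k) + (\<Sum>k\<in>{- int n..int n}. ?g k) = (\<Sum>k\<in>F \<union> {- int n..int n}. ?g k)"
      by (rule sum.union_disjoint[symmetric]) (use F in auto)
    also have "\<dots> \<le> (\<Sum>\<^sub>\<infinity>k. ?g k)"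
      by (rule finite_sum_le_infsum[OF s]) (use F assms(2) in auto)
    finally show "(\<Sum>k\<in>F. ?g k) \<le> e" using n by linarith
  qed
qed

text \<open>Partial sums along intervals with tails at most \<open>(1 / 4) ^ j\<close> have L^1
  increments at most \<open>2 * pi * (1 / 2) ^ j\<close>, hence converge almost everywhere. The last
  conclusion records approximability by trigonometric sums, for the proof of Parseval's
  identity.\<close>

lemma riesz_fischer:
  assumes b: "wl2 (\<lambda>_. 1) b B"
  obtains g where "g \<in> L2_torus" and "\<And>k. fourier_coeff g k = b k"
    and "\<And>e. 0 < e \<Longrightarrow> \<exists>F. finite F \<and> (\<integral>x. (cmod (g x - psum F b x))\<^sup>2 \<partial>tor) \<le> e"
proof -
  have "\<exists>n::nat. \<forall>F. finite F \<and> F \<inter> {- int n..int n} = {} \<longrightarrow> (\<Sum>k\<in>F. (cmod (b k))\<^sup>2) \<le> (1 / 4) ^ j" for j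
  proof -
    obtain n :: nat where "\<And>F. finite F \<Longrightarrow> F \<inter> {- int n..int n} = {} \<Longrightarrow> (\<Sum>k\<in>F. 1 * (cmod (b k))\<^sup>2) \<le> (1 / 4) ^ j"
      by (rule wl2_small_tail[OF b]) auto
    then show ?thesis by auto
  qed
  then obtain N :: "nat \<Rightarrow> nat" where
    N: "\<And>j F. finite F \<Longrightarrow> F \<inter> {- int (N j)..int (N j)} = {} \<Longrightarrow> (\<Sum>k\<in>F. (cmod (b k))\<^sup>2) \<le> (1 / 4) ^ j"
    by metis
  \<comment> \<open>The sum makes \<open>m\<close> monotone and at least \<open>N j\<close>; the
    summand \<open>j\<close> makes the intervals exhaust the integers.\<close>
  define m where "m j = j + (\<Sum>i\<le>j. N i)" for j
  define I where "I j = {- int (m j)..int (m j)}" for j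
  have mm: "m i \<le> m j" if "i \<le> j" for i j
    unfolding m_def using that by (intro add_mono sum_mono2) auto
  have finI: "finite (I j)" for j by (simp add: I_def)
  have Nm: "N j \<le> m j" for j unfolding m_def by (rule trans_le_add2, rule member_le_sum) auto
  have tail: "(\<Sum>k\<in>F. (cmod (b k))\<^sup>2) \<le> (1 / 4) ^ j" if "finite F" "F \<inter> I j = {}" for F j
    by (rule N[OF that(1)]) (use that(2) Nm[of j] in \<open>auto simp: I_def\<close>)
  define f where "f j = psum (I j) b" for j
  have sqf: "sqint (f j)" for j by (simp add: f_def sqint_psum)
  have diff: "(\<integral>x. (cmod (f i x - f j x))\<^sup>2 \<partial>tor) \<le> (1 / 4) ^ j * (2 * pi)" if "j \<le> i" for i j
  proof -
    have sub: "I j \<subseteq> I i" using mm[OF that] by (auto simp: I_def)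
    have "(\<integral>x. (cmod (f i x - f j x))\<^sup>2 \<partial>tor) = 2 * pi * (\<Sum>k\<in>I i - I j. (cmod (b k))\<^sup>2)"
      unfolding f_def psum_diff[OF finI sub] by (rule integral_norm_sq_psum) (simp add: finI)
    also have "\<dots> \<le> 2 * pi * (1 / 4) ^ j"
      by (intro mult_left_mono tail) (auto simp: finI)
    finally show ?thesis by (simp add: mult_ac)
  qed
  have conv: "AE x in tor. convergent (\<lambda>n. f n x)"
  proof (rule AE_convergent_of_summable_norms)
    show "integrable tor (f n)" for n by (rule sqint_integrable[OF sqf])
    show "(\<integral>x. cmod (f (Suc n) x - f n x) \<partial>tor) \<le> 2 * pi * (1 / 2) ^ n" for n
    proof (rule integral_norm_le_sqrt)
      show "sqint (\<lambda>x. f (Suc n) x - f n x)" by (intro sqint_diff sqf)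
      have "((1 / 2) ^ n)\<^sup>2 = (1 / 4 :: real) ^ n"
        by (simp add: power2_eq_square power_mult_distrib[symmetric])
      then show "(\<integral>x. (cmod (f (Suc n) x - f n x))\<^sup>2 \<partial>tor) \<le> ((1 / 2) ^ n)\<^sup>2 * (2 * pi)"
        using diff[of n "Suc n"] by simp
    qed simp
    show "summable (\<lambda>n. 2 * pi * (1 / 2) ^ n)" by (intro summable_mult summable_geometric) simp
  qed
  \<comment> \<open>\<open>lim\<close> is taken at every point, so Borel measurability and
    periodicity hold on the whole line, also where the limit does not exist.\<close>
  define g where "g x = lim (\<lambda>n. f n x)" for x
  have gb: "g \<in> borel_measurable borel"
    unfolding g_def by (rule borel_measurable_lim_metric) (simp add: f_def borel_psum)
  have gper: "g (x + 2 * pi) = g x" for x by (simp add: g_def f_def psum_periodic)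
  have glim: "AE x in tor. (\<lambda>n. f n x) \<longlonglongrightarrow> g x"
    using conv by eventually_elim (simp add: g_def convergent_LIMSEQ_iff)
  have gf: "sqint (\<lambda>x. g x - f j x)" "(\<integral>x. (cmod (g x - f j x))\<^sup>2 \<partial>tor) \<le> (1 / 4) ^ j * (2 * pi)" for j
  proof -
    have 1: "sqint (\<lambda>x. f n x - f j x)" for n by (intro sqint_diff sqf)
    have 2: "(\<lambda>x. g x - f j x) \<in> borel_measurable tor"
      using borel_tor[OF gb] sqint_measurable[OF sqf] by (rule borel_measurable_diff)
    have 3: "AE x in tor. (\<lambda>n. f n x - f j x) \<longlonglongrightarrow> g x - f j x"
      using glim by eventually_elim (intro tendsto_intros)
    have 4: "\<forall>\<^sub>F n in sequentially. (\<integral>x. (cmod (f n x - f j x))\<^sup>2 \<partial>tor) \<le> (1 / 4) ^ j * (2 * pi)"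
      using eventually_ge_at_top[of j] by eventually_elim (rule diff)
    show "sqint (\<lambda>x. g x - f j x)" "(\<integral>x. (cmod (g x - f j x))\<^sup>2 \<partial>tor) \<le> (1 / 4) ^ j * (2 * pi)"
      by (fact integral_norm_sq_limit_le[OF 1 2 3 4])+
  qed
  have sqg: "sqint g"
    using sqint_add[OF gf(1)[of 0] sqf[of 0]] by simp
  have zero: "(\<lambda>j. (1 / 4) ^ j :: real) \<longlonglongrightarrow> 0" by (rule LIMSEQ_realpow_zero) auto
  show thesis
  proof (rule that)
    show "g \<in> L2_torus"
      using gb gper sqg by (simp add: L2_torus_def set_integrable_tor sqint_def)
    show "fourier_coeff g k = b k" for k
    proof -
      have "\<forall>\<^sub>F j in sequentially. (cmod (fourier_coeff g k - b k))\<^sup>2 \<le> (1 / 4) ^ j"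
        using eventually_ge_at_top[of "nat \<bar>k\<bar>"]
      proof eventually_elim
        case (elim j)
        then have "nat \<bar>k\<bar> \<le> m j" by (simp add: m_def)
        then have "k \<in> I j" by (auto simp: I_def)
        then have "fourier_coeff (f j) k = b k" by (simp add: f_def fourier_coeff_psum finI)
        then have "fourier_coeff (\<lambda>x. g x - f j x) k = fourier_coeff g k - b k"
          by (simp add: fourier_coeff_diff sqint_integrable sqg sqf)
        then have "(cmod (fourier_coeff g k - b k))\<^sup>2 \<le> (\<integral>x. (cmod (g x - f j x))\<^sup>2 \<partial>tor) / (2 * pi)"
          using wl2D[OF bessel[OF gf(1)[of j]], of "{k}"] by simp
        also have "\<dots> \<le> (1 / 4) ^ j" using gf(2)[of j] by (simp add: pos_divide_le_eq)
        finally show ?case .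
      qed
      then have "(cmod (fourier_coeff g k - b k))\<^sup>2 \<le> 0"
        by (intro tendsto_lowerbound[OF zero]) auto
      then show ?thesis by simp
    qed
    fix e :: real assume e: "0 < e"
    have "(\<lambda>j. (1 / 4) ^ j * (2 * pi)) \<longlonglongrightarrow> 0 * (2 * pi)" by (intro tendsto_intros zero)
    then have "\<forall>\<^sub>F j in sequentially. (1 / 4) ^ j * (2 * pi) < e"
      using e by (intro order_tendstoD) auto
    then obtain j where "(1 / 4) ^ j * (2 * pi) < e" by (auto dest: eventually_happens)
    then show "\<exists>F. finite F \<and> (\<integral>x. (cmod (g x - psum F b x))\<^sup>2 \<partial>tor) \<le> e"
      using gf(2)[of j] finI[of j] by (intro exI[of _ "I j"]) (auto simp: f_def)
  qed
qed

text \<open>Riesz--Fischer produces a function with the coefficients of \<open>f\<close> that is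
  approximable by trigonometric sums; by completeness it equals \<open>f\<close> almost everywhere.
  The other inequality is Bessel's.\<close>

lemma parseval:
  assumes f: "sqint f"
  shows "(\<integral>x. (cmod (f x))\<^sup>2 \<partial>tor) = 2 * pi * (\<Sum>\<^sub>\<infinity>k. (cmod (fourier_coeff f k))\<^sup>2)"
proof -
  let ?c = "fourier_coeff f"
  have one: "wl2 (\<lambda>_. 1) ?c ((\<integral>x. (cmod (f x))\<^sup>2 \<partial>tor) / (2 * pi))" by (rule bessel[OF f])
  have sm: "(\<lambda>k. (cmod (?c k))\<^sup>2) summable_on UNIV" using wl2_summable[OF one] by simp
  obtain g where g: "g \<in> L2_torus" "\<And>k. fourier_coeff g k = ?c k"
    "\<And>e. 0 < e \<Longrightarrow> \<exists>F. finite F \<and> (\<integral>x. (cmod (g x - psum F ?c x))\<^sup>2 \<partial>tor) \<le> e"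
    using riesz_fischer[OF one] by metis
  have sg: "sqint g" by (rule L2_torus_sqint[OF g(1)])
  have "AE x in tor. g x = f x"
    by (rule fourier_coeff_eq_imp_AE_eq) (auto simp: sqint_integrable sg f g(2))
  then have eq: "(\<integral>x. (cmod (g x))\<^sup>2 \<partial>tor) = (\<integral>x. (cmod (f x))\<^sup>2 \<partial>tor)"
    by (intro integral_cong_AE) (use sqint_measurable[OF sg] sqint_measurable[OF f] in auto)
  have "(\<integral>x. (cmod (f x))\<^sup>2 \<partial>tor) \<le> 2 * pi * (\<Sum>\<^sub>\<infinity>k. (cmod (?c k))\<^sup>2)"
  proof (rule field_le_epsilon)
    fix e :: real assume "0 < e"
    then obtain F where F: "finite F" "(\<integral>x. (cmod (g x - psum F ?c x))\<^sup>2 \<partial>tor) \<le> e" using g(3) by blast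
    have "(\<integral>x. (cmod (g x))\<^sup>2 \<partial>tor) \<le> 2 * pi * (\<Sum>k\<in>F. (cmod (?c k))\<^sup>2) + e"
      using integral_norm_sq_diff_psum[OF sg F(1), of ?c] F(2) g(2) by simp
    also have "\<dots> \<le> 2 * pi * (\<Sum>\<^sub>\<infinity>k. (cmod (?c k))\<^sup>2) + e"
      by (intro add_right_mono mult_left_mono finite_sum_le_infsum sm) (use F in auto)
    finally show "(\<integral>x. (cmod (f x))\<^sup>2 \<partial>tor) \<le> 2 * pi * (\<Sum>\<^sub>\<infinity>k. (cmod (?c k))\<^sup>2) + e" by (simp add: eq)
  qed
  moreover have "(\<Sum>\<^sub>\<infinity>k. (cmod (?c k))\<^sup>2) \<le> (\<integral>x. (cmod (f x))\<^sup>2 \<partial>tor) / (2 * pi)"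
    using wl2_infsum_le[OF one] by simp
  ultimately show ?thesis by (simp add: field_simps)
qed

lemma psum_L2_LIMSEQ:
  assumes f: "sqint f"
  shows "(\<lambda>n. \<integral>x. (cmod (f x - psum {- int n..int n} (fourier_coeff f) x))\<^sup>2 \<partial>tor) \<longlonglongrightarrow> 0"
proof -
  let ?c = "fourier_coeff f"
  have sm: "(\<lambda>k. (cmod (?c k))\<^sup>2) summable_on UNIV" using wl2_summable[OF bessel[OF f]] by simp
  have "(\<lambda>n. 2 * pi * (\<Sum>\<^sub>\<infinity>k. (cmod (?c k))\<^sup>2) - 2 * pi * (\<Sum>k\<in>{- int n..int n}. (cmod (?c k))\<^sup>2))
      \<longlonglongrightarrow> 2 * pi * (\<Sum>\<^sub>\<infinity>k. (cmod (?c k))\<^sup>2) - 2 * pi * (\<Sum>\<^sub>\<infinity>k. (cmod (?c k))\<^sup>2)"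
    by (intro tendsto_intros infsum_int_LIMSEQ sm)
  then show ?thesis by (simp add: integral_norm_sq_diff_psum[OF f] parseval[OF f])
qed

lemma psum_weak_LIMSEQ:
  assumes f: "sqint f" and h: "sqint h"
  shows "(\<lambda>n. \<integral>x. psum {- int n..int n} (fourier_coeff f) x * h x \<partial>tor) \<longlonglongrightarrow> (\<integral>x. f x * h x \<partial>tor)"
proof -
  let ?p = "\<lambda>n. psum {- int n..int n} (fourier_coeff f)"
  let ?H = "\<integral>x. (cmod (h x))\<^sup>2 \<partial>tor"
  have le: "cmod ((\<integral>x. f x * h x \<partial>tor) - (\<integral>x. ?p n x * h x \<partial>tor))
      \<le> sqrt ((\<integral>x. (cmod (f x - ?p n x))\<^sup>2 \<partial>tor) * ?H)" for n
  proof -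
    have "(\<integral>x. f x * h x \<partial>tor) - (\<integral>x. ?p n x * h x \<partial>tor) = (\<integral>x. (f x - ?p n x) * h x \<partial>tor)"
      unfolding left_diff_distrib
      by (rule Bochner_Integration.integral_diff[symmetric]) (intro sqint_mult_integrable f h sqint_psum)+
    then show ?thesis
      using sqint_Cauchy_Schwarz[OF sqint_diff[OF f sqint_psum] h] by (simp add: real_le_rsqrt)
  qed
  have "(\<lambda>n. sqrt ((\<integral>x. (cmod (f x - ?p n x))\<^sup>2 \<partial>tor) * ?H)) \<longlonglongrightarrow> sqrt (0 * ?H)"
    by (intro tendsto_intros psum_L2_LIMSEQ f)
  then have "(\<lambda>n. sqrt ((\<integral>x. (cmod (f x - ?p n x))\<^sup>2 \<partial>tor) * ?H)) \<longlonglongrightarrow> 0" by simp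
  then have "(\<lambda>n. (\<integral>x. f x * h x \<partial>tor) - (\<integral>x. ?p n x * h x \<partial>tor)) \<longlonglongrightarrow> 0"
    by (rule Lim_null_comparison[rotated]) (use le in \<open>auto intro!: always_eventually\<close>)
  from tendsto_diff[OF tendsto_const[of "\<integral>x. f x * h x \<partial>tor"] this] show ?thesis by simp
qed

subsection \<open>The Sobolev space in terms of Fourier coefficients\<close>

lemma torus_test_function_cis: "torus_test_function (\<lambda>x. cis (- (of_int k * x)))"
  unfolding torus_test_function_def
proof (intro conjI allI exI)
  let ?D = "\<lambda>n x. (- \<i> * of_int k) ^ n * cis (- (of_int k * x))"
  show "cis (- (of_int k * (x + 2 * pi))) = cis (- (of_int k * x))" for x
    using cis_int_periodic[of "- k" x] by simp
  show "?D 0 = (\<lambda>x. cis (- (of_int k * x)))" by simp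
  show "(?D n has_vector_derivative ?D (Suc n) x) (at x)" for n x
    using has_vector_derivative_mult_right[OF has_vector_derivative_cis[of "- of_int k" x UNIV],
      of "(- \<i> * of_int k) ^ n"] by (simp add: mult_ac)
qed

lemma torus_test_function_derivs:
  assumes "torus_test_function \<phi>"
  shows "(\<phi> has_vector_derivative vector_derivative \<phi> (at x)) (at x)"
    and "continuous_on S \<phi>" and "continuous_on S (\<lambda>x. vector_derivative \<phi> (at x))"
    and "\<phi> (x + 2 * pi) = \<phi> x"
proof -
  obtain D where D: "D 0 = \<phi>" "\<And>n x. (D n has_vector_derivative D (Suc n) x) (at x)"
    and per: "\<And>x. \<phi> (x + 2 * pi) = \<phi> x"
    using assms by (auto simp: torus_test_function_def)
  have cont: "continuous_on S (D n)" for n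
    using D(2) by (intro continuous_at_imp_continuous_on) (auto intro: has_vector_derivative_continuous)
  have vd: "vector_derivative \<phi> (at x) = D 1 x" for x
    using D(2)[of 0 x] D(1) by (simp add: vector_derivative_at)
  show "(\<phi> has_vector_derivative vector_derivative \<phi> (at x)) (at x)"
    using D(2)[of 0 x] by (simp add: vd D(1))
  show "continuous_on S \<phi>" using cont[of 0] D(1) by simp
  show "continuous_on S (\<lambda>x. vector_derivative \<phi> (at x))" unfolding vd by (rule cont)
  show "\<phi> (x + 2 * pi) = \<phi> x" by (rule per)
qed

lemma has_vector_derivative_psum:
  "(psum F a has_vector_derivative psum F (\<lambda>k. \<i> * of_int k * a k) x) (at x within S)"
proof -
  have "((\<lambda>x. \<Sum>k\<in>F. a k * cis (of_int k * x)) has_vector_derivative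
      (\<Sum>k\<in>F. a k * (\<i> * of_real (of_int k) * cis (of_int k * x)))) (at x within S)"
    by (intro has_vector_derivative_sum has_vector_derivative_mult_right has_vector_derivative_cis)
  then show ?thesis by (simp add: psum_def[abs_def] mult_ac)
qed

lemma psum_integration_by_parts:
  assumes \<phi>: "torus_test_function \<phi>"
  shows "(\<integral>x. psum F a x * vector_derivative \<phi> (at x) \<partial>tor) = - (\<integral>x. psum F (\<lambda>k. \<i> * of_int k * a k) x * \<phi> x \<partial>tor)"
proof -
  let ?b = "\<lambda>k. \<i> * of_int k * a k" and ?d = "\<lambda>x. vector_derivative \<phi> (at x)"
  note T = torus_test_function_derivs[OF \<phi>]
  have c: "continuous_on S (\<lambda>x. psum F a x * ?d x)" "continuous_on S (\<lambda>x. psum F ?b x * \<phi> x)" for S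
    by (intro continuous_intros continuous_psum T)+
  have "(LBINT x. indicator {0..2 * pi} x *\<^sub>R (psum F a x * ?d x + psum F ?b x * \<phi> x))
      = psum F a (2 * pi) * \<phi> (2 * pi) - psum F a 0 * \<phi> 0"
  proof (rule integral_FTC_atLeastAtMost)
    show "((\<lambda>x. psum F a x * \<phi> x) has_vector_derivative psum F a x * ?d x + psum F ?b x * \<phi> x)
        (at x within {0..2 * pi})" for x
      by (rule has_vector_derivative_mult[OF has_vector_derivative_psum
        has_vector_derivative_at_within[OF T(1)]])
  qed (auto intro!: continuous_on_add c)
  also have "\<dots> = 0" using psum_periodic[of F a 0] T(4)[of 0] by simp
  finally have "(\<integral>x. psum F a x * ?d x + psum F ?b x * \<phi> x \<partial>tor) = 0"
    by (simp add: set_integral_tor[symmetric] set_lebesgue_integral_def)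
  then show ?thesis using c by (simp add: continuous_integrable_tor eq_neg_iff_add_eq_0)
qed

lemma is_weak_deriv_tor:
  "is_weak_deriv f g \<longleftrightarrow> (\<forall>\<phi>. torus_test_function \<phi> \<longrightarrow>
     (\<integral>x. f x * vector_derivative \<phi> (at x) \<partial>tor) = - (\<integral>x. g x * \<phi> x \<partial>tor))"
  by (simp add: is_weak_deriv_def set_integral_tor)

lemma fourier_coeff_weak_deriv:
  assumes "is_weak_deriv f g"
  shows "fourier_coeff g k = \<i> * of_int k * fourier_coeff f k"
proof -
  have "vector_derivative (\<lambda>x. cis (- (of_int k * x))) (at x) = (- \<i> * of_int k) * cis (- (of_int k * x))" for x
    using has_vector_derivative_cis[of "- of_int k" x UNIV]
    by (intro vector_derivative_at) simp
  then have "(\<integral>x. (- \<i> * of_int k) * (f x * cis (- (of_int k * x))) \<partial>tor)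
      = - (\<integral>x. g x * cis (- (of_int k * x)) \<partial>tor)"
    using assms[unfolded is_weak_deriv_tor, rule_format, OF torus_test_function_cis[of k]]
    by (simp add: mult_ac)
  then have "(- \<i> * of_int k) * (of_real (2 * pi) * fourier_coeff f k) = - (of_real (2 * pi) * fourier_coeff g k)"
    unfolding integral_mult_right_zero fourier_coeff_integral .
  then have "of_real (2 * pi) * (\<i> * of_int k * fourier_coeff f k) = of_real (2 * pi) * fourier_coeff g k"
    by (simp add: mult_ac)
  then show ?thesis by (simp only: mult_cancel_left) simp
qed

text \<open>Exponentials are test functions, which gives one direction. Conversely, integration by
  parts holds for partial sums, and both sides converge because the test function and its derivative
  are square integrable.\<close>

lemma is_weak_deriv_iff:
  assumes f: "sqint f" and g: "sqint g"
  shows "is_weak_deriv f g \<longleftrightarrow> (\<forall>k. fourier_coeff g k = \<i> * of_int k * fourier_coeff f k)"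
proof (intro iffI allI)
  fix k assume "is_weak_deriv f g"
  then show "fourier_coeff g k = \<i> * of_int k * fourier_coeff f k" by (rule fourier_coeff_weak_deriv)
next
  assume eq: "\<forall>k. fourier_coeff g k = \<i> * of_int k * fourier_coeff f k"
  show "is_weak_deriv f g"
    unfolding is_weak_deriv_tor
  proof (intro allI impI)
    fix \<phi> assume \<phi>: "torus_test_function \<phi>"
    let ?d = "\<lambda>x. vector_derivative \<phi> (at x)"
    note T = torus_test_function_derivs[OF \<phi>]
    have "fourier_coeff g = (\<lambda>k. \<i> * of_int k * fourier_coeff f k)" using eq by auto
    then have "(\<lambda>n. \<integral>x. psum {- int n..int n} (\<lambda>k. \<i> * of_int k * fourier_coeff f k) x * \<phi> x \<partial>tor) \<longlonglongrightarrow> (\<integral>x. g x * \<phi> x \<partial>tor)"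
      using psum_weak_LIMSEQ[OF g sqint_continuous[OF T(2)]] by simp
    from tendsto_minus[OF this]
    have "(\<lambda>n. \<integral>x. psum {- int n..int n} (fourier_coeff f) x * ?d x \<partial>tor) \<longlonglongrightarrow> - (\<integral>x. g x * \<phi> x \<partial>tor)"
      by (simp add: psum_integration_by_parts[OF \<phi>])
    from LIMSEQ_unique[OF psum_weak_LIMSEQ[OF f sqint_continuous[OF T(3)]] this]
    show "(\<integral>x. f x * ?d x \<partial>tor) = - (\<integral>x. g x * \<phi> x \<partial>tor)" .
  qed
qed

lemma wl2_sob_split:
  assumes "wl2 (\<lambda>_. 1) a A" and "wl2 (\<lambda>_. 1) (\<lambda>k. \<i> * of_int k * a k) B"
  shows "wl2 sob a (A + B)"
  unfolding wl2_def
proof (intro allI impI)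
  fix F :: "int set" assume F: "finite F"
  show "(\<Sum>k\<in>F. sob k * (cmod (a k))\<^sup>2) \<le> A + B"
    using wl2D[OF assms(1) F] wl2D[OF assms(2) F]
    by (simp add: sob_def distrib_right sum.distrib norm_mult power_mult_distrib)
qed

lemma wl2_deriv:
  assumes "wl2 sob a B" shows "wl2 (\<lambda>_. 1) (\<lambda>k. \<i> * of_int k * a k) B"
  unfolding wl2_def
proof (intro allI impI)
  fix F :: "int set" assume F: "finite F"
  have "(\<Sum>k\<in>F. 1 * (cmod (\<i> * of_int k * a k))\<^sup>2) \<le> (\<Sum>k\<in>F. sob k * (cmod (a k))\<^sup>2)"
    by (intro sum_mono) (simp add: sob_def norm_mult power_mult_distrib distrib_right)
  with wl2D[OF assms F] show "(\<Sum>k\<in>F. 1 * (cmod (\<i> * of_int k * a k))\<^sup>2) \<le> B" by simp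
qed

lemma weak_deriv_props:
  assumes "f \<in> H1_torus"
  shows "weak_deriv f \<in> L2_torus" and "is_weak_deriv f (weak_deriv f)"
proof -
  have "\<exists>g. g \<in> L2_torus \<and> is_weak_deriv f g" using assms by (auto simp: H1_torus_def)
  from someI_ex[OF this] show "weak_deriv f \<in> L2_torus" "is_weak_deriv f (weak_deriv f)"
    by (auto simp: weak_deriv_def)
qed

text \<open>For the converse the weak derivative is built by Riesz--Fischer from the coefficients i
  k f_k.\<close>

lemma H1_torus_iff: "f \<in> H1_torus \<longleftrightarrow> f \<in> L2_torus \<and> (\<exists>B. wl2 sob (fourier_coeff f) B)"
proof (intro iffI conjI)
  assume f: "f \<in> H1_torus"
  then show "f \<in> L2_torus" by (simp add: H1_torus_def)
  note w = weak_deriv_props[OF f]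
  have "fourier_coeff (weak_deriv f) = (\<lambda>k. \<i> * of_int k * fourier_coeff f k)"
    using fourier_coeff_weak_deriv[OF w(2)] by auto
  then show "\<exists>B. wl2 sob (fourier_coeff f) B"
    using wl2_sob_split[OF bessel[OF L2_torus_sqint[OF \<open>f \<in> L2_torus\<close>]]] bessel[OF L2_torus_sqint[OF w(1)]]
    by auto
next
  assume a: "f \<in> L2_torus \<and> (\<exists>B. wl2 sob (fourier_coeff f) B)"
  then obtain B where B: "wl2 sob (fourier_coeff f) B" by blast
  obtain g where g: "g \<in> L2_torus" "\<And>k. fourier_coeff g k = \<i> * of_int k * fourier_coeff f k"
    using riesz_fischer[OF wl2_deriv[OF B]] by metis
  then have "is_weak_deriv f g" using a by (simp add: is_weak_deriv_iff L2_torus_sqint)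
  then show "f \<in> H1_torus" using a g by (auto simp: H1_torus_def)
qed

lemma weak_deriv_norm:
  assumes f: "f \<in> H1_torus"
  shows "integrable tor (\<lambda>x. (cmod (weak_deriv f x))\<^sup>2)"
    and "(\<integral>x. (cmod (weak_deriv f x))\<^sup>2 \<partial>tor) = 2 * pi * (\<Sum>\<^sub>\<infinity>k. (of_int k)\<^sup>2 * (cmod (fourier_coeff f k))\<^sup>2)"
proof -
  note w = weak_deriv_props[OF f]
  show "integrable tor (\<lambda>x. (cmod (weak_deriv f x))\<^sup>2)"
    by (rule sqint_integrable_sq[OF L2_torus_sqint[OF w(1)]])
  show "(\<integral>x. (cmod (weak_deriv f x))\<^sup>2 \<partial>tor) = 2 * pi * (\<Sum>\<^sub>\<infinity>k. (of_int k)\<^sup>2 * (cmod (fourier_coeff f k))\<^sup>2)"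
    using parseval[OF L2_torus_sqint[OF w(1)]]
    by (simp add: fourier_coeff_weak_deriv[OF w(2)] norm_mult power_mult_distrib)
qed

lemma H1_norm_fourier:
  assumes f: "f \<in> H1_torus"
  shows "H1_norm f = sqrt (2 * pi * (\<Sum>\<^sub>\<infinity>k. sob k * (cmod (fourier_coeff f k))\<^sup>2))"
proof -
  have L: "sqint f" using f by (auto simp: H1_torus_def L2_torus_sqint)
  obtain B where B: "wl2 sob (fourier_coeff f) B" using f by (auto simp: H1_torus_iff)
  have s1: "(\<lambda>k. (cmod (fourier_coeff f k))\<^sup>2) summable_on UNIV"
    using wl2_summable[OF wl2_sob_one[OF B]] by simp
  have s2: "(\<lambda>k. (of_int k)\<^sup>2 * (cmod (fourier_coeff f k))\<^sup>2) summable_on UNIV"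
    using wl2_summable[OF wl2_deriv[OF B]] by (simp add: norm_mult power_mult_distrib)
  have "(\<integral>x. (cmod (f x))\<^sup>2 + (cmod (weak_deriv f x))\<^sup>2 \<partial>tor)
      = 2 * pi * (\<Sum>\<^sub>\<infinity>k. (cmod (fourier_coeff f k))\<^sup>2) + 2 * pi * (\<Sum>\<^sub>\<infinity>k. (of_int k)\<^sup>2 * (cmod (fourier_coeff f k))\<^sup>2)"
    using sqint_integrable_sq[OF L] weak_deriv_norm[OF f] parseval[OF L] by simp
  also have "\<dots> = 2 * pi * (\<Sum>\<^sub>\<infinity>k. sob k * (cmod (fourier_coeff f k))\<^sup>2)"
    by (simp add: sob_def distrib_right distrib_left infsum_add[OF s1 s2])
  finally show ?thesis by (simp add: H1_norm_def set_integral_tor)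
qed

lemma H1_torus_AE_trig:
  assumes f: "f \<in> H1_torus"
  shows "AE x in tor. f x = trig (fourier_coeff f) x"
proof -
  have L: "sqint f" using f by (auto simp: H1_torus_def L2_torus_sqint)
  obtain B where B: "wl2 sob (fourier_coeff f) B" using f by (auto simp: H1_torus_iff)
  note s = wl2_sob_abs_summable[OF B]
  show ?thesis
    by (rule fourier_coeff_eq_imp_AE_eq) (auto simp: L s sqint_integrable sqint_trig fourier_coeff_trig)
qed

lemma trig_L2_torus:
  assumes "(\<lambda>k. cmod (a k)) summable_on UNIV"
  shows "trig a \<in> L2_torus"
  using sqint_integrable_sq[OF sqint_trig[OF assms]] continuous_trig[OF assms]
  by (simp add: L2_torus_def trig_periodic set_integrable_tor borel_measurable_continuous_onI)

lemma trig_H1_torus: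
  assumes "wl2 sob a B"
  shows "trig a \<in> H1_torus" and "fourier_coeff (trig a) = a"
proof -
  note s = wl2_sob_abs_summable[OF assms]
  show "fourier_coeff (trig a) = a" by (simp add: fun_eq_iff fourier_coeff_trig[OF s])
  then show "trig a \<in> H1_torus" using trig_L2_torus[OF s] assms by (auto simp: H1_torus_iff)
qed

lemma L2_torus_diff:
  assumes "f \<in> L2_torus" and "g \<in> L2_torus"
  shows "(\<lambda>x. f x - g x) \<in> L2_torus"
  using assms sqint_integrable_sq[OF sqint_diff[OF L2_torus_sqint[OF assms(1)] L2_torus_sqint[OF assms(2)]]]
  by (auto simp: L2_torus_def set_integrable_tor)

lemma H1_torus_diff:
  assumes "f \<in> H1_torus" and "g \<in> H1_torus"
  shows "(\<lambda>x. f x - g x) \<in> H1_torus"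
    and "fourier_coeff (\<lambda>x. f x - g x) k = fourier_coeff f k - fourier_coeff g k"
proof -
  have L: "f \<in> L2_torus" "g \<in> L2_torus" using assms by (auto simp: H1_torus_iff)
  have eq: "fourier_coeff (\<lambda>x. f x - g x) k = fourier_coeff f k - fourier_coeff g k" for k
    using L by (intro fourier_coeff_diff sqint_integrable L2_torus_sqint)
  then show "fourier_coeff (\<lambda>x. f x - g x) k = fourier_coeff f k - fourier_coeff g k" .
  obtain A B where "wl2 sob (fourier_coeff f) A" "wl2 sob (fourier_coeff g) B"
    using assms by (auto simp: H1_torus_iff)
  from wl2_diff[OF this sob_nonneg]
  have "wl2 sob (fourier_coeff (\<lambda>x. f x - g x)) (2 * A + 2 * B)" by (simp only: eq[abs_def])
  then show "(\<lambda>x. f x - g x) \<in> H1_torus"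
    using L2_torus_diff[OF L] by (auto simp: H1_torus_iff)
qed

subsection \<open>Integral estimates\<close>

definition antider :: "(real \<Rightarrow> complex) \<Rightarrow> real \<Rightarrow> complex" where
  "antider g t = (LBINT \<tau>=ereal 0..ereal t. g \<tau>)"

lemma antider_eq_diff:
  assumes "continuous_on {min 0 t..max 0 t} g"
    and "\<And>x. min 0 t \<le> x \<Longrightarrow> x \<le> max 0 t \<Longrightarrow> (F has_vector_derivative g x) (at x)"
  shows "antider g t = F t - F 0"
  unfolding antider_def zero_ereal_def[symmetric]
  using interval_integral_FTC_finite[of 0 t g F] assms
  by (auto simp: zero_ereal_def intro: has_vector_derivative_at_within)

lemma antider_0 [simp]: "antider g 0 = 0"
  by (simp add: antider_def)

lemma antider_has_vector_derivative:
  assumes g: "continuous_on UNIV g"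
  shows "(antider g has_vector_derivative g t) (at t)"
proof -
  \<comment> \<open>With this window both \<open>0\<close> and \<open>t\<close> are interior points,
    whatever the sign of \<open>t\<close>.\<close>
  define T where "T = \<bar>t\<bar> + 1"
  define F where "F x = integral {-T..x} g" for x
  have F: "(F has_vector_derivative g x) (at x)" if "x \<in> {-T<..<T}" for x
  proof -
    have "(F has_vector_derivative g x) (at x within {-T..T})"
      unfolding F_def using that
      by (intro integral_has_vector_derivative continuous_on_subset[OF g]) auto
    then show ?thesis
      using that at_within_interior[of x "{-T..T}"] by simp
  qed
  have eq: "antider g x = F x - F 0" if "x \<in> {-T<..<T}" for x
    by (rule antider_eq_diff) (use that in \<open>auto intro!: F continuous_on_subset[OF g]\<close>)
  have t: "t \<in> {-T<..<T}" by (auto simp: T_def)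
  have "((\<lambda>x. F x - F 0) has_vector_derivative g t - 0) (at t)"
    by (intro has_vector_derivative_diff F t has_vector_derivative_const)
  then have "((\<lambda>x. F x - F 0) has_vector_derivative g t) (at t)" by simp
  then show ?thesis
    by (rule has_vector_derivative_transform_within_open[where S = "{-T<..<T}"]) (use t eq in auto)
qed

text \<open>The variance of \<open>g\<close> about its mean \<open>M\<close> over the unit interval
  is nonnegative.\<close>

lemma norm_integral_sq_le:
  fixes g :: "real \<Rightarrow> complex"
  assumes g: "continuous_on {0..1} g"
  shows "(cmod (integral {0..1} g))\<^sup>2 \<le> integral {0..1} (\<lambda>r. (cmod (g r))\<^sup>2)"
proof -
  define M where "M = integral {0..1} g"
  have i1: "(\<lambda>r. (cmod (g r))\<^sup>2) integrable_on {0..1}" and i2: "(\<lambda>r. g r \<bullet> M) integrable_on {0..1}"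
    and ig: "g integrable_on {0..1}"
    by (intro integrable_continuous_real continuous_intros g)+
  have ip: "integral {0..1} (\<lambda>r. g r \<bullet> M) = M \<bullet> M"
    using integral_linear[OF ig bounded_linear_inner_left[of M]] by (simp add: M_def o_def)
  have "0 \<le> integral {0..1} (\<lambda>r. (cmod (g r - M))\<^sup>2)"
    by (rule integral_nonneg) (auto intro!: integrable_continuous_real continuous_intros g)
  also have "(\<lambda>r. (cmod (g r - M))\<^sup>2) = (\<lambda>r. (cmod (g r))\<^sup>2 - 2 * (g r \<bullet> M) + M \<bullet> M)"
    by (simp add: fun_eq_iff power2_norm_eq_inner inner_diff inner_commute)
  also have "integral {0..1} \<dots> = integral {0..1} (\<lambda>r. (cmod (g r))\<^sup>2) - 2 * (M \<bullet> M) + M \<bullet> M"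
  proof (rule integral_unique)
    have i2': "((\<lambda>r. g r \<bullet> M) has_integral M \<bullet> M) {0..1}" using i2 ip by (simp add: has_integral_integral)
    have "((\<lambda>r::real. M \<bullet> M) has_integral M \<bullet> M) {0..1}" using has_integral_const_real[of "M \<bullet> M" 0 1] by simp
    then show "((\<lambda>r. (cmod (g r))\<^sup>2 - 2 * (g r \<bullet> M) + M \<bullet> M) has_integral
        integral {0..1} (\<lambda>r. (cmod (g r))\<^sup>2) - 2 * (M \<bullet> M) + M \<bullet> M) {0..1}"
      by (intro has_integral_add has_integral_diff has_integral_mult_right integrable_integral i1 i2')
  qed
  finally show ?thesis unfolding M_def[symmetric] power2_norm_eq_inner by simp
qed

text \<open>By the Cauchy--Schwarz inequality; parametrising the segment from \<open>s\<close> to \<open>t\<close> by the unit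
  interval treats both orientations of time at once.\<close>

lemma weighted_increment_le:
  fixes U g :: "int \<Rightarrow> real \<Rightarrow> complex"
  assumes F: "finite F" and w: "\<And>k. 0 \<le> w k"
    and U: "\<And>k r. r \<in> {0..1} \<Longrightarrow> (U k has_vector_derivative g k (s + r * (t - s))) (at (s + r * (t - s)))"
    and g: "\<And>k. continuous_on {0..1} (\<lambda>r. g k (s + r * (t - s)))"
    and b: "\<And>r. r \<in> {0..1} \<Longrightarrow> (\<Sum>k\<in>F. w k * (cmod (g k (s + r * (t - s))))\<^sup>2) \<le> b r"
    and I: "(b has_integral I) {0..1}"
  shows "(\<Sum>k\<in>F. w k * (cmod (U k t - U k s))\<^sup>2) \<le> (t - s)\<^sup>2 * I"
proof -
  let ?h = "\<lambda>k r. g k (s + r * (t - s))"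
  have eq: "U k t - U k s = of_real (t - s) * integral {0..1} (?h k)" for k
  proof -
    have "((\<lambda>r. (t - s) *\<^sub>R ?h k r) has_integral (U k (s + 1 * (t - s)) - U k (s + 0 * (t - s)))) {0..1}"
    proof (rule fundamental_theorem_of_calculus)
      fix r :: real assume r: "r \<in> {0..1}"
      have "((\<lambda>r. s + r * (t - s)) has_vector_derivative (t - s)) (at r within {0..1})"
        by (auto intro!: derivative_eq_intros simp: has_real_derivative_iff_has_vector_derivative[symmetric])
      from vector_diff_chain_within[OF this has_vector_derivative_at_within[OF U[OF r]]]
      show "((\<lambda>r. U k (s + r * (t - s))) has_vector_derivative (t - s) *\<^sub>R ?h k r) (at r within {0..1})"
        by (simp add: o_def)
    qed simp
    from integral_unique[OF this] show ?thesis by (simp add: scaleR_conv_of_real)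
  qed
  have ih: "(\<lambda>r. w k * (cmod (?h k r))\<^sup>2) integrable_on {0..1}" for k
    by (intro integrable_continuous_real continuous_intros g)
  have "(\<Sum>k\<in>F. w k * (cmod (U k t - U k s))\<^sup>2)
      = (t - s)\<^sup>2 * (\<Sum>k\<in>F. w k * (cmod (integral {0..1} (?h k)))\<^sup>2)"
    by (simp add: eq norm_mult power_mult_distrib sum_distrib_left mult_ac del: of_real_diff)
  also have "\<dots> \<le> (t - s)\<^sup>2 * (\<Sum>k\<in>F. w k * integral {0..1} (\<lambda>r. (cmod (?h k r))\<^sup>2))"
    by (intro mult_left_mono sum_mono norm_integral_sq_le g w) auto
  also have "(\<Sum>k\<in>F. w k * integral {0..1} (\<lambda>r. (cmod (?h k r))\<^sup>2))
      = integral {0..1} (\<lambda>r. \<Sum>k\<in>F. w k * (cmod (?h k r))\<^sup>2)"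
    using ih F by (simp add: integral_sum)
  also have "\<dots> \<le> I"
    by (rule has_integral_le[OF integrable_integral I])
       (use ih F b in \<open>auto intro!: integrable_sum\<close>)
  finally show ?thesis by (simp add: mult_left_mono)
qed

lemma has_integral_power_segment:
  "((\<lambda>r. (c * r :: real) ^ n) has_integral (c ^ n / (real n + 1))) {0..1}"
proof -
  have "((\<lambda>r. (c * r) ^ n) has_integral (c ^ n * 1 ^ (n + 1) / (real n + 1) - c ^ n * 0 ^ (n + 1) / (real n + 1))) {0..1}"
  proof (rule fundamental_theorem_of_calculus)
    fix r :: real
    have "((\<lambda>r. r ^ (n + 1)) has_real_derivative (real n + 1) * r ^ n) (at r within {0..1})"
      using DERIV_pow[of "Suc n" r "{0..1}"] by (simp add: add.commute)
    from DERIV_cdivide[OF DERIV_cmult[OF this, of "c ^ n"], of "real n + 1"]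
    have "((\<lambda>r. c ^ n * r ^ (n + 1) / (real n + 1)) has_real_derivative (c * r) ^ n) (at r within {0..1})"
      by (simp add: power_mult_distrib add_nonneg_eq_0_iff)
    then show "((\<lambda>r. c ^ n * r ^ (n + 1) / (real n + 1)) has_vector_derivative (c * r) ^ n) (at r within {0..1})"
      by (simp add: has_real_derivative_iff_has_vector_derivative)
  qed simp
  then show ?thesis by simp
qed

text \<open>The derivative in \<open>h\<close> is \<open>F (2 * pi + h) - F h\<close>, which is 0 by
  periodicity.\<close>

lemma integral_tor_shift:
  assumes F: "continuous_on UNIV F" and per: "\<And>x. F (x + 2 * pi) = F x"
  shows "(\<integral>x. F (x + h) \<partial>tor) = (\<integral>x. F x \<partial>tor :: complex)"
proof -
  let ?A = "antider F"
  note d = antider_has_vector_derivative[OF F]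
  have eq: "(\<integral>x. F (x + h) \<partial>tor) = ?A (2 * pi + h) - ?A h" for h
  proof -
    have "(LBINT x. indicator {0..2 * pi} x *\<^sub>R F (x + h)) = ?A (2 * pi + h) - ?A (0 + h)"
    proof (rule integral_FTC_atLeastAtMost)
      fix x
      have "((\<lambda>x. x + h) has_vector_derivative 1) (at x within {0..2 * pi})"
        by (auto intro!: derivative_eq_intros simp: has_real_derivative_iff_has_vector_derivative[symmetric])
      from vector_diff_chain_within[OF this has_vector_derivative_at_within[OF d]]
      show "((\<lambda>x. ?A (x + h)) has_vector_derivative F (x + h)) (at x within {0..2 * pi})"
        by (simp add: o_def)
    qed (auto intro!: continuous_on_compose2[OF F] continuous_intros)
    then show ?thesis by (simp add: set_integral_tor[symmetric] set_lebesgue_integral_def)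
  qed
  have "((\<lambda>h. ?A (2 * pi + h) - ?A h) has_vector_derivative 0) (at h within UNIV)" for h
  proof -
    have "((\<lambda>x. 2 * pi + x) has_vector_derivative 1) (at h)"
      by (auto intro!: derivative_eq_intros simp: has_real_derivative_iff_has_vector_derivative[symmetric])
    from vector_diff_chain_at[OF this d]
    have "((\<lambda>h. ?A (2 * pi + h)) has_vector_derivative F (2 * pi + h)) (at h)" by (simp add: o_def)
    from has_vector_derivative_diff[OF this d[of h]] show ?thesis
      using per[of h] by (simp add: add.commute)
  qed
  from has_vector_derivative_zero_constant[OF convex_UNIV this]
  have "?A (2 * pi + h) - ?A h = ?A (2 * pi + 0) - ?A 0" by (metis UNIV_I)
  then show ?thesis using eq[of h] eq[of 0] by simp
qed

lemma norm_cis_minus_one_le: "cmod (cis \<theta> - 1) \<le> \<bar>\<theta>\<bar>"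
proof -
  have "cis \<theta> - 1 = cis (\<theta> / 2) * (2 * \<i> * sin (\<theta> / 2))"
    using cos_double_sin[of "\<theta> / 2"] sin_double[of "\<theta> / 2"]
    by (simp add: complex_eq_iff power2_eq_square)
  then have "cmod (cis \<theta> - 1) = 2 * \<bar>sin (\<theta> / 2)\<bar>" by (simp add: norm_mult)
  also have "\<dots> \<le> 2 * \<bar>\<theta> / 2\<bar>" using abs_sin_x_le_abs_x[of "\<theta> / 2"] by linarith
  finally show ?thesis by simp
qed

subsection \<open>Continuity of curves of sequences\<close>

text \<open>Norm continuity in the weighted l^2 space, with squared norms expressed by bounds on
  finite sums.\<close>

definition wcont :: "(int \<Rightarrow> real) \<Rightarrow> (real \<Rightarrow> int \<Rightarrow> complex) \<Rightarrow> bool" where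
  "wcont w u \<longleftrightarrow> (\<forall>t. \<forall>e>0. \<forall>\<^sub>F s in at t. wl2 w (\<lambda>k. u s k - u t k) e)"

text \<open>The Schroedinger group on Fourier coefficients; it leads from the interaction picture
  back to the original one.\<close>

definition evol :: "real \<Rightarrow> (int \<Rightarrow> complex) \<Rightarrow> int \<Rightarrow> complex" where
  "evol t a k = cis (- (t * (of_int k)\<^sup>2)) * a k"

lemma norm_evol [simp]: "cmod (evol t a k) = cmod (a k)"
  by (simp add: evol_def norm_mult)

lemma wl2_evol [simp]: "wl2 w (evol t a) B \<longleftrightarrow> wl2 w a B"
  by (simp add: wl2_def)

lemma evol_diff: "evol t a k - evol t b k = evol t (\<lambda>k. a k - b k) k"
  by (simp add: evol_def right_diff_distrib)

lemma wl2_evol_diff [simp]: "wl2 w (\<lambda>k. evol t a k - evol t b k) B \<longleftrightarrow> wl2 w (\<lambda>k. a k - b k) B"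
  by (simp add: evol_diff)

lemma wcontD: "wcont w u \<Longrightarrow> 0 < e \<Longrightarrow> \<forall>\<^sub>F s in at t. wl2 w (\<lambda>k. u s k - u t k) e"
  by (simp add: wcont_def)

text \<open>The group is strongly but not norm continuous: finitely many frequencies move
  continuously, and the tail is small at all times because the factors are unimodular.\<close>

lemma wcont_evol_const:
  assumes a: "wl2 w a B" and w: "\<And>k. 0 \<le> w k"
  shows "wcont w (\<lambda>t. evol t a)"
  unfolding wcont_def
proof (intro allI impI)
  fix t e :: real assume e: "0 < e"
  \<comment> \<open>On the tail the squared difference is at most 4 times the squared coefficient,
    so \<open>e / 8\<close> contributes \<open>e / 2\<close>.\<close>
  obtain n :: nat where n: "\<And>F. finite F \<Longrightarrow> F \<inter> {- int n..int n} = {} \<Longrightarrow> (\<Sum>k\<in>F. w k * (cmod (a k))\<^sup>2) \<le> e / 8"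
    by (rule wl2_small_tail[OF a w, of "e / 8"]) (use e in auto)
  let ?I = "{- int n..int n}"
  let ?d = "\<lambda>s k. evol s a k - evol t a k"
  have "((\<lambda>s. \<Sum>k\<in>?I. w k * (cmod (?d s k))\<^sup>2) \<longlongrightarrow> (\<Sum>k\<in>?I. w k * (cmod (?d t k))\<^sup>2)) (at t)"
    unfolding evol_def by (intro tendsto_intros)
  then have "\<forall>\<^sub>F s in at t. (\<Sum>k\<in>?I. w k * (cmod (?d s k))\<^sup>2) < e / 2"
    using e by (intro order_tendstoD) auto
  then show "\<forall>\<^sub>F s in at t. wl2 w (?d s) e"
  proof eventually_elim
    case (elim s)
    show ?case
      unfolding wl2_def
    proof (intro allI impI)
      fix F :: "int set" assume F: "finite F"
      have "(\<Sum>k\<in>F. w k * (cmod (?d s k))\<^sup>2)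
          = (\<Sum>k\<in>F \<inter> ?I. w k * (cmod (?d s k))\<^sup>2) + (\<Sum>k\<in>F - ?I. w k * (cmod (?d s k))\<^sup>2)"
        by (rule sum.Int_Diff[OF F])
      also have "(\<Sum>k\<in>F \<inter> ?I. w k * (cmod (?d s k))\<^sup>2) \<le> (\<Sum>k\<in>?I. w k * (cmod (?d s k))\<^sup>2)"
        by (rule sum_mono2) (auto simp: w)
      also have "(\<Sum>k\<in>F - ?I. w k * (cmod (?d s k))\<^sup>2) \<le> (\<Sum>k\<in>F - ?I. 4 * (w k * (cmod (a k))\<^sup>2))"
      proof (rule sum_mono)
        fix k
        have "(cmod (?d s k))\<^sup>2 \<le> 4 * (cmod (a k))\<^sup>2"
          using norm_add_sq_le[of "evol s a k" "- evol t a k"] by simp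
        from mult_left_mono[OF this w[of k]]
        show "w k * (cmod (?d s k))\<^sup>2 \<le> 4 * (w k * (cmod (a k))\<^sup>2)" by (simp add: mult_ac)
      qed
      also have "\<dots> \<le> 4 * (e / 8)"
        unfolding sum_distrib_left[symmetric] by (intro mult_left_mono n) (use F in auto)
      finally show "(\<Sum>k\<in>F. w k * (cmod (?d s k))\<^sup>2) \<le> e" using elim by simp
    qed
  qed
qed

lemma wcont_add_le:
  assumes "\<And>e. 0 < e \<Longrightarrow> \<forall>\<^sub>F s in F. wl2 w (a s) e" and "\<And>e. 0 < e \<Longrightarrow> \<forall>\<^sub>F s in F. wl2 w (b s) e"
    and "\<And>k. 0 \<le> w k" and "0 < e"
  shows "\<forall>\<^sub>F s in F. wl2 w (\<lambda>k. a s k + b s k) e"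
proof -
  have "\<forall>\<^sub>F s in F. wl2 w (a s) (e / 4)" "\<forall>\<^sub>F s in F. wl2 w (b s) (e / 4)"
    using assms by auto
  then show ?thesis
  proof eventually_elim
    case (elim s)
    from wl2_add[OF this assms(3)] show ?case by simp
  qed
qed

text \<open>The group at time \<open>s\<close> is isometric on the difference of \<open>u s\<close>
  and \<open>u t\<close>; strong continuity handles the fixed sequence \<open>u t\<close>.\<close>

lemma wcont_evol:
  assumes u: "wcont w u" and b: "\<And>t. \<exists>B. wl2 w (u t) B" and w: "\<And>k. 0 \<le> w k"
  shows "wcont w (\<lambda>t. evol t (u t))"
  unfolding wcont_def
proof (intro allI impI)
  fix t e :: real assume e: "0 < e"
  obtain B where B: "wl2 w (u t) B" using b by blast
  have "\<forall>\<^sub>F s in at t. wl2 w (\<lambda>k. (evol s (u s) k - evol s (u t) k) + (evol s (u t) k - evol t (u t) k)) e"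
    by (rule wcont_add_le[OF _ _ w e])
       (simp add: wcontD[OF u], rule wcontD[OF wcont_evol_const[OF B w]])
  then show "\<forall>\<^sub>F s in at t. wl2 w (\<lambda>k. evol s (u s) k - evol t (u t) k) e" by simp
qed

lemma wcont_of_increment:
  assumes "\<And>s t. \<bar>s - t\<bar> \<le> 1 \<Longrightarrow> wl2 w (\<lambda>k. u s k - u t k) (C t * (s - t)\<^sup>2)"
  shows "wcont w u"
  unfolding wcont_def
proof (intro allI impI)
  fix t e :: real assume e: "0 < e"
  have "((\<lambda>s. C t * (s - t)\<^sup>2) \<longlongrightarrow> C t * (t - t)\<^sup>2) (at t)" by (intro tendsto_intros)
  then have "\<forall>\<^sub>F s in at t. C t * (s - t)\<^sup>2 < e" using e by (intro order_tendstoD) auto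
  moreover have "((\<lambda>s. \<bar>s - t\<bar>) \<longlongrightarrow> \<bar>t - t\<bar>) (at t)" by (intro tendsto_intros)
  then have "\<forall>\<^sub>F s in at t. \<bar>s - t\<bar> < 1" by (intro order_tendstoD) auto
  ultimately show "\<forall>\<^sub>F s in at t. wl2 w (\<lambda>k. u s k - u t k) e"
  proof eventually_elim
    case (elim s)
    then show ?case using wl2_mono[OF assms[of s t], of e] by simp
  qed
qed

lemma wl2_one_single: "wl2 (\<lambda>_. 1) a B \<Longrightarrow> (cmod (a k))\<^sup>2 \<le> B"
  using wl2D[of "\<lambda>_. 1" a B "{k}"] by simp

subsection \<open>Gauge invariant Lipschitz nonlinearities\<close>

text \<open>A real function of the squared modulus times \<open>z\<close> keeps the pairing with
  \<open>cnj z\<close> real, which gives mass conservation. The factor 1/2 in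
  \<open>\<Psi>_deriv\<close> makes \<open>Re (cnj (f z) * z')\<close> the time derivative of
  \<open>\<Psi> ((cmod z)\<^sup>2)\<close>, so \<open>\<Psi>\<close> is the potential energy
  density.\<close>

locale lipschitz_nls =
  fixes m \<Psi> :: "real \<Rightarrow> real" and L \<sigma> :: real
  assumes cont_m: "continuous_on UNIV m"
    and L_nonneg: "0 \<le> L"
    and lipschitz: "\<And>z w :: complex. cmod (of_real (m ((cmod z)\<^sup>2)) * z - of_real (m ((cmod w)\<^sup>2)) * w) \<le> L * cmod (z - w)"
    and \<Psi>_deriv: "\<And>q. (\<Psi> has_real_derivative m q / 2) (at q)"
    and \<Psi>_0: "\<Psi> 0 = 0"
    and \<sigma>: "\<sigma> = 1 \<or> \<sigma> = -1"
begin

definition f :: "complex \<Rightarrow> complex" where "f z = of_real (m ((cmod z)\<^sup>2)) * z"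

definition N :: "(int \<Rightarrow> complex) \<Rightarrow> int \<Rightarrow> complex" where
  "N a = fourier_coeff (\<lambda>x. f (trig a x))"

text \<open>The vector field in the interaction picture. The unbounded symbol k^2 survives only in
  unimodular factors, so \<open>G t\<close> inherits the bounds of \<open>N\<close>.\<close>

definition G :: "real \<Rightarrow> (int \<Rightarrow> complex) \<Rightarrow> int \<Rightarrow> complex" where
  "G t u k = \<i> * of_real \<sigma> * cis (t * (of_int k)\<^sup>2) * N (evol t u) k"

lemma f_lipschitz: "cmod (f z - f w) \<le> L * cmod (z - w)"
  unfolding f_def by (rule lipschitz)

lemma f_0 [simp]: "f 0 = 0" by (simp add: f_def)

lemma continuous_f: "continuous_on S f"
  unfolding f_def
  by (intro continuous_intros continuous_on_compose2[OF cont_m]) auto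

lemma continuous_f_trig: "(\<lambda>k. cmod (a k)) summable_on UNIV \<Longrightarrow> continuous_on S (\<lambda>x. f (trig a x))"
  by (rule continuous_on_compose2[OF continuous_f continuous_trig]) auto

lemma sqint_f_trig: "(\<lambda>k. cmod (a k)) summable_on UNIV \<Longrightarrow> sqint (\<lambda>x. f (trig a x))"
  by (rule sqint_continuous[OF continuous_f_trig])

text \<open>The pointwise Lipschitz bound is carried to coefficients by Parseval's identity for the
  difference of the arguments and by Bessel's inequality for the difference of the values.\<close>

lemma N_lipschitz:
  assumes a: "(\<lambda>k. cmod (a k)) summable_on UNIV" and b: "(\<lambda>k. cmod (b k)) summable_on UNIV"
    and D: "wl2 (\<lambda>_. 1) (\<lambda>k. a k - b k) D"
  shows "wl2 (\<lambda>_. 1) (\<lambda>k. N a k - N b k) (L\<^sup>2 * D)"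
proof -
  let ?g = "\<lambda>x. f (trig a x) - f (trig b x)"
  note sg = sqint_diff[OF sqint_f_trig[OF a] sqint_f_trig[OF b]]
  have ab: "(\<lambda>k. cmod (a k - b k)) summable_on UNIV"
    by (rule summable_on_comparison_test[OF summable_on_add[OF a b]]) (auto simp: norm_triangle_ineq4)
  have "(\<integral>x. (cmod (?g x))\<^sup>2 \<partial>tor) \<le> (\<integral>x. L\<^sup>2 * (cmod (trig (\<lambda>k. a k - b k) x))\<^sup>2 \<partial>tor)"
  proof (rule integral_mono)
    show "(cmod (?g x))\<^sup>2 \<le> L\<^sup>2 * (cmod (trig (\<lambda>k. a k - b k) x))\<^sup>2" for x
      unfolding power_mult_distrib[symmetric] trig_diff[OF a b] by (intro power_mono f_lipschitz) simp
  qed (use sqint_integrable_sq[OF sg] sqint_integrable_sq[OF sqint_trig[OF ab]] in auto)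
  also have "\<dots> = L\<^sup>2 * (2 * pi * (\<Sum>\<^sub>\<infinity>k. 1 * (cmod (a k - b k))\<^sup>2))"
    by (simp add: parseval_trig(2)[OF ab])
  also have "\<dots> \<le> L\<^sup>2 * (2 * pi * D)"
    by (intro mult_left_mono wl2_infsum_le[OF D]) auto
  finally have "(\<integral>x. (cmod (?g x))\<^sup>2 \<partial>tor) / (2 * pi) \<le> L\<^sup>2 * D" by (simp add: pos_divide_le_eq mult_ac)
  moreover have "fourier_coeff ?g = (\<lambda>k. N a k - N b k)"
    unfolding N_def by (intro ext fourier_coeff_diff sqint_integrable sqint_f_trig a b)
  ultimately show ?thesis using wl2_mono[OF bessel[OF sg]] by simp
qed

lemma N_zero: "N (\<lambda>_. 0) = (\<lambda>_. 0)"
  by (simp add: N_def trig_def fourier_coeff_tor fun_eq_iff)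

lemma fourier_coeff_shift:
  assumes F: "continuous_on UNIV F" and per: "\<And>x. F (x + 2 * pi) = F x"
  shows "fourier_coeff (\<lambda>x. F (x + h)) k = cis (of_int k * h) * fourier_coeff F k"
proof -
  let ?H = "\<lambda>x. F x * cis (- (of_int k * x))"
  have A: "(\<integral>x. ?H (x + h) \<partial>tor) = (\<integral>x. ?H x \<partial>tor)"
  proof (rule integral_tor_shift[of ?H])
    show "?H (x + 2 * pi) = ?H x" for x
      using cis_int_periodic[of "- k" x] per[of x] by simp
    show "continuous_on UNIV ?H" by (intro continuous_intros F)
  qed
  have B: "F (x + h) * cis (- (of_int k * x)) = cis (of_int k * h) * ?H (x + h)" for x
  proof -
    have "cis (of_int k * h) * cis (- (of_int k * (x + h))) = cis (- (of_int k * x))"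
      by (simp add: cis_mult distrib_left)
    then show ?thesis by (metis mult.assoc mult.commute)
  qed
  show ?thesis unfolding fourier_coeff_tor B integral_mult_right_zero A by simp
qed

text \<open>Translations turn the Lipschitz bound into a bound for difference quotients, which is
  the only derivative estimate for the nonlinearity that is needed; no chain rule is involved.\<close>

lemma N_deriv:
  assumes a: "(\<lambda>k. cmod (a k)) summable_on UNIV" and B: "wl2 (\<lambda>k. (of_int k)\<^sup>2) a B"
  shows "wl2 (\<lambda>k. (of_int k)\<^sup>2) (N a) (L\<^sup>2 * B)"
  unfolding wl2_def
proof (intro allI impI)
  fix F :: "int set" assume F: "finite F"
  let ?h = "\<lambda>n::nat. 1 / real (Suc n)"
  \<comment> \<open>The Fourier symbol of a difference quotient with step \<open>?h n\<close>; it
    tends to i k.\<close>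
  let ?q = "\<lambda>n k. (cis (of_int k * ?h n) - 1) / of_real (?h n)"
  have bound: "(\<Sum>k\<in>F. (cmod (?q n k * N a k))\<^sup>2) \<le> L\<^sup>2 * B" for n
  proof -
    let ?t = "\<lambda>k. cis (of_int k * ?h n) * a k"
    have h: "0 < ?h n" by simp
    have t: "(\<lambda>k. cmod (?t k)) summable_on UNIV" using a by (simp add: norm_mult)
    have Nt: "N ?t k = cis (of_int k * ?h n) * N a k" for k
      unfolding N_def trig_shift[symmetric]
      by (rule fourier_coeff_shift[OF continuous_f_trig[OF a]]) (simp add: trig_periodic)
    have "wl2 (\<lambda>_. 1) (\<lambda>k. ?t k - a k) ((?h n)\<^sup>2 * B)"
      unfolding wl2_def
    proof (intro allI impI)
      fix E :: "int set" assume E: "finite E"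
      have "(\<Sum>k\<in>E. 1 * (cmod (?t k - a k))\<^sup>2) \<le> (\<Sum>k\<in>E. (?h n)\<^sup>2 * ((of_int k)\<^sup>2 * (cmod (a k))\<^sup>2))"
      proof (rule sum_mono)
        fix k
        have "?t k - a k = (cis (of_int k * ?h n) - 1) * a k" by (simp add: left_diff_distrib)
        then have "(cmod (?t k - a k))\<^sup>2 = (cmod (cis (of_int k * ?h n) - 1))\<^sup>2 * (cmod (a k))\<^sup>2"
          by (simp only: norm_mult power_mult_distrib)
        also have "\<dots> \<le> \<bar>of_int k * ?h n\<bar>\<^sup>2 * (cmod (a k))\<^sup>2"
          by (intro mult_right_mono power_mono norm_cis_minus_one_le) auto
        finally show "1 * (cmod (?t k - a k))\<^sup>2 \<le> (?h n)\<^sup>2 * ((of_int k)\<^sup>2 * (cmod (a k))\<^sup>2)"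
          by (simp only: power_mult_distrib power2_abs mult_ac)
      qed
      also have "\<dots> \<le> (?h n)\<^sup>2 * B"
        unfolding sum_distrib_left[symmetric] by (intro mult_left_mono wl2D[OF B E]) simp
      finally show "(\<Sum>k\<in>E. 1 * (cmod (?t k - a k))\<^sup>2) \<le> (?h n)\<^sup>2 * B" .
    qed
    from wl2D[OF N_lipschitz[OF t a this] F]
    have "(\<Sum>k\<in>F. (cmod ((cis (of_int k * ?h n) - 1) * N a k))\<^sup>2) \<le> L\<^sup>2 * ((?h n)\<^sup>2 * B)"
      unfolding left_diff_distrib mult_1 Nt .
    then have "(\<Sum>k\<in>F. (cmod ((cis (of_int k * ?h n) - 1) * N a k))\<^sup>2) / (?h n)\<^sup>2 \<le> L\<^sup>2 * B"
      using h by (simp add: pos_divide_le_eq mult_ac del: of_nat_Suc)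
    moreover have "(cmod (?q n k * N a k))\<^sup>2 = (cmod ((cis (of_int k * ?h n) - 1) * N a k))\<^sup>2 / (?h n)\<^sup>2" for k
      by (simp only: norm_mult norm_divide norm_of_real power_mult_distrib power_divide power2_abs) simp
    ultimately show ?thesis by (simp only: sum_divide_distrib)
  qed
  have lim: "(\<lambda>n. ?q n k) \<longlonglongrightarrow> \<i> * of_int k" for k
  proof -
    have "((\<lambda>z. exp (\<i> * of_int k * z)) has_field_derivative \<i> * of_int k) (at 0)"
      by (auto intro!: derivative_eq_intros)
    then have d: "((\<lambda>z. (exp (\<i> * of_int k * z) - 1) / z) \<longlongrightarrow> \<i> * of_int k) (at 0)"
      by (simp add: has_field_derivative_iff)
    have "?h \<longlonglongrightarrow> 0" using LIMSEQ_inverse_real_of_nat by (simp add: inverse_eq_divide)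
    then have "(\<lambda>n. complex_of_real (?h n)) \<longlonglongrightarrow> of_real 0" by (rule tendsto_of_real)
    then have "filterlim (\<lambda>n. complex_of_real (?h n)) (at 0) sequentially"
      unfolding filterlim_at by (auto simp del: of_nat_Suc of_real_divide)
    from filterlim_compose[OF d this] show ?thesis
      by (simp add: cis_conv_exp mult_ac)
  qed
  have "(\<lambda>n. \<Sum>k\<in>F. (cmod (?q n k * N a k))\<^sup>2) \<longlonglongrightarrow> (\<Sum>k\<in>F. (cmod (\<i> * of_int k * N a k))\<^sup>2)"
    by (intro tendsto_intros lim)
  from LIMSEQ_le_const2[OF this] bound
  have "(\<Sum>k\<in>F. (cmod (\<i> * of_int k * N a k))\<^sup>2) \<le> L\<^sup>2 * B" by blast
  then show "(\<Sum>k\<in>F. (of_int k)\<^sup>2 * (cmod (N a k))\<^sup>2) \<le> L\<^sup>2 * B"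
    by (simp add: norm_mult power_mult_distrib)
qed

lemma N_sob:
  assumes B: "wl2 sob a B"
  shows "wl2 sob (N a) (L\<^sup>2 * B)"
proof -
  note s = wl2_sob_abs_summable[OF B]
  have d0: "wl2 (\<lambda>k. (of_int k)\<^sup>2) a B"
    by (rule wl2_weight_mono[OF B]) (simp add: sob_def)
  \<comment> \<open>Exact sums in place of the bound \<open>B\<close> for each part: they add up to
    at most \<open>B\<close>, so the constant stays \<open>L\<^sup>2\<close> instead of
    doubling.\<close>
  let ?X = "\<Sum>\<^sub>\<infinity>k. 1 * (cmod (a k))\<^sup>2" and ?Y = "\<Sum>\<^sub>\<infinity>k. (of_int k)\<^sup>2 * (cmod (a k))\<^sup>2"
  have sx: "(\<lambda>k. 1 * (cmod (a k))\<^sup>2) summable_on UNIV" by (rule wl2_summable[OF wl2_sob_one[OF B]]) simp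
  have sy: "(\<lambda>k. (of_int k)\<^sup>2 * (cmod (a k))\<^sup>2) summable_on UNIV" by (rule wl2_summable[OF d0]) simp
  have X: "wl2 (\<lambda>_. 1) a ?X" by (rule wl2_infsum[OF sx]) simp
  have Y: "wl2 (\<lambda>k. (of_int k)\<^sup>2) a ?Y" by (rule wl2_infsum[OF sy]) simp
  have XY: "?X + ?Y \<le> B"
  proof -
    have "?X + ?Y = (\<Sum>\<^sub>\<infinity>k. sob k * (cmod (a k))\<^sup>2)"
      by (subst infsum_add[OF sx sy, symmetric]) (simp add: sob_def distrib_right)
    then show ?thesis using wl2_infsum_le[OF B sob_nonneg] by simp
  qed
  have "wl2 (\<lambda>_. 1) (\<lambda>k. N a k - N (\<lambda>_. 0) k) (L\<^sup>2 * ?X)"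
    by (rule N_lipschitz[OF s]) (use X in auto)
  then have 1: "wl2 (\<lambda>_. 1) (N a) (L\<^sup>2 * ?X)" by (simp add: N_zero)
  have 2: "wl2 (\<lambda>k. (of_int k)\<^sup>2) (N a) (L\<^sup>2 * ?Y)" by (rule N_deriv[OF s Y])
  show ?thesis
    unfolding wl2_def
  proof (intro allI impI)
    fix F :: "int set" assume F: "finite F"
    have "(\<Sum>k\<in>F. sob k * (cmod (N a k))\<^sup>2) = (\<Sum>k\<in>F. 1 * (cmod (N a k))\<^sup>2) + (\<Sum>k\<in>F. (of_int k)\<^sup>2 * (cmod (N a k))\<^sup>2)"
      by (simp add: sob_def distrib_right sum.distrib)
    also have "\<dots> \<le> L\<^sup>2 * ?X + L\<^sup>2 * ?Y" using wl2D[OF 1 F] wl2D[OF 2 F] by simp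
    also have "\<dots> = L\<^sup>2 * (?X + ?Y)" by (simp add: distrib_left)
    also have "\<dots> \<le> L\<^sup>2 * B" by (rule mult_left_mono[OF XY]) simp
    finally show "(\<Sum>k\<in>F. sob k * (cmod (N a k))\<^sup>2) \<le> L\<^sup>2 * B" .
  qed
qed

lemma norm_\<sigma> [simp]: "cmod (of_real \<sigma>) = 1" "\<bar>\<sigma>\<bar> = 1" "\<sigma> * \<sigma> = 1"
  using \<sigma> by auto

lemma norm_G [simp]: "cmod (G t u k) = cmod (N (evol t u) k)"
  by (simp add: G_def norm_mult)

lemma norm_G_diff: "cmod (G t u k - G t v k) = cmod (N (evol t u) k - N (evol t v) k)"
proof -
  have "G t u k - G t v k = \<i> * of_real \<sigma> * cis (t * (of_int k)\<^sup>2) * (N (evol t u) k - N (evol t v) k)"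
    by (simp add: G_def right_diff_distrib)
  then show ?thesis by (simp add: norm_mult)
qed

lemma G_lipschitz:
  assumes "wl2 sob u A" and "wl2 sob v B" and "wl2 (\<lambda>_. 1) (\<lambda>k. u k - v k) D"
  shows "wl2 (\<lambda>_. 1) (\<lambda>k. G t u k - G t v k) (L\<^sup>2 * D)"
proof -
  have "wl2 (\<lambda>_. 1) (\<lambda>k. N (evol t u) k - N (evol t v) k) (L\<^sup>2 * D)"
    by (rule N_lipschitz) (use wl2_sob_abs_summable[OF assms(1)] wl2_sob_abs_summable[OF assms(2)] assms(3) in auto)
  then show ?thesis by (simp add: wl2_def norm_G_diff)
qed

lemma G_sob:
  assumes "wl2 sob u B"
  shows "wl2 sob (G t u) (L\<^sup>2 * B)"
  using N_sob[of "evol t u" B] assms by (simp add: wl2_def)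

lemma continuous_N:
  assumes w: "wcont (\<lambda>_. 1) w" and h: "\<And>t. \<exists>B. wl2 sob (w t) B"
  shows "continuous_on UNIV (\<lambda>t. N (w t) k)"
proof (rule continuous_at_imp_continuous_on, rule ballI)
  fix t :: real
  have "((\<lambda>s. N (w s) k) \<longlongrightarrow> N (w t) k) (at t)"
  proof (rule tendstoI)
    fix e :: real assume e: "0 < e"
    \<comment> \<open>\<open>L + 1\<close> instead of \<open>L\<close> avoids division by 0 when
      \<open>L = 0\<close>.\<close>
    let ?d = "(e / (2 * (L + 1)))\<^sup>2"
    have d: "0 < ?d" using e L_nonneg by simp
    from wcontD[OF w d]
    show "\<forall>\<^sub>F s in at t. dist (N (w s) k) (N (w t) k) < e"
    proof eventually_elim
      case (elim s)
      obtain A B where AB: "wl2 sob (w s) A" "wl2 sob (w t) B" using h by blast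
      have "(cmod (N (w s) k - N (w t) k))\<^sup>2 \<le> L\<^sup>2 * ?d"
        by (rule wl2_one_single[OF N_lipschitz[OF wl2_sob_abs_summable[OF AB(1)] wl2_sob_abs_summable[OF AB(2)] elim]])
      also have "\<dots> = (L * (e / (2 * (L + 1))))\<^sup>2" by (simp only: power_mult_distrib)
      finally have "cmod (N (w s) k - N (w t) k) \<le> L * (e / (2 * (L + 1)))"
        by (rule power2_le_imp_le) (use e L_nonneg in simp)
      also have "\<dots> \<le> (L + 1) * (e / (2 * (L + 1)))"
        by (intro mult_right_mono) (use e L_nonneg in auto)
      also have "\<dots> = e / 2" using L_nonneg by (simp add: field_simps)
      also have "\<dots> < e" using e by simp
      finally show ?case by (simp add: dist_norm)
    qed
  qed
  then show "isCont (\<lambda>t. N (w t) k) t" by (simp add: isCont_def)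
qed

lemma continuous_G:
  assumes u: "wcont (\<lambda>_. 1) u" and h: "\<And>t. \<exists>B. wl2 sob (u t) B"
  shows "continuous_on UNIV (\<lambda>t. G t (u t) k)"
proof -
  have "wcont (\<lambda>_. 1) (\<lambda>t. evol t (u t))"
    by (rule wcont_evol[OF u]) (use h wl2_sob_one in \<open>blast, simp\<close>)
  then have "continuous_on UNIV (\<lambda>t. N (evol t (u t)) k)"
    by (rule continuous_N) (use h in auto)
  then show ?thesis unfolding G_def by (intro continuous_intros)
qed

end

subsection \<open>Picard iteration\<close>

lemma wcont_weight_mono:
  assumes "wcont w u" and "\<And>k. v k \<le> w k"
  shows "wcont v u"
  unfolding wcont_def
proof (intro allI impI)
  fix t e :: real assume "0 < e"
  from wcontD[OF assms(1) this, of t] show "\<forall>\<^sub>F s in at t. wl2 v (\<lambda>k. u s k - u t k) e"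
    by eventually_elim (rule wl2_weight_mono[OF _ assms(2)])
qed

lemma wcont_sob_one: "wcont sob u \<Longrightarrow> wcont (\<lambda>_. 1) u"
  by (erule wcont_weight_mono) (rule sob_ge1)

text \<open>Minkowski's inequality, stated for squares. The geometric series of Picard differences
  needs this sharp constant; the factors 2 in \<open>wl2_add\<close> would accumulate.\<close>

lemma wl2_triangle:
  assumes "wl2 (\<lambda>_. 1) a (A\<^sup>2)" and "wl2 (\<lambda>_. 1) b (B\<^sup>2)" and "0 \<le> A" and "0 \<le> B"
  shows "wl2 (\<lambda>_. 1) (\<lambda>k. a k + b k) ((A + B)\<^sup>2)"
  unfolding wl2_def
proof (intro allI impI)
  fix F :: "int set" assume F: "finite F"
  have "L2_set (\<lambda>k. cmod (a k + b k)) F \<le> L2_set (\<lambda>k. cmod (a k) + cmod (b k)) F"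
    by (rule L2_set_mono) (auto simp: norm_triangle_ineq)
  also have "\<dots> \<le> L2_set (\<lambda>k. cmod (a k)) F + L2_set (\<lambda>k. cmod (b k)) F" by (rule L2_set_triangle_ineq)
  also have "\<dots> \<le> A + B"
    unfolding L2_set_def
    by (intro add_mono real_le_lsqrt) (use assms wl2D[OF assms(1) F] wl2D[OF assms(2) F] in \<open>auto intro: sum_nonneg\<close>)
  finally have "(L2_set (\<lambda>k. cmod (a k + b k)) F)\<^sup>2 \<le> (A + B)\<^sup>2"
    by (rule power_mono) (rule L2_set_nonneg)
  then show "(\<Sum>k\<in>F. 1 * (cmod (a k + b k))\<^sup>2) \<le> (A + B)\<^sup>2"
    by (simp add: L2_set_def sum_nonneg)
qed

context lipschitz_nls
begin

text \<open>The increment of a Duhamel integral is controlled by the \<open>sob\<close> size of its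
  integrand times the elapsed time, so continuity of \<open>u\<close> in l^2 and local
  \<open>sob\<close> bounds suffice. This is how continuity in H^1 is obtained without a Lipschitz
  estimate there.\<close>

lemma wcont_duhamel:
  assumes d: "\<And>t k. ((\<lambda>t. U t k) has_vector_derivative G t (u t) k) (at t)"
    and u: "wcont (\<lambda>_. 1) u" and b: "\<And>T. \<exists>B. \<forall>t. \<bar>t\<bar> \<le> T \<longrightarrow> wl2 sob (u t) B"
  shows "wcont sob U"
proof -
  have h: "\<exists>B. wl2 sob (u t) B" for t using b[of "\<bar>t\<bar>"] by auto
  have "\<forall>t. \<exists>B. \<forall>s. \<bar>s\<bar> \<le> \<bar>t\<bar> + 1 \<longrightarrow> wl2 sob (u s) B" using b by blast
  then obtain B where B: "\<And>s t. \<bar>s\<bar> \<le> \<bar>t\<bar> + 1 \<Longrightarrow> wl2 sob (u s) (B t)" by metis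
  show ?thesis
  proof (rule wcont_of_increment[where C = "\<lambda>t. L\<^sup>2 * B t"])
    fix s t :: real assume st: "\<bar>s - t\<bar> \<le> 1"
    show "wl2 sob (\<lambda>k. U s k - U t k) (L\<^sup>2 * B t * (s - t)\<^sup>2)"
      unfolding wl2_def
    proof (intro allI impI)
      fix F :: "int set" assume F: "finite F"
      have "(\<Sum>k\<in>F. sob k * (cmod (U s k - U t k))\<^sup>2) \<le> (s - t)\<^sup>2 * (L\<^sup>2 * B t)"
      proof (rule weighted_increment_le[where U = "\<lambda>k t. U t k" and g = "\<lambda>k t. G t (u t) k" and b = "\<lambda>_. L\<^sup>2 * B t", OF F sob_nonneg d])
        show "continuous_on {0..1} (\<lambda>r. G (t + r * (s - t)) (u (t + r * (s - t))) k)" for k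
          by (rule continuous_on_compose2[OF continuous_G[OF u h]]) (auto intro!: continuous_intros)
        show "((\<lambda>_. L\<^sup>2 * B t) has_integral L\<^sup>2 * B t) {0..1::real}"
          using has_integral_const_real[of "L\<^sup>2 * B t" "0::real" 1] by simp
        fix r :: real assume r: "r \<in> {0..1}"
        have "\<bar>r * (s - t)\<bar> \<le> 1 * 1"
          unfolding abs_mult by (rule mult_mono) (use r st in auto)
        then have "\<bar>t + r * (s - t)\<bar> \<le> \<bar>t\<bar> + 1" by linarith
        from wl2D[OF G_sob[OF B[OF this]] F]
        show "(\<Sum>k\<in>F. sob k * (cmod (G (t + r * (s - t)) (u (t + r * (s - t))) k))\<^sup>2) \<le> L\<^sup>2 * B t" .
      qed
      then show "(\<Sum>k\<in>F. sob k * (cmod (U s k - U t k))\<^sup>2) \<le> L\<^sup>2 * B t * (s - t)\<^sup>2" by (simp add: mult_ac)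
    qed
  qed
qed

text \<open>One Picard step in squared norms: integrating the power \<open>2 * n\<close> of time
  gives the factor \<open>1 / (real (2 * n) + 1)\<close>, weakened to
  \<open>1 / (real n + 1)\<close> to build the factorial. The drivers \<open>p\<close>,
  \<open>q\<close> are kept apart from \<open>U\<close>, \<open>V\<close> so that the same step
  serves successive iterates, the limit equation and uniqueness.\<close>

lemma picard_step:
  assumes U: "\<And>k \<tau>. \<bar>\<tau>\<bar> \<le> \<bar>t\<bar> \<Longrightarrow> ((\<lambda>\<tau>. U \<tau> k) has_vector_derivative G \<tau> (p \<tau>) k) (at \<tau>)"
    and V: "\<And>k \<tau>. \<bar>\<tau>\<bar> \<le> \<bar>t\<bar> \<Longrightarrow> ((\<lambda>\<tau>. V \<tau> k) has_vector_derivative G \<tau> (q \<tau>) k) (at \<tau>)"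
    and init: "\<And>k. U 0 k = V 0 k"
    and cp: "\<And>k. continuous_on {-\<bar>t\<bar>..\<bar>t\<bar>} (\<lambda>\<tau>. G \<tau> (p \<tau>) k)"
    and cq: "\<And>k. continuous_on {-\<bar>t\<bar>..\<bar>t\<bar>} (\<lambda>\<tau>. G \<tau> (q \<tau>) k)"
    and hp: "\<And>\<tau>. \<exists>B. wl2 sob (p \<tau>) B" and hq: "\<And>\<tau>. \<exists>B. wl2 sob (q \<tau>) B"
    and D: "\<And>\<tau>. \<bar>\<tau>\<bar> \<le> \<bar>t\<bar> \<Longrightarrow> wl2 (\<lambda>_. 1) (\<lambda>k. p \<tau> k - q \<tau> k) (D * (L\<^sup>2 * \<tau>\<^sup>2) ^ n / fact n)"
    and D0: "0 \<le> D"
  shows "wl2 (\<lambda>_. 1) (\<lambda>k. U t k - V t k) (D * (L\<^sup>2 * t\<^sup>2) ^ Suc n / fact (Suc n))"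
  unfolding wl2_def
proof (intro allI impI)
  fix F :: "int set" assume F: "finite F"
  let ?c = "L\<^sup>2 * (D * (L\<^sup>2 * t\<^sup>2) ^ n / fact n)"
  have seg: "\<bar>0 + r * (t - 0)\<bar> \<le> \<bar>t\<bar>" if "r \<in> {0..1}" for r
    using that by (simp add: abs_mult mult_left_le_one_le)
  have "(\<Sum>k\<in>F. 1 * (cmod ((U t k - V t k) - (U 0 k - V 0 k)))\<^sup>2) \<le> (t - 0)\<^sup>2 * (?c * (1 / (real (2 * n) + 1)))"
  proof (rule weighted_increment_le[where U = "\<lambda>k \<tau>. U \<tau> k - V \<tau> k" and w = "\<lambda>_. 1"
        and g = "\<lambda>k \<tau>. G \<tau> (p \<tau>) k - G \<tau> (q \<tau>) k" and b = "\<lambda>r. ?c * r ^ (2 * n)", OF F])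
    show "0 \<le> (1::real)" for k :: int by simp
    fix k and r :: real assume "r \<in> {0..1}"
    from seg[OF this] show "((\<lambda>\<tau>. U \<tau> k - V \<tau> k) has_vector_derivative
        G (0 + r * (t - 0)) (p (0 + r * (t - 0))) k - G (0 + r * (t - 0)) (q (0 + r * (t - 0))) k) (at (0 + r * (t - 0)))"
      by (intro has_vector_derivative_diff U V)
  next
    fix k
    have seg': "0 + r * (t - 0) \<in> {-\<bar>t\<bar>..\<bar>t\<bar>}" if "r \<in> {0..1}" for r
      using seg[OF that] by (auto simp: abs_le_iff)
    show "continuous_on {0..1} (\<lambda>r. G (0 + r * (t - 0)) (p (0 + r * (t - 0))) k - G (0 + r * (t - 0)) (q (0 + r * (t - 0))) k)"
      by (intro continuous_on_diff continuous_on_compose2[OF cp] continuous_on_compose2[OF cq])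
         (use seg' in \<open>auto intro!: continuous_intros\<close>)
  next
    have "((\<lambda>r. (1 * r) ^ (2 * n)) has_integral (1 ^ (2 * n) / (real (2 * n) + 1))) {0..1::real}"
      by (rule has_integral_power_segment)
    then show "((\<lambda>r. ?c * r ^ (2 * n)) has_integral ?c * (1 / (real (2 * n) + 1))) {0..1}"
      by (intro has_integral_mult_right) simp
    fix r :: real assume r: "r \<in> {0..1}"
    let ?\<tau> = "0 + r * (t - 0)"
    obtain A B where AB: "wl2 sob (p ?\<tau>) A" "wl2 sob (q ?\<tau>) B" using hp hq by blast
    have "(\<Sum>k\<in>F. 1 * (cmod (G ?\<tau> (p ?\<tau>) k - G ?\<tau> (q ?\<tau>) k))\<^sup>2) \<le> L\<^sup>2 * (D * (L\<^sup>2 * ?\<tau>\<^sup>2) ^ n / fact n)"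
      by (rule wl2D[OF G_lipschitz[OF AB D[OF seg[OF r]]] F])
    also have "\<dots> = ?c * r ^ (2 * n)"
      by (simp add: power_mult_distrib power_mult[symmetric] mult_ac)
    finally show "(\<Sum>k\<in>F. 1 * (cmod (G ?\<tau> (p ?\<tau>) k - G ?\<tau> (q ?\<tau>) k))\<^sup>2) \<le> ?c * r ^ (2 * n)" .
  qed
  also have "(t - 0)\<^sup>2 * (?c * (1 / (real (2 * n) + 1))) = D * (L\<^sup>2 * t\<^sup>2) ^ Suc n / (fact n * (real (2 * n) + 1))"
    by (simp add: mult_ac)
  also have "\<dots> \<le> D * (L\<^sup>2 * t\<^sup>2) ^ Suc n / (fact n * (real n + 1))"
    by (rule divide_left_mono) (use D0 in auto)
  also have "fact n * (real n + 1) = fact (Suc n)" by (simp add: algebra_simps)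
  finally show "(\<Sum>k\<in>F. 1 * (cmod (U t k - V t k))\<^sup>2) \<le> D * (L\<^sup>2 * t\<^sup>2) ^ Suc n / fact (Suc n)"
    by (simp add: init)
qed

primrec iter :: "(int \<Rightarrow> complex) \<Rightarrow> nat \<Rightarrow> real \<Rightarrow> int \<Rightarrow> complex" where
  "iter a 0 = (\<lambda>t. a)"
| "iter a (Suc n) = (\<lambda>t k. a k + antider (\<lambda>\<tau>. G \<tau> (iter a n \<tau>) k) t)"

lemma exp_partial_sum_le:
  fixes x :: real assumes "0 \<le> x" shows "(\<Sum>j\<le>n. x ^ j / fact j) \<le> exp x"
proof -
  have "(\<Sum>j\<le>n. x ^ j /\<^sub>R fact j) \<le> (\<Sum>j. x ^ j /\<^sub>R fact j)"
    by (rule sum_le_suminf[OF summable_exp_generic]) (use assms in auto)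
  then show ?thesis by (simp add: exp_def divide_inverse mult.commute)
qed

text \<open>Partial sums of an exponential series reproduce themselves: integration raises the power
  of \<open>t\<^sup>2\<close> by one, with \<open>1 / (real (2 * j) + 1)\<close> weakened to
  \<open>1 / (real j + 1)\<close>, and the factor 2 in \<open>2 * L\<^sup>2\<close> comes from
  \<open>wl2_add\<close>. Continuity is proved along with the bound because the next integral needs
  a continuous integrand.\<close>

lemma iter_bound_aux:
  assumes a: "wl2 sob a A"
  shows "(\<forall>t. wl2 sob (iter a n t) (2 * A * (\<Sum>j\<le>n. (2 * L\<^sup>2 * t\<^sup>2) ^ j / fact j))) \<and> wcont sob (iter a n)"
proof (induction n)
  case 0
  have "wcont sob (\<lambda>t. a)" unfolding wcont_def by (simp add: wl2_def)
  moreover have "wl2 sob a (2 * A)" using wl2_mono[OF a] wl2_nonneg[OF a] by simp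
  ultimately show ?case by simp
next
  case (Suc n)
  let ?u = "iter a n" and ?E = "\<lambda>n t. 2 * A * (\<Sum>j\<le>n. (2 * L\<^sup>2 * t\<^sup>2) ^ j / fact j)"
  have A: "0 \<le> A" by (rule wl2_nonneg[OF a])
  have u: "wcont (\<lambda>_. 1) ?u" using Suc wcont_sob_one by blast
  have h: "\<exists>B. wl2 sob (?u t) B" for t using Suc by blast
  have d: "(antider (\<lambda>\<tau>. G \<tau> (?u \<tau>) k) has_vector_derivative G t (?u t) k) (at t)" for t k
    by (rule antider_has_vector_derivative[OF continuous_G[OF u h]])
  have d': "((\<lambda>t. iter a (Suc n) t k) has_vector_derivative G t (?u t) k) (at t)" for t k
    using has_vector_derivative_add[OF has_vector_derivative_const d] by simp
  have loc: "\<exists>B. \<forall>t. \<bar>t\<bar> \<le> T \<longrightarrow> wl2 sob (?u t) B" for T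
  proof (intro exI allI impI)
    fix t assume "\<bar>t\<bar> \<le> T"
    then have "t\<^sup>2 \<le> T\<^sup>2" by (simp add: abs_le_square_iff[symmetric])
    then have le: "2 * L\<^sup>2 * t\<^sup>2 \<le> 2 * L\<^sup>2 * T\<^sup>2" by (rule mult_left_mono) simp
    have "?E n t \<le> ?E n T"
      using A by (intro mult_left_mono sum_mono divide_right_mono power_mono[OF le]) auto
    with Suc show "wl2 sob (?u t) (?E n T)" using wl2_mono by blast
  qed
  have "wl2 sob (iter a (Suc n) t) (?E (Suc n) t)" for t
  proof -
    let ?I = "L\<^sup>2 * (2 * A) * (\<Sum>j\<le>n. (2 * L\<^sup>2 * t\<^sup>2) ^ j / fact j * (1 / (real (2 * j) + 1)))"
    have inc: "wl2 sob (\<lambda>k. antider (\<lambda>\<tau>. G \<tau> (?u \<tau>) k) t - antider (\<lambda>\<tau>. G \<tau> (?u \<tau>) k) 0) ((t - 0)\<^sup>2 * ?I)"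
      unfolding wl2_def
    proof (intro allI impI, rule weighted_increment_le[OF _ sob_nonneg d])
      fix F :: "int set" assume F: "finite F"
      show "continuous_on {0..1} (\<lambda>r. G (0 + r * (t - 0)) (?u (0 + r * (t - 0))) k)" for k
        by (rule continuous_on_compose2[OF continuous_G[OF u h]]) (auto intro!: continuous_intros)
      let ?b = "\<lambda>r. L\<^sup>2 * (2 * A) * (\<Sum>j\<le>n. (2 * L\<^sup>2 * t\<^sup>2) ^ j / fact j * r ^ (2 * j))"
      have "((\<lambda>r. (1 * r) ^ (2 * j)) has_integral (1 ^ (2 * j) / (real (2 * j) + 1))) {0..1::real}" for j
        by (rule has_integral_power_segment)
      then show "(?b has_integral ?I) {0..1}"
        by (intro has_integral_mult_right has_integral_sum) auto
      fix r :: real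
      have "(\<Sum>k\<in>F. sob k * (cmod (G (0 + r * (t - 0)) (?u (0 + r * (t - 0))) k))\<^sup>2) \<le> L\<^sup>2 * ?E n (0 + r * (t - 0))"
        by (rule wl2D[OF G_sob F]) (use Suc in blast)
      also have "\<dots> = ?b r"
        by (simp add: power_mult_distrib power_mult[symmetric] mult_ac)
      finally show "(\<Sum>k\<in>F. sob k * (cmod (G (0 + r * (t - 0)) (?u (0 + r * (t - 0))) k))\<^sup>2) \<le> ?b r" .
    qed simp
    have "wl2 sob (iter a (Suc n) t) (2 * A + 2 * ((t - 0)\<^sup>2 * ?I))"
      using wl2_add[OF a inc sob_nonneg] by simp
    moreover have "2 * A + 2 * ((t - 0)\<^sup>2 * ?I) \<le> ?E (Suc n) t"
    proof -
      have "2 * ((t - 0)\<^sup>2 * ?I) = 2 * A * (\<Sum>j\<le>n. (2 * L\<^sup>2 * t\<^sup>2) ^ Suc j / (fact j * (real (2 * j) + 1)))"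
        by (simp add: sum_distrib_left mult_ac)
      also have "\<dots> \<le> 2 * A * (\<Sum>j\<le>n. (2 * L\<^sup>2 * t\<^sup>2) ^ Suc j / (fact j * (real j + 1)))"
        by (intro mult_left_mono sum_mono divide_left_mono) (use A in auto)
      also have "\<dots> = 2 * A * (\<Sum>j\<le>n. (2 * L\<^sup>2 * t\<^sup>2) ^ Suc j / fact (Suc j))"
        by (simp add: algebra_simps)
      finally have "2 * A + 2 * ((t - 0)\<^sup>2 * ?I) \<le> 2 * A * (1 + (\<Sum>j\<le>n. (2 * L\<^sup>2 * t\<^sup>2) ^ Suc j / fact (Suc j)))"
        by (simp add: distrib_left)
      also have "1 + (\<Sum>j\<le>n. (2 * L\<^sup>2 * t\<^sup>2) ^ Suc j / fact (Suc j)) = (\<Sum>j\<le>Suc n. (2 * L\<^sup>2 * t\<^sup>2) ^ j / fact j)"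
        by (subst sum.atMost_Suc_shift) simp
      finally show ?thesis .
    qed
    ultimately show ?thesis by (rule wl2_mono)
  qed
  moreover have "wcont sob (iter a (Suc n))" by (rule wcont_duhamel[OF d' u loc])
  ultimately show ?case by blast
qed

lemma iter_bound:
  assumes a: "wl2 sob a A"
  shows "wl2 sob (iter a n t) (2 * A * exp (2 * L\<^sup>2 * t\<^sup>2))"
proof -
  have "2 * A * (\<Sum>j\<le>n. (2 * L\<^sup>2 * t\<^sup>2) ^ j / fact j) \<le> 2 * A * exp (2 * L\<^sup>2 * t\<^sup>2)"
    using wl2_nonneg[OF a] by (intro mult_left_mono exp_partial_sum_le) auto
  then show ?thesis using iter_bound_aux[OF a] wl2_mono by blast
qed

lemma iter_props:
  assumes a: "wl2 sob a A"
  shows "wcont (\<lambda>_. 1) (iter a n)" and "\<exists>B. wl2 sob (iter a n t) B"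
    and "continuous_on UNIV (\<lambda>t. G t (iter a n t) k)"
    and "((\<lambda>t. iter a (Suc n) t k) has_vector_derivative G t (iter a n t) k) (at t)"
proof -
  show 1: "wcont (\<lambda>_. 1) (iter a n)" using iter_bound_aux[OF a] wcont_sob_one by blast
  have 2: "\<exists>B. wl2 sob (iter a n t) B" for t using iter_bound[OF a] by blast
  then show "\<exists>B. wl2 sob (iter a n t) B" .
  show "continuous_on UNIV (\<lambda>t. G t (iter a n t) k)" by (rule continuous_G[OF 1 2])
  from has_vector_derivative_add[OF has_vector_derivative_const antider_has_vector_derivative[OF this]]
  show "((\<lambda>t. iter a (Suc n) t k) has_vector_derivative G t (iter a n t) k) (at t)" by simp
qed

lemma iter_0_time: "iter a n 0 k = a k"
  by (cases n) auto

lemma iter_diff: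
  assumes a: "wl2 sob a A"
  shows "wl2 (\<lambda>_. 1) (\<lambda>k. iter a (Suc n) t k - iter a n t k) (A * (L\<^sup>2 * t\<^sup>2) ^ Suc n / fact (Suc n))"
proof (induction n arbitrary: t)
  case 0
  have A: "0 \<le> A" by (rule wl2_nonneg[OF a])
  have "wl2 (\<lambda>_. 1) (\<lambda>k. iter a (Suc 0) t k - a k) (A * (L\<^sup>2 * t\<^sup>2) ^ Suc 0 / fact (Suc 0))"
  \<comment> \<open>The constant curve \<open>a\<close> counts as driven by the zero curve, since
    \<open>G\<close> vanishes at zero; so the first difference is a case of the general
    step.\<close>
  proof (rule picard_step[where p = "\<lambda>_. a" and q = "\<lambda>_ _. 0" and V = "\<lambda>_. a" and n = 0])
    have "evol \<tau> (\<lambda>_. 0) = (\<lambda>_. 0)" for \<tau> by (simp add: evol_def fun_eq_iff)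
    then have z: "G \<tau> (\<lambda>_. 0) k = 0" for \<tau> k by (simp add: G_def N_zero)
    show "((\<lambda>\<tau>. iter a (Suc 0) \<tau> k) has_vector_derivative G \<tau> a k) (at \<tau>)" for \<tau> k
      using iter_props(4)[OF a, of 0] by simp
    show "((\<lambda>\<tau>. a k) has_vector_derivative G \<tau> (\<lambda>_. 0) k) (at \<tau>)" for \<tau> k
      by (simp add: z)
    show "continuous_on {-\<bar>t\<bar>..\<bar>t\<bar>} (\<lambda>\<tau>. G \<tau> a k)" for k
      using continuous_on_subset[OF iter_props(3)[OF a, of 0]] by simp
    show "continuous_on {-\<bar>t\<bar>..\<bar>t\<bar>} (\<lambda>\<tau>. G \<tau> (\<lambda>_. 0) k)" for k by (simp add: z)
    show "\<exists>B. wl2 sob (\<lambda>_. 0) B" by (auto simp: wl2_def)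
    show "wl2 (\<lambda>_. 1) (\<lambda>k. a k - 0) (A * (L\<^sup>2 * \<tau>\<^sup>2) ^ 0 / fact 0)" for \<tau>
      using wl2_sob_one[OF a] by simp
  qed (use a A in auto)
  then show ?case by simp
next
  case (Suc n)
  show ?case
    by (rule picard_step[where p = "iter a (Suc n)" and q = "iter a n" and n = "Suc n",
        OF iter_props(4)[OF a] iter_props(4)[OF a] _ continuous_on_subset[OF iter_props(3)[OF a] subset_UNIV]
        continuous_on_subset[OF iter_props(3)[OF a] subset_UNIV] iter_props(2)[OF a] iter_props(2)[OF a] Suc wl2_nonneg[OF a]])
       (simp add: iter_0_time del: iter.simps)
qed

text \<open>Trades factorial for geometric decay: x^(n+1) / (n+1)! is at most exp(4x) / 4^(n+1), and
  in norms instead of squares the ratio 1/4 becomes 1/2.\<close>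

definition Q :: "real \<Rightarrow> real \<Rightarrow> real" where
  "Q A t = sqrt (A * exp (4 * (L\<^sup>2 * t\<^sup>2)))"

lemma Q_nonneg: "0 \<le> A \<Longrightarrow> 0 \<le> Q A t" by (simp add: Q_def)

lemma Q_mono: "0 \<le> A \<Longrightarrow> \<bar>s\<bar> \<le> T \<Longrightarrow> Q A s \<le> Q A T"
  unfolding Q_def by (intro real_sqrt_le_mono mult_left_mono iffD2[OF exp_le_cancel_iff] mult_left_mono)
    (auto simp: abs_le_square_iff[symmetric])

lemma iter_diff_geometric:
  assumes a: "wl2 sob a A"
  shows "wl2 (\<lambda>_. 1) (\<lambda>k. iter a (Suc n) t k - iter a n t k) ((Q A t * (1 / 2) ^ n)\<^sup>2)"
proof (rule wl2_mono[OF iter_diff[OF a]])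
  have A: "0 \<le> A" by (rule wl2_nonneg[OF a])
  let ?x = "L\<^sup>2 * t\<^sup>2"
  have "(4 * ?x) ^ Suc n / fact (Suc n) \<le> (\<Sum>j\<le>Suc n. (4 * ?x) ^ j / fact j)"
    by (rule member_le_sum) auto
  also have "\<dots> \<le> exp (4 * ?x)" by (rule exp_partial_sum_le) simp
  finally have "4 ^ Suc n * (?x ^ Suc n / fact (Suc n)) \<le> exp (4 * ?x)"
    by (simp only: power_mult_distrib times_divide_eq_right)
  then have "?x ^ Suc n / fact (Suc n) \<le> exp (4 * ?x) * (1 / 4) ^ Suc n"
    by (simp add: power_divide field_simps)
  also have "\<dots> \<le> exp (4 * ?x) * (1 / 4) ^ n" by (intro mult_left_mono power_decreasing) auto
  finally have "A * (?x ^ Suc n / fact (Suc n)) \<le> A * (exp (4 * ?x) * (1 / 4) ^ n)"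
    using A by (rule mult_left_mono)
  also have "\<dots> = (Q A t * (1 / 2) ^ n)\<^sup>2"
  proof -
    have "((1 / 2) ^ n)\<^sup>2 = (1 / 4 :: real) ^ n" by (simp add: power2_eq_square power_mult_distrib[symmetric])
    then show ?thesis using A by (simp add: Q_def power_mult_distrib)
  qed
  finally show "A * ?x ^ Suc n / fact (Suc n) \<le> (Q A t * (1 / 2) ^ n)\<^sup>2" by simp
qed

text \<open>The factor \<open>1 - (1 / 2) ^ j\<close> turns the bound into the exact partial
  geometric sum, so the induction on \<open>j\<close> closes with equality.\<close>

lemma iter_tail:
  assumes a: "wl2 sob a A"
  shows "wl2 (\<lambda>_. 1) (\<lambda>k. iter a (n + j) t k - iter a n t k) ((2 * Q A t * (1 / 2) ^ n * (1 - (1 / 2) ^ j))\<^sup>2)"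
proof (induction j)
  case 0
  then show ?case by (simp add: wl2_def)
next
  case (Suc j)
  have Q0: "0 \<le> Q A t" by (rule Q_nonneg[OF wl2_nonneg[OF a]])
  have "wl2 (\<lambda>_. 1) (\<lambda>k. (iter a (Suc (n + j)) t k - iter a (n + j) t k) + (iter a (n + j) t k - iter a n t k))
      ((Q A t * (1 / 2) ^ (n + j) + 2 * Q A t * (1 / 2) ^ n * (1 - (1 / 2) ^ j))\<^sup>2)"
    by (rule wl2_triangle[OF iter_diff_geometric[OF a] Suc]) (use Q0 in \<open>auto simp: power_le_one\<close>)
  moreover have "Q A t * (1 / 2) ^ (n + j) + 2 * Q A t * (1 / 2) ^ n * (1 - (1 / 2) ^ j)
      = 2 * Q A t * (1 / 2) ^ n * (1 - (1 / 2) ^ Suc j)"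
    by (simp add: power_add algebra_simps)
  ultimately show ?case by (simp del: iter.simps)
qed

lemma iter_tail':
  assumes a: "wl2 sob a A" and "n \<le> p"
  shows "wl2 (\<lambda>_. 1) (\<lambda>k. iter a p t k - iter a n t k) ((2 * Q A t * (1 / 2) ^ n)\<^sup>2)"
proof -
  have "2 * Q A t * (1 / 2) ^ n * (1 - (1 / 2) ^ (p - n)) \<le> 2 * Q A t * (1 / 2) ^ n * 1"
    by (rule mult_left_mono) (use Q_nonneg[OF wl2_nonneg[OF a]] in auto)
  moreover have "0 \<le> 2 * Q A t * (1 / 2) ^ n * (1 - (1 / 2) ^ (p - n))"
    using Q_nonneg[OF wl2_nonneg[OF a]] by (intro mult_nonneg_nonneg) (auto simp: power_le_one)
  ultimately have "(2 * Q A t * (1 / 2) ^ n * (1 - (1 / 2) ^ (p - n)))\<^sup>2 \<le> (2 * Q A t * (1 / 2) ^ n)\<^sup>2"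
    by (intro power_mono) auto
  with wl2_mono[OF iter_tail[OF a, of n "p - n" t]] assms(2) show ?thesis by simp
qed

section \<open>The global flow as the limit of the iterates\<close>

definition sol :: "(int \<Rightarrow> complex) \<Rightarrow> real \<Rightarrow> int \<Rightarrow> complex" where
  "sol a t k = lim (\<lambda>n. iter a n t k)"

lemma iter_LIMSEQ:
  assumes a: "wl2 sob a A"
  shows "(\<lambda>n. iter a n t k) \<longlonglongrightarrow> sol a t k"
proof -
  have "norm (iter a (Suc n) t k - iter a n t k) \<le> Q A t * (1 / 2) ^ n" for n
  proof -
    have "(cmod (iter a (Suc n) t k - iter a n t k))\<^sup>2 \<le> (Q A t * (1 / 2) ^ n)\<^sup>2"
      by (rule wl2_one_single[OF iter_diff_geometric[OF a]])
    then show ?thesis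
      by (rule power2_le_imp_le) (use Q_nonneg[OF wl2_nonneg[OF a]] in simp)
  qed
  then have "summable (\<lambda>n. iter a (Suc n) t k - iter a n t k)"
    by (rule summable_comparison_test'[where N = 0, rotated])
       (intro summable_mult summable_geometric, simp)
  then have "convergent (\<lambda>n. (\<Sum>i<n. iter a (Suc i) t k - iter a i t k) + iter a 0 t k)"
    by (intro convergent_add convergent_const) (simp only: summable_iff_convergent)
  moreover have "(\<Sum>i<n. iter a (Suc i) t k - iter a i t k) + iter a 0 t k = iter a n t k" for n
    using sum_lessThan_telescope[of "\<lambda>i. iter a i t k" n] by (simp del: iter.simps)
  ultimately have "convergent (\<lambda>n. iter a n t k)" by (simp del: iter.simps)
  then show ?thesis by (simp add: sol_def convergent_LIMSEQ_iff)
qed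

lemma sol_sob:
  assumes a: "wl2 sob a A"
  shows "wl2 sob (sol a t) (2 * A * exp (2 * L\<^sup>2 * t\<^sup>2))"
  by (rule wl2_limit[OF always_eventually iter_LIMSEQ[OF a]]) (simp add: iter_bound[OF a])

lemma sol_iter:
  assumes a: "wl2 sob a A"
  shows "wl2 (\<lambda>_. 1) (\<lambda>k. sol a t k - iter a n t k) ((2 * Q A t * (1 / 2) ^ n)\<^sup>2)"
proof (rule wl2_limit)
  show "\<forall>\<^sub>F p in sequentially. wl2 (\<lambda>_. 1) (\<lambda>k. iter a p t k - iter a n t k) ((2 * Q A t * (1 / 2) ^ n)\<^sup>2)"
    using eventually_ge_at_top[of n] by eventually_elim (rule iter_tail'[OF a])
  show "(\<lambda>p. iter a p t k - iter a n t k) \<longlonglongrightarrow> sol a t k - iter a n t k" for k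
    by (rule tendsto_diff[OF iter_LIMSEQ[OF a] tendsto_const])
qed

lemma Q_half_power_tendsto: "(\<lambda>n. (2 * Q A t * (1 / 2) ^ n)\<^sup>2) \<longlonglongrightarrow> 0"
proof -
  have "(\<lambda>n. (2 * Q A t * (1 / 2) ^ n)\<^sup>2) \<longlonglongrightarrow> (2 * Q A t * 0)\<^sup>2"
    by (intro tendsto_intros LIMSEQ_realpow_zero) auto
  then show ?thesis by simp
qed

text \<open>The iterates converge uniformly on bounded time intervals because \<open>Q\<close> is
  monotone in the modulus of time.\<close>

lemma sol_wcont:
  assumes a: "wl2 sob a A"
  shows "wcont (\<lambda>_. 1) (sol a)"
  unfolding wcont_def
proof (intro allI impI)
  fix t e :: real assume e: "0 < e"
  let ?B = "\<lambda>n. (2 * Q A (\<bar>t\<bar> + 1) * (1 / 2) ^ n)\<^sup>2"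
  have "\<forall>\<^sub>F n in sequentially. ?B n < e / 16"
    using e by (intro order_tendstoD(2)[OF Q_half_power_tendsto]) auto
  then obtain n where n: "?B n < e / 16" by (auto dest: eventually_happens)
  \<comment> \<open>Three differences of size \<open>e / 16\<close> combine through
    \<open>wl2_add\<close> to \<open>10 * e / 16\<close>.\<close>
  have near: "wl2 (\<lambda>_. 1) (\<lambda>k. sol a s k - iter a n s k) (e / 16)" if "\<bar>s\<bar> \<le> \<bar>t\<bar> + 1" for s
  proof (rule wl2_mono[OF sol_iter[OF a]])
    have A: "0 \<le> A" by (rule wl2_nonneg[OF a])
    have "(2 * Q A s * (1 / 2) ^ n)\<^sup>2 \<le> ?B n"
      by (intro power_mono mult_right_mono mult_left_mono Q_mono) (use A that in \<open>auto simp: Q_nonneg\<close>)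
    then show "(2 * Q A s * (1 / 2) ^ n)\<^sup>2 \<le> e / 16" using n by simp
  qed
  have "\<forall>\<^sub>F s in at t. wl2 (\<lambda>_. 1) (\<lambda>k. iter a n s k - iter a n t k) (e / 16)"
    by (rule wcontD[OF iter_props(1)[OF a]]) (use e in simp)
  moreover have "((\<lambda>s. \<bar>s\<bar>) \<longlongrightarrow> \<bar>t\<bar>) (at t)" by (intro tendsto_intros)
  then have "\<forall>\<^sub>F s in at t. \<bar>s\<bar> < \<bar>t\<bar> + 1" by (intro order_tendstoD) auto
  ultimately show "\<forall>\<^sub>F s in at t. wl2 (\<lambda>_. 1) (\<lambda>k. sol a s k - sol a t k) e"
  proof eventually_elim
    case (elim s)
    have 1: "wl2 (\<lambda>_. 1) (\<lambda>k. sol a s k - iter a n s k) (e / 16)" by (rule near) (use elim in simp)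
    have 2: "wl2 (\<lambda>_. 1) (\<lambda>k. - (sol a t k - iter a n t k)) (e / 16)" unfolding wl2_minus by (rule near) simp
    have "wl2 (\<lambda>_. 1) (\<lambda>k. ((sol a s k - iter a n s k) + (iter a n s k - iter a n t k)) + - (sol a t k - iter a n t k))
        (2 * (2 * (e / 16) + 2 * (e / 16)) + 2 * (e / 16))"
      by (intro wl2_add 1 2 elim) auto
    moreover have "(\<lambda>k. ((sol a s k - iter a n s k) + (iter a n s k - iter a n t k)) + - (sol a t k - iter a n t k))
        = (\<lambda>k. sol a s k - sol a t k)" by (simp add: fun_eq_iff)
    ultimately have "wl2 (\<lambda>_. 1) (\<lambda>k. sol a s k - sol a t k) (2 * (2 * (e / 16) + 2 * (e / 16)) + 2 * (e / 16))"
      by (simp only:)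
    then show ?case by (rule wl2_mono) (use e in simp)
  qed
qed

text \<open>Both \<open>sol\<close> and its Duhamel integral are limits of the shifted iterates: one
  Picard step, driven by \<open>sol a\<close> and by \<open>iter a n\<close>, bounds the distance of
  the integral to \<open>iter a (Suc n)\<close>. So the integral equation holds exactly and can be
  differentiated.\<close>

lemma sol_deriv:
  assumes a: "wl2 sob a A"
  shows "((\<lambda>t. sol a t k) has_vector_derivative G t (sol a t) k) (at t)"
proof -
  have h: "\<exists>B. wl2 sob (sol a t) B" for t using sol_sob[OF a] by blast
  note c = continuous_G[OF sol_wcont[OF a] h]
  let ?V = "\<lambda>t k. a k + antider (\<lambda>\<tau>. G \<tau> (sol a \<tau>) k) t"
  have V: "((\<lambda>t. ?V t k) has_vector_derivative G t (sol a t) k) (at t)" for t k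
    using has_vector_derivative_add[OF has_vector_derivative_const antider_has_vector_derivative[OF c]] by simp
  have eq: "sol a t k = ?V t k" for t k
  proof (rule LIMSEQ_unique)
    show "(\<lambda>n. iter a (Suc n) t k) \<longlonglongrightarrow> sol a t k"
      using iter_LIMSEQ[OF a] by (rule LIMSEQ_Suc)
    have le: "(cmod (?V t k - iter a (Suc n) t k))\<^sup>2 \<le> (2 * Q A t * (1 / 2) ^ n)\<^sup>2 * (L\<^sup>2 * t\<^sup>2)" for n
    proof -
      have "wl2 (\<lambda>_. 1) (\<lambda>k. ?V t k - iter a (Suc n) t k) ((2 * Q A t * (1 / 2) ^ n)\<^sup>2 * (L\<^sup>2 * t\<^sup>2) ^ Suc 0 / fact (Suc 0))"
      proof (rule picard_step[where p = "sol a" and q = "iter a n" and n = 0, OF V iter_props(4)[OF a] _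
            continuous_on_subset[OF c subset_UNIV] continuous_on_subset[OF iter_props(3)[OF a] subset_UNIV] h iter_props(2)[OF a]])
        fix \<tau> :: real assume "\<bar>\<tau>\<bar> \<le> \<bar>t\<bar>"
        moreover have A: "0 \<le> A" by (rule wl2_nonneg[OF a])
        ultimately have "(2 * Q A \<tau> * (1 / 2) ^ n)\<^sup>2 \<le> (2 * Q A t * (1 / 2) ^ n)\<^sup>2"
          using Q_mono[of A \<tau> "\<bar>t\<bar>"] Q_nonneg[of A \<tau>]
          by (intro power_mono mult_right_mono mult_left_mono) (auto simp: Q_def)
        then show "wl2 (\<lambda>_. 1) (\<lambda>k. sol a \<tau> k - iter a n \<tau> k) ((2 * Q A t * (1 / 2) ^ n)\<^sup>2 * (L\<^sup>2 * \<tau>\<^sup>2) ^ 0 / fact 0)"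
          using wl2_mono[OF sol_iter[OF a]] by simp
      qed auto
      from wl2_one_single[OF this] show ?thesis by (simp del: iter.simps)
    qed
    have lim: "(\<lambda>n. (2 * Q A t * (1 / 2) ^ n)\<^sup>2 * (L\<^sup>2 * t\<^sup>2)) \<longlonglongrightarrow> 0"
      using tendsto_mult_right[OF Q_half_power_tendsto[of A t], of "L\<^sup>2 * t\<^sup>2"] by simp
    have "(\<lambda>n. (cmod (?V t k - iter a (Suc n) t k))\<^sup>2) \<longlonglongrightarrow> 0"
    proof (rule tendsto_sandwich[OF _ _ tendsto_const lim])
      show "\<forall>\<^sub>F n in sequentially. (cmod (?V t k - iter a (Suc n) t k))\<^sup>2 \<le> (2 * Q A t * (1 / 2) ^ n)\<^sup>2 * (L\<^sup>2 * t\<^sup>2)"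
        using le by (intro always_eventually allI)
    qed (intro always_eventually allI zero_le_power2)
    then have "(\<lambda>n. sqrt ((cmod (?V t k - iter a (Suc n) t k))\<^sup>2)) \<longlonglongrightarrow> sqrt 0"
      by (rule tendsto_real_sqrt)
    then have "(\<lambda>n. cmod (?V t k - iter a (Suc n) t k)) \<longlonglongrightarrow> 0"
      by (simp only: real_sqrt_abs abs_norm_cancel real_sqrt_zero)
    then have "(\<lambda>n. ?V t k - iter a (Suc n) t k) \<longlonglongrightarrow> 0"
      by (rule tendsto_norm_zero_cancel)
    from tendsto_diff[OF tendsto_const[of "?V t k"] this]
    show "(\<lambda>n. iter a (Suc n) t k) \<longlonglongrightarrow> ?V t k" by (simp del: iter.simps)
  qed
  have "(\<lambda>t. sol a t k) = (\<lambda>t. ?V t k)" by (rule ext) (rule eq)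
  then show ?thesis using V by (simp only:)
qed

lemma sol_0: assumes "wl2 sob a A" shows "sol a 0 = a"
  by (rule ext, rule LIMSEQ_unique[OF iter_LIMSEQ[OF assms]]) (simp add: iter_0_time)

text \<open>Convergence of the iterates is controlled only in l^2; continuity in H^1 comes from the
  equation together with the local \<open>sob\<close> bounds.\<close>

lemma sol_wcont_sob:
  assumes a: "wl2 sob a A"
  shows "wcont sob (sol a)"
proof (rule wcont_duhamel[OF sol_deriv[OF a] sol_wcont[OF a]])
  fix T
  show "\<exists>B. \<forall>t. \<bar>t\<bar> \<le> T \<longrightarrow> wl2 sob (sol a t) B"
  proof (intro exI allI impI)
    fix t assume "\<bar>t\<bar> \<le> T"
    then have "t\<^sup>2 \<le> T\<^sup>2" by (simp add: abs_le_square_iff[symmetric])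
    then have "2 * A * exp (2 * L\<^sup>2 * t\<^sup>2) \<le> 2 * A * exp (2 * L\<^sup>2 * T\<^sup>2)"
      using wl2_nonneg[OF a] by (intro mult_left_mono) (auto intro!: mult_left_mono)
    then show "wl2 sob (sol a t) (2 * A * exp (2 * L\<^sup>2 * T\<^sup>2))" using wl2_mono[OF sol_sob[OF a]] by blast
  qed
qed

end

subsection \<open>Conservation laws\<close>

text \<open>Differentiability is asked of the approximations only: their increments are integrals of
  \<open>\<mu> n\<close> over the time segment, and these tend to 0 by dominated
  convergence.\<close>

lemma constant_of_vanishing_derivatives:
  fixes \<phi> \<mu> :: "nat \<Rightarrow> real \<Rightarrow> real"
  assumes d: "\<And>n \<tau>. (\<phi> n has_real_derivative \<mu> n \<tau>) (at \<tau>)"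
    and c: "\<And>n. continuous_on UNIV (\<mu> n)"
    and b: "\<And>n \<tau>. \<bar>\<tau>\<bar> \<le> \<bar>t\<bar> \<Longrightarrow> \<bar>\<mu> n \<tau>\<bar> \<le> C"
    and z: "\<And>\<tau>. (\<lambda>n. \<mu> n \<tau>) \<longlonglongrightarrow> 0"
    and lim: "\<And>\<tau>. (\<lambda>n. \<phi> n \<tau>) \<longlonglongrightarrow> \<Phi> \<tau>"
  shows "\<Phi> t = \<Phi> 0"
proof -
  let ?h = "\<lambda>n r. t * \<mu> n (r * t)"
  have eq: "(?h n has_integral (\<phi> n t - \<phi> n 0)) {0..1}" for n
  proof -
    have "(?h n has_integral (\<phi> n (1 * t) - \<phi> n (0 * t))) {0..1}"
    proof (rule fundamental_theorem_of_calculus)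
      fix r :: real
      have "((\<lambda>r. \<phi> n (r * t)) has_real_derivative \<mu> n (r * t) * t) (at r within {0..1})"
        by (rule DERIV_chain2[OF d]) (auto intro!: derivative_eq_intros)
      then show "((\<lambda>r. \<phi> n (r * t)) has_vector_derivative t * \<mu> n (r * t)) (at r within {0..1})"
        by (simp add: has_real_derivative_iff_has_vector_derivative mult.commute)
    qed simp
    then show ?thesis by simp
  qed
  have "(\<lambda>n. integral {0..1} (?h n)) \<longlonglongrightarrow> integral {0..1::real} (\<lambda>r. 0 :: real)"
  proof (rule dominated_convergence(2))
    show "?h n integrable_on {0..1}" for n using eq by (rule has_integral_integrable)
    show "(\<lambda>r. \<bar>t\<bar> * C) integrable_on {0..1::real}" by (rule integrable_const_ivl)
    show "norm (?h n r) \<le> \<bar>t\<bar> * C" if "r \<in> {0..1}" for n r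
    proof -
      have "\<bar>r * t\<bar> \<le> \<bar>t\<bar>" using that by (simp add: abs_mult mult_left_le_one_le)
      then show ?thesis by (simp add: abs_mult mult_left_mono b)
    qed
    show "(\<lambda>n. ?h n r) \<longlonglongrightarrow> 0" for r
      using tendsto_mult_left[OF z, of t] by simp
  qed
  then have "(\<lambda>n. \<phi> n t - \<phi> n 0) \<longlonglongrightarrow> 0" by (simp only: integral_unique[OF eq] integral_0)
  moreover have "(\<lambda>n. \<phi> n t - \<phi> n 0) \<longlonglongrightarrow> \<Phi> t - \<Phi> 0" by (intro tendsto_diff lim)
  ultimately have "\<Phi> t - \<Phi> 0 = 0" by (rule LIMSEQ_unique[rotated])
  then show ?thesis by simp
qed

lemma has_real_derivative_norm_sq:
  fixes g :: "real \<Rightarrow> complex"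
  assumes "(g has_vector_derivative g') (at t within S)"
  shows "((\<lambda>t. (cmod (g t))\<^sup>2) has_real_derivative 2 * Re (cnj (g t) * g')) (at t within S)"
proof -
  have "((\<lambda>t. g t \<bullet> g t) has_derivative (\<lambda>h. g t \<bullet> (h *\<^sub>R g') + (h *\<^sub>R g') \<bullet> g t)) (at t within S)"
    using assms unfolding has_vector_derivative_def by (intro has_derivative_inner)
  moreover have "(\<lambda>h. g t \<bullet> (h *\<^sub>R g') + (h *\<^sub>R g') \<bullet> g t) = (*) (2 * Re (cnj (g t) * g'))"
    by (rule ext) (simp add: inner_complex_def algebra_simps)
  ultimately show ?thesis
    by (simp only: has_field_derivative_def power2_norm_eq_inner)
qed

definition trunc :: "int set \<Rightarrow> (int \<Rightarrow> complex) \<Rightarrow> int \<Rightarrow> complex" where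
  "trunc F c k = (if k \<in> F then c k else 0)"

lemma psum_trunc: "finite F \<Longrightarrow> psum F c = trig (trunc F c)"
  unfolding psum_def trig_def trunc_def
  by (rule ext, subst infsum_cong_neutral[where T = F and g = "\<lambda>k. c k * cis (of_int k * _)"]) auto

lemma wl2_trunc: "wl2 w c B \<Longrightarrow> (\<And>k. 0 \<le> w k) \<Longrightarrow> wl2 w (trunc F c) B"
  by (erule wl2_norm_mono) (auto simp: trunc_def)

lemma wl2_diff_trunc:
  assumes s: "(\<lambda>k. (cmod (c k))\<^sup>2) summable_on UNIV" and F: "finite F"
  shows "wl2 (\<lambda>_. 1) (\<lambda>k. c k - trunc F c k) ((\<Sum>\<^sub>\<infinity>k. (cmod (c k))\<^sup>2) - (\<Sum>k\<in>F. (cmod (c k))\<^sup>2))"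
  unfolding wl2_def
proof (intro allI impI)
  fix E :: "int set" assume E: "finite E"
  have "(\<Sum>k\<in>E. 1 * (cmod (c k - trunc F c k))\<^sup>2) = (\<Sum>k\<in>E - F. (cmod (c k))\<^sup>2)"
    using E by (intro sum.mono_neutral_cong_right) (auto simp: trunc_def)
  moreover have "(\<Sum>k\<in>E - F. (cmod (c k))\<^sup>2) + (\<Sum>k\<in>F. (cmod (c k))\<^sup>2) = (\<Sum>k\<in>(E - F) \<union> F. (cmod (c k))\<^sup>2)"
    by (rule sum.union_disjoint[symmetric]) (use E F in auto)
  moreover have "\<dots> \<le> (\<Sum>\<^sub>\<infinity>k. (cmod (c k))\<^sup>2)"
    by (rule finite_sum_le_infsum[OF s]) (use E F in auto)
  ultimately show "(\<Sum>k\<in>E. 1 * (cmod (c k - trunc F c k))\<^sup>2) \<le> (\<Sum>\<^sub>\<infinity>k. (cmod (c k))\<^sup>2) - (\<Sum>k\<in>F. (cmod (c k))\<^sup>2)"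
    by linarith
qed

lemma sq_le_sob: "((of_int k)\<^sup>2)\<^sup>2 \<le> sob k * sob k"
  unfolding power2_eq_square[of "(of_int k)\<^sup>2"] by (intro mult_mono) (auto simp: sob_def)

text \<open>Weak convergence in the weighted space: splitting off a tail of \<open>w\<close>, only finitely many
  frequencies have to be controlled in the unweighted norm.\<close>

lemma weighted_pairing_tendsto_0:
  assumes w: "wl2 sob w B" and D: "\<And>n. wl2 sob (D n) C" and e: "\<And>n. wl2 (\<lambda>_. 1) (D n) (\<epsilon> n)"
    and \<epsilon>: "\<epsilon> \<longlonglongrightarrow> 0" and F: "\<And>n. finite (F n)"
  shows "(\<lambda>n. \<Sum>k\<in>F n. (of_int k)\<^sup>2 * (cmod (w k) * cmod (D n k))) \<longlonglongrightarrow> 0"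
proof (rule tendstoI)
  fix r :: real assume r: "0 < r"
  have C: "0 \<le> C" by (rule wl2_nonneg[OF D])
  define s where "s = sqrt C"
  \<comment> \<open>Chosen so that \<open>sqrt e * s\<close> is at most \<open>r / 2\<close>;
    \<open>s + 1\<close> excludes division by 0.\<close>
  define e where "e = (r / (2 * (s + 1)))\<^sup>2"
  have sC: "0 \<le> s" using C by (simp add: s_def)
  have e0: "0 < e" using r sC by (simp add: e_def)
  obtain m :: nat where m: "\<And>E. finite E \<Longrightarrow> E \<inter> {- int m..int m} = {} \<Longrightarrow> (\<Sum>k\<in>E. sob k * (cmod (w k))\<^sup>2) \<le> e"
    using wl2_small_tail[OF w sob_nonneg e0] by metis
  let ?I = "{- int m..int m}"
  let ?S = "\<Sum>k\<in>?I. (of_int k)\<^sup>2 * cmod (w k)"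
  have "(\<lambda>n. ?S * sqrt (\<epsilon> n)) \<longlonglongrightarrow> ?S * sqrt 0" by (intro tendsto_intros \<epsilon>)
  then have "\<forall>\<^sub>F n in sequentially. ?S * sqrt (\<epsilon> n) < r / 2" using r by (intro order_tendstoD) auto
  then show "\<forall>\<^sub>F n in sequentially. dist (\<Sum>k\<in>F n. (of_int k)\<^sup>2 * (cmod (w k) * cmod (D n k))) 0 < r"
  proof eventually_elim
    case (elim n)
    let ?t = "\<lambda>k. (of_int k)\<^sup>2 * (cmod (w k) * cmod (D n k)) :: real"
    have "sum ?t (F n) = sum ?t (F n \<inter> ?I) + sum ?t (F n - ?I)" by (rule sum.Int_Diff[OF F])
    moreover have "sum ?t (F n \<inter> ?I) \<le> ?S * sqrt (\<epsilon> n)"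
    proof -
      have "sum ?t (F n \<inter> ?I) \<le> sum ?t ?I" by (rule sum_mono2) auto
      also have "\<dots> \<le> (\<Sum>k\<in>?I. (of_int k)\<^sup>2 * cmod (w k) * sqrt (\<epsilon> n))"
      proof (rule sum_mono)
        fix k
        have "cmod (D n k) \<le> sqrt (\<epsilon> n)" by (rule real_le_rsqrt[OF wl2_one_single[OF e]])
        then show "?t k \<le> (of_int k)\<^sup>2 * cmod (w k) * sqrt (\<epsilon> n)"
          unfolding mult.assoc by (intro mult_left_mono) auto
      qed
      finally show ?thesis by (simp add: sum_distrib_right)
    qed
    moreover have "sum ?t (F n - ?I) \<le> r / 2"
    proof -
      have "sum ?t (F n - ?I) \<le> (\<Sum>k\<in>F n - ?I. (sqrt (sob k) * cmod (w k)) * (sqrt (sob k) * cmod (D n k)))"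
      proof (rule sum_mono)
        fix k
        have "(of_int k)\<^sup>2 * (cmod (w k) * cmod (D n k)) \<le> sob k * (cmod (w k) * cmod (D n k))"
          by (rule mult_right_mono) (auto simp: sob_def)
        also have "\<dots> = (sqrt (sob k) * sqrt (sob k)) * (cmod (w k) * cmod (D n k))"
          using sob_nonneg[of k] by simp
        finally show "?t k \<le> (sqrt (sob k) * cmod (w k)) * (sqrt (sob k) * cmod (D n k))" by (simp only: mult_ac)
      qed
      also have "\<dots> \<le> sqrt e * sqrt C"
        using m[of "F n - ?I"] wl2D[OF D, of "F n - ?I"] F[of n]
        by (intro sum_mult_le_sqrt) (auto simp: power_mult_distrib sob_nonneg)
      also have "\<dots> = r / (2 * (s + 1)) * s"
        using r sC by (simp add: e_def s_def[symmetric])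
      also have "\<dots> \<le> r / 2" using r sC by (simp add: field_simps)
      finally show ?thesis .
    qed
    moreover have "0 \<le> sum ?t (F n)" by (intro sum_nonneg) auto
    ultimately show ?case using elim by (simp add: dist_real_def)
  qed
qed

section \<open>Potential energy of frequency truncations\<close>

context lipschitz_nls
begin

text \<open>Dividing by \<open>2 * pi\<close> matches Parseval's identity, so that kinetic and
  potential energy share the one factor \<open>2 * pi\<close>.\<close>

definition pot :: "(int \<Rightarrow> complex) \<Rightarrow> real" where
  "pot c = (\<integral>x. \<Psi> ((cmod (trig c x))\<^sup>2) \<partial>tor) / (2 * pi)"

lemma continuous_\<Psi>: "continuous_on S \<Psi>"
  using \<Psi>_deriv by (intro DERIV_continuous_on) (auto intro: has_field_derivative_at_within)

lemma continuous_\<Psi>_norm: "continuous_on S g \<Longrightarrow> continuous_on S (\<lambda>x. \<Psi> ((cmod (g x))\<^sup>2))"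
  by (rule continuous_on_compose2[OF continuous_\<Psi>[of UNIV]]) (auto intro!: continuous_intros)

lemma pot_psum_LIMSEQ:
  assumes c: "(\<lambda>k. cmod (c k)) summable_on UNIV"
  shows "(\<lambda>n. pot (trunc {- int n..int n} c)) \<longlonglongrightarrow> pot c"
proof -
  let ?p = "\<lambda>n. psum {- int n..int n} c"
  let ?R = "\<Sum>\<^sub>\<infinity>k. cmod (c k)"
  have p: "cmod (?p n x) \<le> ?R" for n x
  proof -
    have "cmod (?p n x) \<le> (\<Sum>k\<in>{- int n..int n}. cmod (c k))"
      unfolding psum_def by (rule order_trans[OF norm_sum]) (simp add: norm_mult)
    also have "\<dots> \<le> ?R" by (rule finite_sum_le_infsum[OF c]) auto
    finally show ?thesis .
  qed
  have "compact (\<Psi> ` {0..?R\<^sup>2})" by (rule compact_continuous_image[OF continuous_\<Psi>]) simp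
  then obtain K where K: "\<forall>y\<in>\<Psi> ` {0..?R\<^sup>2}. norm y \<le> K" using compact_imp_bounded bounded_iff by metis
  have "(\<lambda>n. \<integral>x. \<Psi> ((cmod (?p n x))\<^sup>2) \<partial>tor) \<longlonglongrightarrow> (\<integral>x. \<Psi> ((cmod (trig c x))\<^sup>2) \<partial>tor)"
  proof (rule integral_dominated_convergence[where w = "\<lambda>_. K"])
    show "(\<lambda>x. \<Psi> ((cmod (trig c x))\<^sup>2)) \<in> borel_measurable tor"
      by (intro continuous_borel_tor continuous_\<Psi>_norm continuous_trig c)
    show "(\<lambda>x. \<Psi> ((cmod (?p n x))\<^sup>2)) \<in> borel_measurable tor" for n
      by (intro continuous_borel_tor continuous_\<Psi>_norm continuous_psum)
    show "AE x in tor. (\<lambda>n. \<Psi> ((cmod (?p n x))\<^sup>2)) \<longlonglongrightarrow> \<Psi> ((cmod (trig c x))\<^sup>2)"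
    proof (rule AE_I2)
      fix x
      have "isCont \<Psi> q" for q using \<Psi>_deriv by (rule DERIV_isCont)
      then show "(\<lambda>n. \<Psi> ((cmod (?p n x))\<^sup>2)) \<longlonglongrightarrow> \<Psi> ((cmod (trig c x))\<^sup>2)"
        by (rule isCont_tendsto_compose) (intro tendsto_intros trig_LIMSEQ c)
    qed
    show "AE x in tor. norm (\<Psi> ((cmod (?p n x))\<^sup>2)) \<le> K" for n
    proof (rule AE_I2)
      fix x
      have "(cmod (?p n x))\<^sup>2 \<in> {0..?R\<^sup>2}" using power_mono[OF p[of n x], of 2] by simp
      then show "norm (\<Psi> ((cmod (?p n x))\<^sup>2)) \<le> K" using K by blast
    qed
  qed auto
  then show ?thesis
    unfolding pot_def psum_trunc[symmetric, OF finite_atLeastAtMost_int] by (intro tendsto_intros) auto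
qed

text \<open>A trigonometric polynomial and its time derivative are jointly continuous, so one may
  differentiate under the integral. The chain rule produces a pairing of \<open>f\<close> of the
  polynomial with its time derivative, which reads off only the coefficients in
  \<open>F\<close>.\<close>

lemma pot_derivative:
  assumes F: "finite F" and d: "\<And>t k. ((\<lambda>t. w t k) has_vector_derivative w' t k) (at t)"
    and c: "\<And>k. continuous_on UNIV (\<lambda>t. w' t k)"
  shows "((\<lambda>t. pot (trunc F (w t))) has_real_derivative
    Re (\<Sum>k\<in>F. cnj (N (trunc F (w t)) k) * w' t k)) (at t)"
proof -
  let ?P = "\<lambda>t. psum F (w t)" and ?P' = "\<lambda>t. psum F (w' t)"
  let ?g = "\<lambda>t x. Re (cnj (f (?P t x)) * ?P' t x)"
  have wc: "continuous_on UNIV (\<lambda>t. w t k)" for k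
    using d by (intro continuous_at_imp_continuous_on) (auto intro: has_vector_derivative_continuous)
  have dP: "((\<lambda>t. ?P t x) has_vector_derivative ?P' t x) (at t within UNIV)" for t x
    unfolding psum_def by (intro has_vector_derivative_sum has_vector_derivative_mult_left d)
  have "((\<lambda>t. integral (cbox 0 (2 * pi)) (\<lambda>x. \<Psi> ((cmod (?P t x))\<^sup>2))) has_vector_derivative
      integral (cbox 0 (2 * pi)) (?g t)) (at t within UNIV)"
  proof (rule leibniz_rule_vector_derivative)
    fix t x
    have "((\<lambda>t. \<Psi> ((cmod (?P t x))\<^sup>2)) has_real_derivative m ((cmod (?P t x))\<^sup>2) / 2 * (2 * Re (cnj (?P t x) * ?P' t x))) (at t within UNIV)"
      by (rule DERIV_chain2[OF \<Psi>_deriv has_real_derivative_norm_sq[OF dP]])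
    also have "m ((cmod (?P t x))\<^sup>2) / 2 * (2 * Re (cnj (?P t x) * ?P' t x)) = ?g t x"
      by (simp add: f_def algebra_simps)
    finally show "((\<lambda>t. \<Psi> ((cmod (?P t x))\<^sup>2)) has_vector_derivative ?g t x) (at t within UNIV)"
      by (simp add: has_real_derivative_iff_has_vector_derivative)
  next
    fix t show "(\<lambda>x. \<Psi> ((cmod (?P t x))\<^sup>2)) integrable_on cbox 0 (2 * pi)"
      by (intro integrable_continuous continuous_\<Psi>_norm continuous_psum)
  next
    have cP: "continuous_on S (\<lambda>z. psum F (w (fst z)) (snd z))" for S :: "(real \<times> real) set"
      unfolding psum_def by (intro continuous_intros continuous_on_compose2[OF wc]) auto
    have cP': "continuous_on S (\<lambda>z. psum F (w' (fst z)) (snd z))" for S :: "(real \<times> real) set"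
      unfolding psum_def by (intro continuous_intros continuous_on_compose2[OF c]) auto
    show "continuous_on (UNIV \<times> cbox 0 (2 * pi)) (\<lambda>(t, x). ?g t x)"
      unfolding split_beta
      by (intro continuous_intros continuous_on_compose2[OF continuous_f[of UNIV] cP] cP' subset_UNIV)
  qed auto
  moreover have "integral (cbox 0 (2 * pi)) (\<lambda>x. \<Psi> ((cmod (?P t x))\<^sup>2)) = (\<integral>x. \<Psi> ((cmod (?P t x))\<^sup>2) \<partial>tor)" for t
    unfolding set_integral_tor[symmetric] cbox_interval
    by (intro set_borel_integral_eq_integral(2)[symmetric] borel_integrable_atLeastAtMost'
      continuous_\<Psi>_norm continuous_psum)
  moreover have "integral (cbox 0 (2 * pi)) (?g t) = 2 * pi * Re (\<Sum>k\<in>F. cnj (N (trunc F (w t)) k) * w' t k)"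
  proof -
    have cf: "continuous_on S (\<lambda>x. f (?P t x))" for S
      by (rule continuous_on_compose2[OF continuous_f continuous_psum subset_UNIV])
    have cg: "continuous_on S (?g t)" for S by (intro continuous_intros cf continuous_psum)
    have i: "integrable tor (\<lambda>x. cnj (f (?P t x)) * ?P' t x)"
      by (intro continuous_integrable_tor continuous_intros cf continuous_psum)
    have "integral (cbox 0 (2 * pi)) (?g t) = (\<integral>x. ?g t x \<partial>tor)"
      unfolding set_integral_tor[symmetric] cbox_interval
      by (intro set_borel_integral_eq_integral(2)[symmetric] borel_integrable_atLeastAtMost' cg)
    also have "\<dots> = Re (\<integral>x. cnj (f (?P t x)) * ?P' t x \<partial>tor)" by (rule integral_Re[OF i])
    also have "(\<integral>x. cnj (f (?P t x)) * ?P' t x \<partial>tor) = cnj (\<integral>x. f (?P t x) * cnj (?P' t x) \<partial>tor)"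
      by (subst Bochner_Integration.integral_cnj[symmetric]) simp
    also have "\<dots> = cnj (of_real (2 * pi) * (\<Sum>k\<in>F. cnj (w' t k) * N (trunc F (w t)) k))"
      unfolding N_def psum_trunc[OF F, symmetric]
      by (subst integral_cnj_psum) (auto intro!: continuous_integrable_tor cf)
    also have "Re \<dots> = 2 * pi * Re (\<Sum>k\<in>F. cnj (N (trunc F (w t)) k) * w' t k)"
      by (simp add: cnj_sum mult_ac)
    finally show ?thesis .
  qed
  ultimately have "((\<lambda>t. \<integral>x. \<Psi> ((cmod (?P t x))\<^sup>2) \<partial>tor) has_real_derivative
      2 * pi * Re (\<Sum>k\<in>F. cnj (N (trunc F (w t)) k) * w' t k)) (at t)"
    by (simp add: has_real_derivative_iff_has_vector_derivative)
  from DERIV_cdivide[OF this, of "2 * pi"] show ?thesis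
    unfolding pot_def psum_trunc[OF F] by simp
qed

end

text \<open>The equation is imposed coefficient by coefficient, where the unbounded symbol k^2 is
  harmless; H^1 enters through local bounds.\<close>

locale nls_flow = lipschitz_nls +
  fixes w :: "real \<Rightarrow> int \<Rightarrow> complex"
  assumes flow: "\<And>t k. ((\<lambda>t. w t k) has_vector_derivative
      - \<i> * (of_int k)\<^sup>2 * w t k + \<i> * of_real \<sigma> * N (w t) k) (at t)"
    and cont: "wcont (\<lambda>_. 1) w"
    and locally_bounded: "\<And>T. \<exists>B. \<forall>t. \<bar>t\<bar> \<le> T \<longrightarrow> wl2 sob (w t) B"
begin

lemma sob_w: "\<exists>B. wl2 sob (w t) B"
  using locally_bounded[of "\<bar>t\<bar>"] by auto

lemma w_abs_summable: "(\<lambda>k. cmod (w t k)) summable_on UNIV"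
  using sob_w wl2_sob_abs_summable by blast

lemma w_sq_summable: "(\<lambda>k. (cmod (w t k))\<^sup>2) summable_on UNIV"
  using parseval_trig(1)[OF w_abs_summable] .

lemma continuous_w: "continuous_on UNIV (\<lambda>t. w t k)"
  using flow by (intro continuous_at_imp_continuous_on) (auto intro: has_vector_derivative_continuous)

lemma continuous_N_w: "continuous_on UNIV (\<lambda>t. N (w t) k)"
  by (rule continuous_N[OF cont sob_w])

lemma wcont_trunc: "wcont (\<lambda>_. 1) (\<lambda>t. trunc F (w t))"
  unfolding wcont_def
proof (intro allI impI)
  fix t e :: real assume "0 < e"
  from wcontD[OF cont this, of t]
  show "\<forall>\<^sub>F s in at t. wl2 (\<lambda>_. 1) (\<lambda>k. trunc F (w s) k - trunc F (w t) k) e"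
    by eventually_elim (erule wl2_norm_mono, auto simp: trunc_def)
qed

lemma continuous_N_trunc: "continuous_on UNIV (\<lambda>t. N (trunc F (w t)) k)"
  by (rule continuous_N[OF wcont_trunc]) (use sob_w wl2_trunc sob_nonneg in blast)

text \<open>The dispersive term contributes the real part of an imaginary number. The nonlinear term
  leads in the limit to the imaginary part of the integral of f(u) times the conjugate of u, and
  this integral is real by gauge invariance.\<close>

lemma mass_conserved: "(\<Sum>\<^sub>\<infinity>k. (cmod (w t k))\<^sup>2) = (\<Sum>\<^sub>\<infinity>k. (cmod (w 0 k))\<^sup>2)"
proof -
  obtain B where B: "\<And>\<tau>. \<bar>\<tau>\<bar> \<le> \<bar>t\<bar> \<Longrightarrow> wl2 sob (w \<tau>) B" using locally_bounded by blast
  let ?\<mu> = "\<lambda>n \<tau>. \<Sum>k\<in>{- int n..int n}. - 2 * \<sigma> * Im (N (w \<tau>) k * cnj (w \<tau> k))"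
  show ?thesis
  proof (rule constant_of_vanishing_derivatives[where \<phi> = "\<lambda>n \<tau>. \<Sum>k\<in>{- int n..int n}. (cmod (w \<tau> k))\<^sup>2" and \<mu> = ?\<mu>])
    show "((\<lambda>\<tau>. \<Sum>k\<in>{- int n..int n}. (cmod (w \<tau> k))\<^sup>2) has_real_derivative ?\<mu> n \<tau>) (at \<tau>)" for n \<tau>
    proof (rule DERIV_sum)
      fix k
      have "2 * Re (cnj (w \<tau> k) * (- \<i> * (of_int k)\<^sup>2 * w \<tau> k + \<i> * of_real \<sigma> * N (w \<tau>) k))
          = - 2 * \<sigma> * Im (N (w \<tau>) k * cnj (w \<tau> k))"
      proof -
        have "(of_int k :: complex)\<^sup>2 = of_real ((of_int k)\<^sup>2)" by simp
        then show ?thesis by (simp add: algebra_simps del: of_real_power of_real_of_int_eq)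
      qed
      with has_real_derivative_norm_sq[OF flow]
      show "((\<lambda>\<tau>. (cmod (w \<tau> k))\<^sup>2) has_real_derivative - 2 * \<sigma> * Im (N (w \<tau>) k * cnj (w \<tau> k))) (at \<tau>)"
        by metis
    qed
    show "continuous_on UNIV (?\<mu> n)" for n
      by (intro continuous_intros continuous_w continuous_N_w)
    show "\<bar>?\<mu> n \<tau>\<bar> \<le> 2 * (sqrt (L\<^sup>2 * B) * sqrt B)" if "\<bar>\<tau>\<bar> \<le> \<bar>t\<bar>" for n \<tau>
    proof -
      have "\<bar>?\<mu> n \<tau>\<bar> \<le> (\<Sum>k\<in>{- int n..int n}. \<bar>- 2 * \<sigma> * Im (N (w \<tau>) k * cnj (w \<tau> k))\<bar>)" by (rule sum_abs)
      also have "\<dots> \<le> (\<Sum>k\<in>{- int n..int n}. 2 * (1 * (cmod (N (w \<tau>) k) * cmod (w \<tau> k))))"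
      proof (rule sum_mono)
        fix k
        show "\<bar>- 2 * \<sigma> * Im (N (w \<tau>) k * cnj (w \<tau> k))\<bar> \<le> 2 * (1 * (cmod (N (w \<tau>) k) * cmod (w \<tau> k)))"
          using abs_Im_le_cmod[of "N (w \<tau>) k * cnj (w \<tau> k)"] by (simp add: abs_mult norm_mult)
      qed
      also have "\<dots> = 2 * (\<Sum>k\<in>{- int n..int n}. 1 * (cmod (N (w \<tau>) k) * cmod (w \<tau> k)))"
        by (rule sum_distrib_left[symmetric])
      also have "\<dots> \<le> 2 * (sqrt (L\<^sup>2 * B) * sqrt B)"
        by (rule mult_left_mono[OF wl2_sum_mult_le[OF wl2_sob_one[OF N_sob[OF B[OF that]]]
          wl2_sob_one[OF B[OF that]]]]) auto
      finally show ?thesis .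
    qed
    show "(\<lambda>n. ?\<mu> n \<tau>) \<longlonglongrightarrow> 0" for \<tau>
    proof -
      let ?a = "w \<tau>"
      note a = w_abs_summable[of \<tau>]
      note E = integral_cnj_trig[OF a sqint_integrable[OF sqint_f_trig[OF a]]]
      have "(\<integral>x. f (trig ?a x) * cnj (trig ?a x) \<partial>tor)
          = (\<integral>x. complex_of_real (m ((cmod (trig ?a x))\<^sup>2) * (cmod (trig ?a x))\<^sup>2) \<partial>tor)"
        by (simp only: f_def of_real_mult complex_norm_sq mult.assoc)
      also have "\<dots> = of_real (\<integral>x. m ((cmod (trig ?a x))\<^sup>2) * (cmod (trig ?a x))\<^sup>2 \<partial>tor)"
        by (rule integral_of_real_complex)
      finally have "Im (of_real (2 * pi) * (\<Sum>\<^sub>\<infinity>k. N ?a k * cnj (?a k))) = 0"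
        unfolding E(2)[folded N_def] by (simp only: Im_complex_of_real)
      then have "Im (\<Sum>\<^sub>\<infinity>k. N ?a k * cnj (?a k)) = 0" by simp
      moreover have "(\<lambda>n. \<Sum>k\<in>{- int n..int n}. N ?a k * cnj (?a k)) \<longlonglongrightarrow> (\<Sum>\<^sub>\<infinity>k. N ?a k * cnj (?a k))"
        by (rule infsum_int_LIMSEQ[OF abs_summable_summable[OF E(1)[folded N_def]]])
      ultimately have "(\<lambda>n. Im (\<Sum>k\<in>{- int n..int n}. N ?a k * cnj (?a k))) \<longlonglongrightarrow> 0"
        using tendsto_Im by fastforce
      from tendsto_mult_left[OF this, of "- 2 * \<sigma>"] show ?thesis
        by (simp add: sum_distrib_left)
    qed
    show "(\<lambda>n. \<Sum>k\<in>{- int n..int n}. (cmod (w \<tau> k))\<^sup>2) \<longlonglongrightarrow> (\<Sum>\<^sub>\<infinity>k. (cmod (w \<tau> k))\<^sup>2)" for \<tau>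
      by (rule infsum_int_LIMSEQ[OF w_sq_summable])
  qed
qed

lemma energy_conserved:
  "(\<Sum>\<^sub>\<infinity>k. (of_int k)\<^sup>2 * (cmod (w t k))\<^sup>2) / 2 - \<sigma> * pot (w t)
    = (\<Sum>\<^sub>\<infinity>k. (of_int k)\<^sup>2 * (cmod (w 0 k))\<^sup>2) / 2 - \<sigma> * pot (w 0)"
proof -
  obtain B where B: "\<And>\<tau>. \<bar>\<tau>\<bar> \<le> \<bar>t\<bar> \<Longrightarrow> wl2 sob (w \<tau>) B" using locally_bounded by blast
  let ?I = "\<lambda>n. {- int n..int n}"
  let ?M = "\<lambda>n \<tau>. N (trunc (?I n) (w \<tau>))"
  \<comment> \<open>\<open>?A\<close> is the gradient of the truncated energy and \<open>?D\<close>
    the error of truncating inside the nonlinearity. The flow is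
    \<open>- \<i> * (?A - of_real \<sigma> * ?D)\<close>, so the derivative \<open>?\<mu>\<close> is
    linear in \<open>?D\<close>.\<close>
  let ?A = "\<lambda>n \<tau> k. of_real ((of_int k)\<^sup>2) * w \<tau> k - of_real \<sigma> * ?M n \<tau> k"
  let ?D = "\<lambda>n \<tau> k. N (w \<tau>) k - ?M n \<tau> k"
  let ?\<mu> = "\<lambda>n \<tau>. \<Sum>k\<in>?I n. - \<sigma> * Im (cnj (?A n \<tau> k) * ?D n \<tau> k)"
  let ?\<phi> = "\<lambda>n \<tau>. (\<Sum>k\<in>?I n. (of_int k)\<^sup>2 * (cmod (w \<tau> k))\<^sup>2) / 2 - \<sigma> * pot (trunc (?I n) (w \<tau>))"
  have MB: "wl2 sob (?M n \<tau>) (L\<^sup>2 * C)" if "wl2 sob (w \<tau>) C" for n \<tau> C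
    by (rule N_sob[OF wl2_trunc[OF that sob_nonneg]])
  have DB: "wl2 sob (?D n \<tau>) (2 * (L\<^sup>2 * C) + 2 * (L\<^sup>2 * C))" if "wl2 sob (w \<tau>) C" for n \<tau> C
    by (rule wl2_diff[OF N_sob[OF that] MB[OF that] sob_nonneg])
  have \<mu>_le: "\<bar>?\<mu> n \<tau>\<bar> \<le> (\<Sum>k\<in>?I n. (of_int k)\<^sup>2 * (cmod (w \<tau> k) * cmod (?D n \<tau> k)))
      + (\<Sum>k\<in>?I n. 1 * (cmod (?M n \<tau> k) * cmod (?D n \<tau> k)))" for n \<tau>
  proof -
    have "\<bar>?\<mu> n \<tau>\<bar> \<le> (\<Sum>k\<in>?I n. \<bar>- \<sigma> * Im (cnj (?A n \<tau> k) * ?D n \<tau> k)\<bar>)" by (rule sum_abs)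
    also have "\<dots> \<le> (\<Sum>k\<in>?I n. (of_int k)\<^sup>2 * (cmod (w \<tau> k) * cmod (?D n \<tau> k)) + 1 * (cmod (?M n \<tau> k) * cmod (?D n \<tau> k)))"
    proof (rule sum_mono)
      fix k
      have "cmod (?A n \<tau> k) \<le> (of_int k)\<^sup>2 * cmod (w \<tau> k) + cmod (?M n \<tau> k)"
        by (rule order_trans[OF norm_triangle_ineq4]) (simp add: norm_mult norm_power)
      then have "cmod (cnj (?A n \<tau> k) * ?D n \<tau> k) \<le> ((of_int k)\<^sup>2 * cmod (w \<tau> k) + cmod (?M n \<tau> k)) * cmod (?D n \<tau> k)"
        unfolding norm_mult complex_mod_cnj by (rule mult_right_mono) simp
      moreover have "\<bar>- \<sigma> * Im (cnj (?A n \<tau> k) * ?D n \<tau> k)\<bar> \<le> cmod (cnj (?A n \<tau> k) * ?D n \<tau> k)"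
        unfolding abs_mult using abs_Im_le_cmod[of "cnj (?A n \<tau> k) * ?D n \<tau> k"] by simp
      ultimately show "\<bar>- \<sigma> * Im (cnj (?A n \<tau> k) * ?D n \<tau> k)\<bar>
          \<le> (of_int k)\<^sup>2 * (cmod (w \<tau> k) * cmod (?D n \<tau> k)) + 1 * (cmod (?M n \<tau> k) * cmod (?D n \<tau> k))"
        by (simp add: distrib_right mult.assoc)
    qed
    finally show ?thesis by (simp only: sum.distrib)
  qed
  show ?thesis
  proof (rule constant_of_vanishing_derivatives[where \<phi> = ?\<phi> and \<mu> = ?\<mu>])
    fix n \<tau>
    let ?w' = "\<lambda>\<tau> k. - \<i> * (of_int k)\<^sup>2 * w \<tau> k + \<i> * of_real \<sigma> * N (w \<tau>) k"
    have d1: "((\<lambda>\<tau>. \<Sum>k\<in>?I n. (of_int k)\<^sup>2 * (cmod (w \<tau> k))\<^sup>2) has_real_derivative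
        (\<Sum>k\<in>?I n. (of_int k)\<^sup>2 * (2 * Re (cnj (w \<tau> k) * ?w' \<tau> k)))) (at \<tau>)"
      by (intro DERIV_sum DERIV_cmult has_real_derivative_norm_sq flow)
    have d2: "((\<lambda>\<tau>. pot (trunc (?I n) (w \<tau>))) has_real_derivative
        Re (\<Sum>k\<in>?I n. cnj (?M n \<tau> k) * ?w' \<tau> k)) (at \<tau>)"
      by (rule pot_derivative[OF _ flow]) (auto intro!: continuous_intros continuous_w continuous_N_w)
    have "(?\<phi> n has_real_derivative ((\<Sum>k\<in>?I n. (of_int k)\<^sup>2 * (2 * Re (cnj (w \<tau> k) * ?w' \<tau> k))) / 2
        - \<sigma> * Re (\<Sum>k\<in>?I n. cnj (?M n \<tau> k) * ?w' \<tau> k))) (at \<tau>)"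
      by (intro DERIV_diff DERIV_cdivide DERIV_cmult d1 d2)
    also have "(\<Sum>k\<in>?I n. (of_int k)\<^sup>2 * (2 * Re (cnj (w \<tau> k) * ?w' \<tau> k))) / 2
        - \<sigma> * Re (\<Sum>k\<in>?I n. cnj (?M n \<tau> k) * ?w' \<tau> k) = (\<Sum>k\<in>?I n. Re (cnj (?A n \<tau> k) * ?w' \<tau> k))"
    proof -
      have "Re (cnj (?A n \<tau> k) * z) = (of_int k)\<^sup>2 * (2 * Re (cnj (w \<tau> k) * z)) / 2 - \<sigma> * Re (cnj (?M n \<tau> k) * z)" for k z
        by (simp add: algebra_simps)
      then show ?thesis by (simp only: Re_sum sum_divide_distrib sum_distrib_left sum_subtractf)
    qed
    also have "\<dots> = ?\<mu> n \<tau>"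
    proof (rule sum.cong[OF refl])
      fix k
      have "?w' \<tau> k = - \<i> * (?A n \<tau> k - of_real \<sigma> * ?D n \<tau> k)"
        by (simp add: algebra_simps)
      moreover have "Re (cnj A * (- \<i> * (A - of_real \<sigma> * D))) = - \<sigma> * Im (cnj A * D)" for A D
        by (simp add: algebra_simps)
      ultimately show "Re (cnj (?A n \<tau> k) * ?w' \<tau> k) = - \<sigma> * Im (cnj (?A n \<tau> k) * ?D n \<tau> k)" by presburger
    qed
    finally show "(?\<phi> n has_real_derivative ?\<mu> n \<tau>) (at \<tau>)" .
  next
    show "continuous_on UNIV (?\<mu> n)" for n
      by (intro continuous_intros continuous_w continuous_N_w continuous_N_trunc)
    let ?C = "2 * (L\<^sup>2 * B) + 2 * (L\<^sup>2 * B)"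
    show "\<bar>?\<mu> n \<tau>\<bar> \<le> sqrt B * sqrt ?C + sqrt (L\<^sup>2 * B) * sqrt ?C" if "\<bar>\<tau>\<bar> \<le> \<bar>t\<bar>" for n \<tau>
    proof (rule order_trans[OF \<mu>_le add_mono])
      show "(\<Sum>k\<in>?I n. (of_int k)\<^sup>2 * (cmod (w \<tau> k) * cmod (?D n \<tau> k))) \<le> sqrt B * sqrt ?C"
        by (rule wl2_sum_mult_le[OF B[OF that] DB[OF B[OF that]] sob_nonneg sob_nonneg])
           (simp_all only: finite_atLeastAtMost_int sq_le_sob)
      show "(\<Sum>k\<in>?I n. 1 * (cmod (?M n \<tau> k) * cmod (?D n \<tau> k))) \<le> sqrt (L\<^sup>2 * B) * sqrt ?C"
        by (rule wl2_sum_mult_le[OF wl2_sob_one[OF MB[OF B[OF that]]] wl2_sob_one[OF DB[OF B[OF that]]]]) auto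
    qed
    show "(\<lambda>n. ?\<mu> n \<tau>) \<longlonglongrightarrow> 0" for \<tau>
    proof -
      obtain C where C: "wl2 sob (w \<tau>) C" using sob_w by blast
      let ?\<delta> = "\<lambda>n. L\<^sup>2 * ((\<Sum>\<^sub>\<infinity>k. (cmod (w \<tau> k))\<^sup>2) - (\<Sum>k\<in>?I n. (cmod (w \<tau> k))\<^sup>2))"
      have \<delta>: "?\<delta> \<longlonglongrightarrow> 0"
      proof -
        have "?\<delta> \<longlonglongrightarrow> L\<^sup>2 * ((\<Sum>\<^sub>\<infinity>k. (cmod (w \<tau> k))\<^sup>2) - (\<Sum>\<^sub>\<infinity>k. (cmod (w \<tau> k))\<^sup>2))"
          by (intro tendsto_intros infsum_int_LIMSEQ w_sq_summable)
        then show ?thesis by simp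
      qed
      have D1: "wl2 (\<lambda>_. 1) (?D n \<tau>) (?\<delta> n)" for n
        by (rule N_lipschitz[OF w_abs_summable _ wl2_diff_trunc[OF w_sq_summable]])
           (use wl2_sob_abs_summable[OF wl2_trunc[OF C sob_nonneg]] in auto)
      \<comment> \<open>This is the part of \<open>?A\<close> with k^2 w_k, beyond the reach of l^2
        convergence of \<open>?D\<close>; the \<open>sob\<close> bounds on both factors reduce it to
        finitely many frequencies.\<close>
      have l1: "(\<lambda>n. \<Sum>k\<in>?I n. (of_int k)\<^sup>2 * (cmod (w \<tau> k) * cmod (?D n \<tau> k))) \<longlonglongrightarrow> 0"
        by (rule weighted_pairing_tendsto_0[where w = "w \<tau>" and D = "\<lambda>n k. ?D n \<tau> k" and \<epsilon> = ?\<delta> and F = ?I,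
              OF C DB[OF C] D1 \<delta>]) simp
      have "(\<lambda>n. sqrt (L\<^sup>2 * C) * sqrt (?\<delta> n)) \<longlonglongrightarrow> sqrt (L\<^sup>2 * C) * sqrt 0" by (intro tendsto_intros \<delta>)
      then have l2: "(\<lambda>n. sqrt (L\<^sup>2 * C) * sqrt (?\<delta> n)) \<longlonglongrightarrow> 0" by simp
      have le: "norm (?\<mu> n \<tau>) \<le> (\<Sum>k\<in>?I n. (of_int k)\<^sup>2 * (cmod (w \<tau> k) * cmod (?D n \<tau> k))) + sqrt (L\<^sup>2 * C) * sqrt (?\<delta> n)" for n
        unfolding real_norm_def
      proof (rule order_trans[OF \<mu>_le add_left_mono])
        show "(\<Sum>k\<in>?I n. 1 * (cmod (?M n \<tau> k) * cmod (?D n \<tau> k))) \<le> sqrt (L\<^sup>2 * C) * sqrt (?\<delta> n)"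
          by (rule wl2_sum_mult_le[OF wl2_sob_one[OF MB[OF C]] D1]) auto
      qed
      show ?thesis
        by (rule Lim_null_comparison[OF always_eventually[OF allI[OF le]] tendsto_add_zero[OF l1 l2]])
    qed
    show "(\<lambda>n. ?\<phi> n \<tau>) \<longlonglongrightarrow> (\<Sum>\<^sub>\<infinity>k. (of_int k)\<^sup>2 * (cmod (w \<tau> k))\<^sup>2) / 2 - \<sigma> * pot (w \<tau>)" for \<tau>
    proof -
      obtain C where C: "wl2 sob (w \<tau>) C" using sob_w by blast
      have "(\<lambda>k. (of_int k)\<^sup>2 * (cmod (w \<tau> k))\<^sup>2) summable_on UNIV"
        using wl2_summable[OF wl2_deriv[OF C]] by (simp add: norm_mult power_mult_distrib)
      then show ?thesis
        by (intro tendsto_intros infsum_int_LIMSEQ pot_psum_LIMSEQ w_abs_summable) auto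
    qed
  qed
qed

end

subsection \<open>The truncated power nonlinearity\<close>

text \<open>The case distinction is needed for continuity at \<open>0\<close>, where \<open>0 powr 0 = 0\<close>.\<close>

definition trunc_m :: "real \<Rightarrow> real \<Rightarrow> real \<Rightarrow> real" where
  "trunc_m p R q = (if p = 0 then 1 else min (sqrt \<bar>q\<bar>) R powr p)"

text \<open>The potential has to be differentiable on the whole line, so \<open>trunc_m\<close> is
  extended evenly through \<open>sqrt \<bar>q\<bar>\<close>. Taking the real part allows the complex
  valued \<open>antider\<close> to be reused.\<close>

definition trunc_\<Psi> :: "real \<Rightarrow> real \<Rightarrow> real \<Rightarrow> real" where
  "trunc_\<Psi> p R q = Re (antider (\<lambda>q. of_real (trunc_m p R q / 2)) q)"

lemma powr_le_one_add:
  fixes x p :: real assumes "0 \<le> x" and "0 \<le> p" and "p \<le> 1"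
  shows "x powr p \<le> 1 + x"
proof (cases "x \<le> 1")
  case True
  then have "x powr p \<le> 1" using assms by (intro powr_le1) auto
  then show ?thesis using assms(1) by simp
next
  case False
  then show ?thesis using powr_mono[OF assms(3), of x] by simp
qed

text \<open>For exponents at most 1, q^p is at most r^p (q / r) when 0 < r <= q: multiplying by the
  smaller modulus \<open>r\<close> compensates the steepness of the power at 0, and the cutoff
  leaves the factor \<open>R powr p\<close>.\<close>

lemma powr_increment_le:
  fixes q r p R :: real
  assumes p: "0 \<le> p" "p \<le> 1" and r: "0 \<le> r" "r \<le> q" and R: "0 < R"
  shows "(min q R powr p - min r R powr p) * r \<le> R powr p * (q - r)"
proof (cases "r = 0 \<or> R \<le> r")
  case True
  have "0 \<le> R powr p * (q - r)" using r by simp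
  then show ?thesis using True r by auto
next
  case False
  then have r0: "0 < r" "r < R" using r by auto
  let ?q = "min q R"
  have rq: "r \<le> ?q" using r r0 by simp
  have "?q powr p = r powr p * (?q / r) powr p"
    using r0 rq by (simp add: powr_mult[symmetric] R less_imp_le)
  also have "(?q / r) powr p \<le> (?q / r) powr 1"
    by (rule powr_mono) (use p r0 rq in auto)
  finally have "?q powr p \<le> r powr p * (?q / r)" using r0 rq by (simp add: mult_left_mono)
  then have "?q powr p * r \<le> r powr p * ?q" using r0 by (simp add: field_simps)
  then have "(?q powr p - r powr p) * r \<le> r powr p * (?q - r)" by (simp add: algebra_simps)
  also have "\<dots> \<le> R powr p * (q - r)"
    using r0 r p rq by (intro mult_mono powr_mono2) auto
  finally show ?thesis using r0 by simp
qed

lemma continuous_trunc_m: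
  assumes "0 \<le> p" and "0 < R"
  shows "continuous_on S (trunc_m p R)"
proof (cases "p = 0")
  case False
  then have eq: "trunc_m p R = (\<lambda>q. min (sqrt \<bar>q\<bar>) R powr p)" by (simp add: trunc_m_def fun_eq_iff)
  show ?thesis
    unfolding eq using assms False by (intro continuous_on_powr' continuous_intros) auto
qed (simp add: trunc_m_def[abs_def])

lemma trunc_m_nonneg: "0 \<le> trunc_m p R q"
  by (simp add: trunc_m_def)

lemma trunc_m_le: "0 \<le> p \<Longrightarrow> 1 \<le> R \<Longrightarrow> trunc_m p R q \<le> R powr p"
  by (auto simp: trunc_m_def intro!: powr_mono2)

text \<open>The bound is free of \<open>R\<close> and linear in the modulus; this is where the
  restriction \<alpha> \<le> 2, that is \<open>p \<le> 1\<close>, enters the a priori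
  estimate.\<close>

lemma trunc_m_le_one_add:
  assumes "0 \<le> p" and "p \<le> 1" and "0 < R" and "0 \<le> q"
  shows "trunc_m p R q \<le> 1 + sqrt q"
proof -
  have "min (sqrt q) R powr p \<le> 1 + min (sqrt q) R"
    by (rule powr_le_one_add) (use assms in auto)
  then show ?thesis using assms by (auto simp: trunc_m_def)
qed

lemma trunc_m_sq: "trunc_m p R ((cmod z)\<^sup>2) = (if p = 0 then 1 else min (cmod z) R powr p)"
  by (simp add: trunc_m_def)

text \<open>With \<open>cmod w \<le> cmod z\<close> write the difference as a (z - w) + (a - b) w,
  where a and b are the two multipliers; each summand contributes \<open>R powr p\<close>.\<close>

lemma trunc_lipschitz:
  assumes p: "0 \<le> p" "p \<le> 1" and R: "1 \<le> R"
  shows "cmod (of_real (trunc_m p R ((cmod z)\<^sup>2)) * z - of_real (trunc_m p R ((cmod w)\<^sup>2)) * w)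
    \<le> 2 * R powr p * cmod (z - w)"
proof -
  have *: "cmod (of_real (trunc_m p R ((cmod z)\<^sup>2)) * z - of_real (trunc_m p R ((cmod w)\<^sup>2)) * w)
    \<le> 2 * R powr p * cmod (z - w)" if le: "cmod w \<le> cmod z" for z w
  proof -
    let ?a = "trunc_m p R ((cmod z)\<^sup>2)" and ?b = "trunc_m p R ((cmod w)\<^sup>2)"
    have ba: "?b \<le> ?a" unfolding trunc_m_sq using p R le by (auto intro!: powr_mono2 simp: min_le_iff_disj)
    have "of_real ?a * z - of_real ?b * w = of_real ?a * (z - w) + of_real (?a - ?b) * w"
      by (simp add: algebra_simps)
    also have "cmod \<dots> \<le> ?a * cmod (z - w) + (?a - ?b) * cmod w"
      by (rule order_trans[OF norm_triangle_ineq])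
         (use ba trunc_m_nonneg in \<open>simp add: norm_mult del: of_real_diff\<close>)
    also have "?a * cmod (z - w) \<le> R powr p * cmod (z - w)"
      by (intro mult_right_mono trunc_m_le) (use p R in auto)
    also have "(?a - ?b) * cmod w \<le> R powr p * (cmod z - cmod w)"
    proof (cases "p = 0")
      case True
      then show ?thesis using le R by (simp add: trunc_m_sq)
    next
      case False
      then show ?thesis unfolding trunc_m_sq
        using powr_increment_le[OF p norm_ge_zero le, of R] R by simp
    qed
    also have "\<dots> \<le> R powr p * cmod (z - w)"
      by (intro mult_left_mono norm_triangle_ineq2) simp
    finally show ?thesis by simp
  qed
  show ?thesis
  proof (cases "cmod w \<le> cmod z")
    case False
    then show ?thesis using *[of z w] by (simp add: norm_minus_commute)
  qed (rule *)
qed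

lemma trunc_\<Psi>_deriv:
  assumes "0 \<le> p" and "0 < R"
  shows "(trunc_\<Psi> p R has_real_derivative trunc_m p R q / 2) (at q)"
proof -
  have c: "continuous_on UNIV (\<lambda>q. complex_of_real (trunc_m p R q / 2))"
    by (intro continuous_intros continuous_trunc_m assms) auto
  from bounded_linear.has_vector_derivative[OF bounded_linear_Re antider_has_vector_derivative[OF c]]
  show ?thesis by (simp add: trunc_\<Psi>_def[abs_def] has_real_derivative_iff_has_vector_derivative)
qed

lemma trunc_\<Psi>_0: "trunc_\<Psi> p R 0 = 0"
  by (simp add: trunc_\<Psi>_def)

text \<open>The mean value theorem together with the bound on \<open>trunc_m\<close>: at most cubic
  growth in the modulus, uniformly in \<open>R\<close>.\<close>

lemma trunc_\<Psi>_bounds: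
  assumes p: "0 \<le> p" "p \<le> 1" and R: "0 < R" and q: "0 \<le> q"
  shows "0 \<le> trunc_\<Psi> p R q" and "trunc_\<Psi> p R q \<le> q / 2 * (1 + sqrt q)"
proof -
  have "0 \<le> trunc_\<Psi> p R q \<and> trunc_\<Psi> p R q \<le> q / 2 * (1 + sqrt q)"
  proof (cases "q = 0")
    case False
    then have "0 < q" using q by simp
    from MVT2[OF this trunc_\<Psi>_deriv[OF p(1) R]]
    obtain s where s: "0 < s" "s < q" "trunc_\<Psi> p R q - trunc_\<Psi> p R 0 = (q - 0) * (trunc_m p R s / 2)" by blast
    have "trunc_m p R s \<le> 1 + sqrt s" by (rule trunc_m_le_one_add) (use p R s in auto)
    also have "\<dots> \<le> 1 + sqrt q" using s by simp
    finally have "q / 2 * trunc_m p R s \<le> q / 2 * (1 + sqrt q)" using q by (intro mult_left_mono) auto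
    moreover have "trunc_\<Psi> p R q = q / 2 * trunc_m p R s" using s by (simp add: trunc_\<Psi>_0)
    moreover have "0 \<le> q / 2 * trunc_m p R s" using q trunc_m_nonneg by (intro mult_nonneg_nonneg) auto
    ultimately show ?thesis by simp
  qed (simp add: trunc_\<Psi>_0)
  then show "0 \<le> trunc_\<Psi> p R q" and "trunc_\<Psi> p R q \<le> q / 2 * (1 + sqrt q)" by auto
qed

text \<open>Both sides vanish at 0 and have the derivative x^(p/2) / 2 in the squared modulus.
  Derivatives are compared only on the open interval below the squared modulus of \<open>z\<close>,
  where \<open>powr\<close> is smooth and the truncation inactive.\<close>

lemma trunc_\<Psi>_eq:
  assumes p: "0 \<le> p" and R: "0 < R" and z: "cmod z \<le> R"
  shows "trunc_\<Psi> p R ((cmod z)\<^sup>2) = cmod z powr (p + 2) / (p + 2)"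
proof (cases "z = 0")
  case False
  let ?h = "\<lambda>q. q powr ((p + 2) / 2) / (p + 2) - trunc_\<Psi> p R q"
  have q: "0 < (cmod z)\<^sup>2" using False by simp
  have "?h ((cmod z)\<^sup>2) = ?h 0"
  proof (rule DERIV_isconst_end[OF q])
    show "continuous_on {0..(cmod z)\<^sup>2} ?h"
      using p trunc_\<Psi>_deriv[OF p R]
      by (intro continuous_intros continuous_on_powr' DERIV_continuous_on) (auto intro: has_field_derivative_at_within)
    fix x assume x: "0 < x" "x < (cmod z)\<^sup>2"
    have "sqrt x \<le> cmod z" by (rule real_le_lsqrt) (use x in auto)
    then have sx: "sqrt x \<le> R" using z by simp
    have mx: "trunc_m p R x = x powr (p / 2)"
      using x sx by (auto simp: trunc_m_def min_absorb1 powr_half_sqrt[symmetric] powr_powr)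
    have "((\<lambda>q. q powr ((p + 2) / 2)) has_real_derivative (p + 2) / 2 * x powr ((p + 2) / 2 - 1)) (at x)"
      using x by (intro has_real_derivative_powr)
    moreover have "(p + 2) / 2 - 1 = p / 2" by (simp add: field_simps)
    ultimately have "((\<lambda>q. q powr ((p + 2) / 2)) has_real_derivative (p + 2) / 2 * x powr (p / 2)) (at x)" by simp
    note d = DERIV_diff[OF DERIV_cdivide[OF this, of "p + 2"] trunc_\<Psi>_deriv[OF p R, of x]]
    have "(p + 2) / 2 * x powr (p / 2) / (p + 2) - trunc_m p R x / 2 = 0"
      using p by (simp add: mx field_simps)
    from d[unfolded this] show "(?h has_real_derivative 0) (at x)" .
  qed
  then have "trunc_\<Psi> p R ((cmod z)\<^sup>2) = ((cmod z)\<^sup>2) powr ((p + 2) / 2) / (p + 2)"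
    by (simp add: trunc_\<Psi>_0)
  also have "((cmod z)\<^sup>2) powr ((p + 2) / 2) = cmod z powr (p + 2)"
  proof -
    have "(cmod z)\<^sup>2 = cmod z powr 2" using False by simp
    moreover have "2 * ((p + 2) / 2) = p + 2" by (simp add: field_simps)
    ultimately show ?thesis by (simp only: powr_powr)
  qed
  finally show ?thesis .
qed (simp add: trunc_\<Psi>_0)

section \<open>The truncated equation and its a priori bound\<close>

locale truncated_nls =
  fixes \<alpha> \<sigma> R :: real
  assumes \<alpha>: "1 \<le> \<alpha>" "\<alpha> \<le> 2" and sign: "\<sigma> = 1 \<or> \<sigma> = -1" and R: "1 \<le> R"
begin

sublocale lipschitz_nls "trunc_m (\<alpha> - 1) R" "trunc_\<Psi> (\<alpha> - 1) R" "2 * R powr (\<alpha> - 1)" \<sigma>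
proof
  show "continuous_on UNIV (trunc_m (\<alpha> - 1) R)" by (rule continuous_trunc_m) (use \<alpha> R in auto)
  show "(trunc_\<Psi> (\<alpha> - 1) R has_real_derivative trunc_m (\<alpha> - 1) R q / 2) (at q)" for q
    by (rule trunc_\<Psi>_deriv) (use \<alpha> R in auto)
  show "cmod (of_real (trunc_m (\<alpha> - 1) R ((cmod z)\<^sup>2)) * z - of_real (trunc_m (\<alpha> - 1) R ((cmod w)\<^sup>2)) * w)
      \<le> 2 * R powr (\<alpha> - 1) * cmod (z - w)" for z w
    by (rule trunc_lipschitz) (use \<alpha> R in auto)
qed (use sign in \<open>auto simp: trunc_\<Psi>_0\<close>)

lemma f_eq_nonlinearity: "cmod z \<le> R \<Longrightarrow> f z = nonlinearity \<alpha> z"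
  unfolding f_def nonlinearity_def trunc_m_sq by (cases "z = 0") (auto simp: min_absorb1)

lemma \<Psi>_eq: "cmod z \<le> R \<Longrightarrow> trunc_\<Psi> (\<alpha> - 1) R ((cmod z)\<^sup>2) = 1 / (\<alpha> + 1) * cmod z powr (\<alpha> + 1)"
  using trunc_\<Psi>_eq[of "\<alpha> - 1" R z] \<alpha> R by (simp add: add.commute)

text \<open>Of the at most three powers of the modulus, one is absorbed by the l^1 norm of the
  coefficients and two by the mass, which is conserved.\<close>

lemma pot_bounds:
  assumes c: "(\<lambda>k. cmod (c k)) summable_on UNIV"
  shows "0 \<le> pot c" and "pot c \<le> (1 + (\<Sum>\<^sub>\<infinity>k. cmod (c k))) / 2 * (\<Sum>\<^sub>\<infinity>k. (cmod (c k))\<^sup>2)"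
proof -
  note b = trunc_\<Psi>_bounds[of "\<alpha> - 1" R]
  have p: "0 \<le> \<alpha> - 1" "\<alpha> - 1 \<le> 1" "0 < R" using \<alpha> R by auto
  show "0 \<le> pot c"
    unfolding pot_def using b(1)[OF p] by (intro divide_nonneg_nonneg integral_nonneg_AE AE_I2) auto
  let ?S = "\<Sum>\<^sub>\<infinity>k. cmod (c k)"
  have i: "integrable tor (\<lambda>x. trunc_\<Psi> (\<alpha> - 1) R ((cmod (trig c x))\<^sup>2))"
    by (intro continuous_integrable_tor continuous_\<Psi>_norm continuous_trig c)
  have "(\<integral>x. trunc_\<Psi> (\<alpha> - 1) R ((cmod (trig c x))\<^sup>2) \<partial>tor) \<le> (\<integral>x. (1 + ?S) / 2 * (cmod (trig c x))\<^sup>2 \<partial>tor)"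
  proof (rule integral_mono[OF i])
    show "integrable tor (\<lambda>x. (1 + ?S) / 2 * (cmod (trig c x))\<^sup>2)"
      using sqint_integrable_sq[OF sqint_trig[OF c]] by simp
    fix x
    have "trunc_\<Psi> (\<alpha> - 1) R ((cmod (trig c x))\<^sup>2) \<le> (cmod (trig c x))\<^sup>2 / 2 * (1 + sqrt ((cmod (trig c x))\<^sup>2))"
      by (rule b(2)[OF p]) simp
    also have "\<dots> \<le> (cmod (trig c x))\<^sup>2 / 2 * (1 + ?S)"
      by (intro mult_left_mono add_left_mono) (use norm_trig_le[OF c] in auto)
    finally show "trunc_\<Psi> (\<alpha> - 1) R ((cmod (trig c x))\<^sup>2) \<le> (1 + ?S) / 2 * (cmod (trig c x))\<^sup>2"
      by (simp add: mult_ac)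
  qed
  also have "\<dots> = (1 + ?S) / 2 * (2 * pi * (\<Sum>\<^sub>\<infinity>k. (cmod (c k))\<^sup>2))" by (simp add: parseval_trig(2)[OF c])
  finally have "(\<integral>x. trunc_\<Psi> (\<alpha> - 1) R ((cmod (trig c x))\<^sup>2) \<partial>tor) \<le> (1 + ?S) / 2 * (2 * pi * (\<Sum>\<^sub>\<infinity>k. (cmod (c k))\<^sup>2))" .
  then show "pot c \<le> (1 + ?S) / 2 * (\<Sum>\<^sub>\<infinity>k. (cmod (c k))\<^sup>2)"
    unfolding pot_def by (simp add: pos_divide_le_eq mult_ac)
qed

lemma energy_eq_pot:
  assumes h: "h \<in> H1_torus" and b: "\<And>x. cmod (trig (fourier_coeff h) x) \<le> R"
  shows "energy \<alpha> \<sigma> h = 2 * pi * ((\<Sum>\<^sub>\<infinity>k. (of_int k)\<^sup>2 * (cmod (fourier_coeff h k))\<^sup>2) / 2 - \<sigma> * pot (fourier_coeff h))"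
proof -
  let ?T = "trig (fourier_coeff h)"
  obtain B where B: "wl2 sob (fourier_coeff h) B" using h by (auto simp: H1_torus_iff)
  have s: "(\<lambda>k. cmod (fourier_coeff h k)) summable_on UNIV" by (rule wl2_sob_abs_summable[OF B])
  have ae: "AE x in tor. h x = ?T x" by (rule H1_torus_AE_trig[OF h])
  have i: "integrable tor (\<lambda>x. trunc_\<Psi> (\<alpha> - 1) R ((cmod (?T x))\<^sup>2))"
    by (intro continuous_integrable_tor continuous_\<Psi>_norm continuous_trig s)
  note w = weak_deriv_norm[OF h]
  have hm: "h \<in> borel_measurable tor" using h by (auto simp: H1_torus_def L2_torus_sqint intro: sqint_measurable)
  have "energy \<alpha> \<sigma> h = (\<integral>x. 1 / 2 * (cmod (weak_deriv h x))\<^sup>2 - \<sigma> * (1 / (\<alpha> + 1)) * cmod (h x) powr (\<alpha> + 1) \<partial>tor)"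
    by (simp add: energy_def set_integral_tor)
  also have "\<dots> = (\<integral>x. 1 / 2 * (cmod (weak_deriv h x))\<^sup>2 - \<sigma> * trunc_\<Psi> (\<alpha> - 1) R ((cmod (?T x))\<^sup>2) \<partial>tor)"
  proof (rule integral_cong_AE)
    show "AE x in tor. 1 / 2 * (cmod (weak_deriv h x))\<^sup>2 - \<sigma> * (1 / (\<alpha> + 1)) * cmod (h x) powr (\<alpha> + 1)
        = 1 / 2 * (cmod (weak_deriv h x))\<^sup>2 - \<sigma> * trunc_\<Psi> (\<alpha> - 1) R ((cmod (?T x))\<^sup>2)"
      using ae
    proof eventually_elim
      case (elim x)
      show ?case unfolding elim \<Psi>_eq[OF b] by simp
    qed
    show "(\<lambda>x. 1 / 2 * (cmod (weak_deriv h x))\<^sup>2 - \<sigma> * (1 / (\<alpha> + 1)) * cmod (h x) powr (\<alpha> + 1)) \<in> borel_measurable tor"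
      using borel_measurable_integrable[OF w(1)] hm by measurable
    show "(\<lambda>x. 1 / 2 * (cmod (weak_deriv h x))\<^sup>2 - \<sigma> * trunc_\<Psi> (\<alpha> - 1) R ((cmod (?T x))\<^sup>2)) \<in> borel_measurable tor"
      using borel_measurable_integrable[OF w(1)] borel_measurable_integrable[OF i] by measurable
  qed
  also have "\<dots> = 1 / 2 * (\<integral>x. (cmod (weak_deriv h x))\<^sup>2 \<partial>tor) - \<sigma> * (\<integral>x. trunc_\<Psi> (\<alpha> - 1) R ((cmod (?T x))\<^sup>2) \<partial>tor)"
    using w(1) i by simp
  also have "\<dots> = 2 * pi * ((\<Sum>\<^sub>\<infinity>k. (of_int k)\<^sup>2 * (cmod (fourier_coeff h k))\<^sup>2) / 2 - \<sigma> * pot (fourier_coeff h))"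
    by (simp add: w(2) pot_def algebra_simps)
  finally show ?thesis .
qed

text \<open>Since the growth of the potential is at most cubic, the kinetic energy exceeds the initial
  one by at most a multiple of its own square root. The resulting bound does not involve \<open>R\<close>.\<close>

lemma sup_bound:
  assumes flow: "nls_flow (trunc_m (\<alpha> - 1) R) (trunc_\<Psi> (\<alpha> - 1) R) (2 * R powr (\<alpha> - 1)) \<sigma> w"
    and Y: "Y = (\<Sum>\<^sub>\<infinity>k. sob k * (cmod (w 0 k))\<^sup>2)"
  shows "(\<Sum>\<^sub>\<infinity>k. cmod (w t k)) \<le> sqrt 7 * (sqrt 7 * Y + (3 * Y + Y * sqrt 7 * sqrt Y) + 1)"
proof -
  interpret nls_flow "trunc_m (\<alpha> - 1) R" "trunc_\<Psi> (\<alpha> - 1) R" "2 * R powr (\<alpha> - 1)" \<sigma> w by (rule flow)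
  define M where "M = (\<Sum>\<^sub>\<infinity>k. (cmod (w 0 k))\<^sup>2)"
  define K where "K t = (\<Sum>\<^sub>\<infinity>k. (of_int k)\<^sup>2 * (cmod (w t k))\<^sup>2)" for t
  define S where "S t = (\<Sum>\<^sub>\<infinity>k. cmod (w t k))" for t
  have M0: "0 \<le> M" unfolding M_def by (rule infsum_nonneg) simp
  have K0: "0 \<le> K t" for t unfolding K_def by (rule infsum_nonneg) simp
  have S0: "0 \<le> S t" for t unfolding S_def by (rule infsum_nonneg) simp
  have mass: "(\<Sum>\<^sub>\<infinity>k. (cmod (w t k))\<^sup>2) = M" for t unfolding M_def by (rule mass_conserved)
  have sobsum: "(\<Sum>\<^sub>\<infinity>k. sob k * (cmod (w t k))\<^sup>2) = M + K t"
    and sobb: "wl2 sob (w t) (M + K t)" for t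
  proof -
    obtain C where C: "wl2 sob (w t) C" using sob_w by blast
    have s: "(\<lambda>k. (of_int k)\<^sup>2 * (cmod (w t k))\<^sup>2) summable_on UNIV"
      using wl2_summable[OF wl2_deriv[OF C]] by (simp add: norm_mult power_mult_distrib)
    show eq: "(\<Sum>\<^sub>\<infinity>k. sob k * (cmod (w t k))\<^sup>2) = M + K t"
      unfolding mass[of t, symmetric] K_def
      by (simp add: infsum_add[OF w_sq_summable s, symmetric] sob_def distrib_right)
    show "wl2 sob (w t) (M + K t)"
      using wl2_infsum[OF wl2_summable[OF C sob_nonneg] sob_nonneg] by (simp add: eq)
  qed
  have Sle: "S t \<le> sqrt 7 * sqrt (M + K t)" for t
    using wl2_sob_infsum_norm_le[OF sobb[of t]] unfolding S_def real_sqrt_mult .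
  have pot: "0 \<le> pot (w t)" "pot (w t) \<le> (1 + S t) / 2 * M" for t
    using pot_bounds[OF w_abs_summable[of t]] by (simp_all add: S_def mass)
  have "K t / 2 - \<sigma> * pot (w t) = K 0 / 2 - \<sigma> * pot (w 0)"
    using energy_conserved[of t] by (simp add: K_def)
  \<comment> \<open>Nonnegativity of \<open>pot\<close> covers both signs of \<open>\<sigma>\<close>
    with one inequality.\<close>
  then have "K t \<le> K 0 + 2 * pot (w t) + 2 * pot (w 0)"
    using sign pot(1)[of t] pot(1)[of 0] by auto
  also have "\<dots> \<le> K 0 + (1 + S t) * M + (1 + S 0) * M" using pot(2)[of t] pot(2)[of 0] by simp
  finally have K1: "K t \<le> K 0 + (1 + S t) * M + (1 + S 0) * M" .
  define x where "x = sqrt (M + K t)"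
  have Y': "Y = M + K 0" using sobsum[of 0] Y by simp
  have MY: "M \<le> Y" using K0[of 0] by (simp add: Y')
  have Y0: "0 \<le> Y" using M0 MY by simp
  have x0: "0 \<le> x" using M0 K0 by (simp add: x_def)
  have "x\<^sup>2 = M + K t" using M0 K0[of t] by (simp add: x_def)
  also have "\<dots> \<le> Y + 2 * M + S 0 * M + S t * M" using K1 by (simp add: Y' algebra_simps)
  also have "\<dots> \<le> Y + 2 * Y + (sqrt 7 * sqrt Y) * Y + (sqrt 7 * x) * Y"
    using Sle[of t] Sle[of 0] MY M0 Y0 x0 S0[of 0] S0[of t]
    by (intro add_mono mult_mono) (auto simp: x_def Y')
  finally have q: "x\<^sup>2 \<le> (3 * Y + Y * sqrt 7 * sqrt Y) + (sqrt 7 * Y) * x" by (simp add: mult_ac)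
  let ?D = "3 * Y + Y * sqrt 7 * sqrt Y" and ?c = "sqrt 7 * Y"
  have D0: "0 \<le> ?D" and c0: "0 \<le> ?c" using Y0 by auto
  \<comment> \<open>A crude bound for the larger root of the quadratic: beyond it \<open>x\<close>
    exceeds 1, so \<open>?c * x + ?D\<close> stays below \<open>x * x\<close>.\<close>
  have "x \<le> ?c + ?D + 1"
  proof (rule ccontr)
    assume "\<not> x \<le> ?c + ?D + 1"
    then have x: "?c + ?D + 1 < x" by simp
    have x1: "1 < x" using x D0 c0 by linarith
    have "?c * x + ?D * 1 \<le> ?c * x + ?D * x" using x1 D0 by (intro add_left_mono mult_left_mono) auto
    also have "\<dots> < ?c * x + ?D * x + 1 * x" using x1 by simp
    also have "\<dots> = (?c + ?D + 1) * x" by (simp add: distrib_right)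
    also have "\<dots> < x * x" using x x1 by (intro mult_strict_right_mono) auto
    finally show False using q by (simp add: power2_eq_square)
  qed
  then show ?thesis using Sle[of t] unfolding S_def x_def[symmetric]
    by (meson mult_left_mono order_trans real_sqrt_ge_zero zero_le_numeral)
qed

end

subsection \<open>Duhamel's formula\<close>

text \<open>The oriented interval integral as a signed integral over one measure space, so that both
  directions of time are treated together.\<close>

lemma oriented_integral:
  fixes g :: "real \<Rightarrow> complex"
  shows "(LBINT \<tau>=ereal 0..ereal t. g \<tau>)
    = of_real (if 0 \<le> t then 1 else -1) * (\<integral>\<tau>. g \<tau> \<partial>restrict_space lborel {min 0 t<..<max 0 t})"
  unfolding interval_lebesgue_integral_def set_lebesgue_integral_def
  by (subst integral_restrict_space) (auto simp: zero_ereal_def min_def max_def einterval_eq_Icc)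

lemma antider_cmult: "antider (\<lambda>\<tau>. c * g \<tau>) t = c * antider g t"
  unfolding antider_def oriented_integral by simp

text \<open>The uniform H^1 bound gives a constant majorant for all partial sums on the time
  segment, so the pointwise time integral can be taken coefficientwise.\<close>

lemma antider_trig:
  fixes n :: "real \<Rightarrow> int \<Rightarrow> complex"
  assumes c: "\<And>k. continuous_on UNIV (\<lambda>\<tau>. n \<tau> k)" and b: "\<And>\<tau>. \<bar>\<tau>\<bar> \<le> \<bar>t\<bar> \<Longrightarrow> wl2 sob (n \<tau>) C"
  shows "(LBINT \<tau>=ereal 0..ereal t. trig (n \<tau>) x) = trig (\<lambda>k. antider (\<lambda>\<tau>. n \<tau> k) t) x"
    and "(\<lambda>k. cmod (antider (\<lambda>\<tau>. n \<tau> k) t)) summable_on UNIV"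
proof -
  let ?M = "restrict_space lborel {min 0 t<..<max 0 t}"
  let ?s = "complex_of_real (if 0 \<le> t then 1 else -1)"
  interpret finite_measure ?M
    by (intro finite_measureI) (simp add: emeasure_restrict_space space_restrict_space)
  have bound: "(\<Sum>k\<in>F. cmod (n \<tau> k * cis (of_int k * y))) \<le> sqrt (7 * C)"
    if "\<tau> \<in> space ?M" "finite F" for \<tau> F y
  proof -
    have "\<bar>\<tau>\<bar> \<le> \<bar>t\<bar>" using that(1) by (auto simp: space_restrict_space)
    from wl2_sob_sum_norm_le[OF b[OF this] that(2)] show ?thesis by (simp add: norm_mult)
  qed
  have meas: "(\<lambda>\<tau>. n \<tau> k * cis (of_int k * y)) \<in> borel_measurable ?M" for k y
    by (intro measurable_restrict_space1)
       (simp add: borel_measurable_continuous_onI continuous_intros c)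
  note E = integral_infsum_int[where M = ?M and c = "\<lambda>k \<tau>. n \<tau> k * cis (of_int k * x)" and B = "\<lambda>_. sqrt (7 * C)",
      OF meas bound integrable_const]
  have s: "cmod ?s = 1" by simp
  have eq: "antider (\<lambda>\<tau>. n \<tau> k) t * cis (of_int k * x) = ?s * (\<integral>\<tau>. n \<tau> k * cis (of_int k * x) \<partial>?M)" for k
    unfolding antider_def oriented_integral integral_mult_left_zero by simp
  have "(\<integral>\<tau>. trig (n \<tau>) x \<partial>?M) = (\<Sum>\<^sub>\<infinity>k. \<integral>\<tau>. n \<tau> k * cis (of_int k * x) \<partial>?M)"
    unfolding trig_def by (rule E(4))
  then have "(LBINT \<tau>=ereal 0..ereal t. trig (n \<tau>) x) = (\<Sum>\<^sub>\<infinity>k. ?s * (\<integral>\<tau>. n \<tau> k * cis (of_int k * x) \<partial>?M))"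
    unfolding oriented_integral by (simp only: infsum_cmult_right')
  then show "(LBINT \<tau>=ereal 0..ereal t. trig (n \<tau>) x) = trig (\<lambda>k. antider (\<lambda>\<tau>. n \<tau> k) t) x"
    unfolding trig_def eq .
  have "cmod (antider (\<lambda>\<tau>. n \<tau> k) t) = cmod (\<integral>\<tau>. n \<tau> k * cis (of_int k * x) \<partial>?M)" for k
    using arg_cong[OF eq[of k], of cmod] s by (simp only: norm_mult norm_cis mult_1_right mult_1_left)
  with E(2) show "(\<lambda>k. cmod (antider (\<lambda>\<tau>. n \<tau> k) t)) summable_on UNIV" by simp
qed

text \<open>Compactness: near each time continuity bounds \<open>u\<close> in terms of its value at
  that time, and a finite subcover leaves finitely many bounds, whose sum serves for all.\<close>

lemma wcont_locally_bounded:
  assumes u: "wcont w u" and b: "\<And>t. \<exists>B. wl2 w (u t) B" and w: "\<And>k. 0 \<le> w k"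
  shows "\<exists>B. \<forall>t. \<bar>t\<bar> \<le> T \<longrightarrow> wl2 w (u t) B"
proof -
  have "\<exists>d B. 0 < d \<and> (\<forall>s. \<bar>s - t\<bar> < d \<longrightarrow> wl2 w (u s) B)" for t
  proof -
    obtain B where B: "wl2 w (u t) B" using b by blast
    obtain d where d: "0 < d" "\<And>s. s \<noteq> t \<Longrightarrow> dist s t < d \<Longrightarrow> wl2 w (\<lambda>k. u s k - u t k) 1"
      using wcontD[OF u zero_less_one, of t] unfolding eventually_at by blast
    have "wl2 w (u s) (2 * 1 + 2 * B)" if "\<bar>s - t\<bar> < d" for s
    proof (cases "s = t")
      case True
      then show ?thesis using wl2_mono[OF B] wl2_nonneg[OF B] by simp
    next
      case False
      from wl2_add[OF d(2)[OF False] B w] show ?thesis using that by (simp add: dist_real_def)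
    qed
    then show ?thesis using d(1) by blast
  qed
  then obtain d B where d: "\<And>t. 0 < d t" and B: "\<And>t s. \<bar>s - t\<bar> < d t \<Longrightarrow> wl2 w (u s) (B t)" by metis
  have B0: "0 \<le> B t" for t by (rule wl2_nonneg[OF B[of t t]]) (simp add: d)
  have "compact {-T..T}" by simp
  then obtain C where C: "C \<subseteq> {-T..T}" "finite C" "{-T..T} \<subseteq> (\<Union>t\<in>C. ball t (d t))"
    by (rule compactE_image[where C = "{-T..T}" and f = "\<lambda>t. ball t (d t)"]) (use d in auto)
  show ?thesis
  proof (intro exI allI impI)
    fix s assume "\<bar>s\<bar> \<le> T"
    then have "s \<in> {-T..T}" by auto
    then obtain t where t: "t \<in> C" "s \<in> ball t (d t)" using C(3) by blast
    have "B t \<le> (\<Sum>t\<in>C. B t)"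
      by (rule member_le_sum[OF t(1) B0 C(2)])
    moreover have "wl2 w (u s) (B t)" by (rule B) (use t in \<open>simp add: dist_real_def abs_minus_commute\<close>)
    ultimately show "wl2 w (u s) (\<Sum>t\<in>C. B t)" by (rule wl2_mono[rotated])
  qed
qed

subsection \<open>Mild solutions in terms of Fourier coefficients\<close>

lemma C_H1_wcont:
  assumes v: "v \<in> C_H1"
  shows "wcont sob (\<lambda>t. fourier_coeff (v t))" and "\<exists>B. wl2 sob (fourier_coeff (v t)) B"
proof -
  have H: "v t \<in> H1_torus" for t using v by (simp add: C_H1_def)
  then show "\<exists>B. wl2 sob (fourier_coeff (v t)) B" by (auto simp: H1_torus_iff)
  show "wcont sob (\<lambda>t. fourier_coeff (v t))"
    unfolding wcont_def
  proof (intro allI impI)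
    fix t e :: real assume e: "0 < e"
    have "((\<lambda>s. H1_norm (\<lambda>x. v s x - v t x)) \<longlongrightarrow> 0) (at t)" using v by (simp add: C_H1_def)
    then have "\<forall>\<^sub>F s in at t. H1_norm (\<lambda>x. v s x - v t x) < sqrt (2 * pi * e)"
      using e by (intro order_tendstoD(2)) auto
    then show "\<forall>\<^sub>F s in at t. wl2 sob (\<lambda>k. fourier_coeff (v s) k - fourier_coeff (v t) k) e"
    proof eventually_elim
      case (elim s)
      note D = H1_torus_diff[OF H[of s] H[of t]]
      obtain B where B: "wl2 sob (fourier_coeff (\<lambda>x. v s x - v t x)) B" using D(1) by (auto simp: H1_torus_iff)
      have "2 * pi * (\<Sum>\<^sub>\<infinity>k. sob k * (cmod (fourier_coeff (\<lambda>x. v s x - v t x) k))\<^sup>2) < 2 * pi * e"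
        using elim unfolding H1_norm_fourier[OF D(1)] by (simp only: real_sqrt_less_iff)
      then have "(\<Sum>\<^sub>\<infinity>k. sob k * (cmod (fourier_coeff (\<lambda>x. v s x - v t x) k))\<^sup>2) \<le> e" by simp
      from wl2_mono[OF wl2_infsum[OF wl2_summable[OF B sob_nonneg] sob_nonneg] this]
      show ?case by (simp only: D(2)[abs_def])
    qed
  qed
qed

lemma trig_C_H1:
  assumes w: "wcont sob w" and b: "\<And>t. \<exists>B. wl2 sob (w t) B"
  shows "(\<lambda>t. trig (w t)) \<in> C_H1"
proof -
  have H: "trig (w t) \<in> H1_torus" and fc: "fourier_coeff (trig (w t)) = w t" for t
    using b[of t] trig_H1_torus by blast+
  have "((\<lambda>s. H1_norm (\<lambda>x. trig (w s) x - trig (w t) x)) \<longlongrightarrow> 0) (at t)" for t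
  proof (rule tendstoI)
    fix e :: real assume e: "0 < e"
    have "\<forall>\<^sub>F s in at t. wl2 sob (\<lambda>k. w s k - w t k) (e\<^sup>2 / (4 * pi))"
      by (rule wcontD[OF w]) (use e in simp)
    then show "\<forall>\<^sub>F s in at t. dist (H1_norm (\<lambda>x. trig (w s) x - trig (w t) x)) 0 < e"
    proof eventually_elim
      case (elim s)
      let ?X = "\<Sum>\<^sub>\<infinity>k. sob k * (cmod (w s k - w t k))\<^sup>2"
      have "2 * pi * ?X \<le> 2 * pi * (e\<^sup>2 / (4 * pi))"
        by (intro mult_left_mono wl2_infsum_le[OF elim sob_nonneg]) auto
      also have "\<dots> < e\<^sup>2" using e by simp
      finally have "sqrt (2 * pi * ?X) < sqrt (e\<^sup>2)" by (simp only: real_sqrt_less_iff)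
      then have "sqrt (2 * pi * ?X) < e" using e by simp
      moreover have "0 \<le> sqrt (2 * pi * ?X)"
        by (intro real_sqrt_ge_zero mult_nonneg_nonneg infsum_nonneg) (auto simp: sob_nonneg)
      moreover have "H1_norm (\<lambda>x. trig (w s) x - trig (w t) x) = sqrt (2 * pi * ?X)"
        unfolding H1_norm_fourier[OF H1_torus_diff(1)[OF H H]] H1_torus_diff(2)[OF H H] fc ..
      ultimately show ?case by (simp add: dist_real_def)
    qed
  qed
  then show ?thesis using H by (simp add: C_H1_def)
qed

text \<open>The untruncated counterpart of \<open>N\<close>. Its argument is a function, not a
  sequence, because mild solutions are given by arbitrary representatives.\<close>

definition power_coeff :: "real \<Rightarrow> (real \<Rightarrow> complex) \<Rightarrow> int \<Rightarrow> complex" where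
  "power_coeff \<alpha> h = fourier_coeff (\<lambda>y. nonlinearity \<alpha> (h y))"

lemma (in truncated_nls) power_coeff_eq_N:
  assumes h: "h \<in> H1_torus" and b: "\<And>x. cmod (trig (fourier_coeff h) x) \<le> R"
  shows "power_coeff \<alpha> h = N (fourier_coeff h)"
proof -
  let ?T = "trig (fourier_coeff h)"
  obtain B where B: "wl2 sob (fourier_coeff h) B" using h by (auto simp: H1_torus_iff)
  have hm: "h \<in> borel_measurable tor" using h by (auto simp: H1_torus_def L2_torus_sqint intro: sqint_measurable)
  have "fourier_coeff (\<lambda>y. nonlinearity \<alpha> (h y)) k = fourier_coeff (\<lambda>y. f (?T y)) k" for k
  proof (rule fourier_coeff_cong_AE)
    show "AE x in tor. nonlinearity \<alpha> (h x) = f (?T x)"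
      using H1_torus_AE_trig[OF h] by eventually_elim (simp add: f_eq_nonlinearity[OF b])
    show "(\<lambda>y. nonlinearity \<alpha> (h y)) \<in> borel_measurable tor"
      unfolding nonlinearity_def using hm by measurable
    show "(\<lambda>y. f (?T y)) \<in> borel_measurable tor"
      by (rule sqint_measurable[OF sqint_f_trig[OF wl2_sob_abs_summable[OF B]]])
  qed
  then show ?thesis by (simp add: power_coeff_def N_def fun_eq_iff)
qed

section \<open>Duhamel integrals along a curve in \<open>C_H1\<close>\<close>

context
  fixes \<alpha> \<sigma> :: real and v :: "real \<Rightarrow> real \<Rightarrow> complex"
  assumes \<alpha>: "1 \<le> \<alpha>" "\<alpha> \<le> 2" and sign: "\<sigma> = 1 \<or> \<sigma> = -1" and v: "v \<in> C_H1"
begin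

lemma C_H1_bounded:
  obtains B where "\<And>t. \<bar>t\<bar> \<le> T \<Longrightarrow> wl2 sob (fourier_coeff (v t)) B"
  using wcont_locally_bounded[OF C_H1_wcont[OF v] sob_nonneg, of T] by metis

lemma C_H1_sup_bounded:
  obtains B where "\<And>t x. \<bar>t\<bar> \<le> T \<Longrightarrow> cmod (trig (fourier_coeff (v t)) x) \<le> B"
proof -
  obtain B where B: "\<And>t. \<bar>t\<bar> \<le> T \<Longrightarrow> wl2 sob (fourier_coeff (v t)) B" using C_H1_bounded[of T] by blast
  show thesis
  proof (rule that)
    fix t x assume "\<bar>t\<bar> \<le> T"
    note b = B[OF this]
    show "cmod (trig (fourier_coeff (v t)) x) \<le> sqrt (7 * B)"
      by (rule order_trans[OF norm_trig_le[OF wl2_sob_abs_summable[OF b]] wl2_sob_infsum_norm_le[OF b]])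
  qed
qed

text \<open>On a bounded time interval \<open>v\<close> is bounded, so its power coefficients are
  those of a truncated nonlinearity, from which continuity and bounds are inherited. The height
  depends on the interval, which is harmless for local properties.\<close>

lemma power_coeff_props:
  shows "continuous_on UNIV (\<lambda>t. power_coeff \<alpha> (v t) k)"
    and "\<exists>C. \<forall>t. \<bar>t\<bar> \<le> T \<longrightarrow> wl2 sob (power_coeff \<alpha> (v t)) C"
proof -
  have H: "v t \<in> H1_torus" for t using v by (simp add: C_H1_def)
  have loc: "\<exists>w. (\<forall>k. continuous_on UNIV (\<lambda>t. w t k)) \<and> (\<exists>C. \<forall>t. \<bar>t\<bar> \<le> T \<longrightarrow> wl2 sob (w t) C)
      \<and> (\<forall>t. \<bar>t\<bar> \<le> T \<longrightarrow> w t = power_coeff \<alpha> (v t))" for T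
  proof -
    obtain B where B: "\<And>t x. \<bar>t\<bar> \<le> T \<Longrightarrow> cmod (trig (fourier_coeff (v t)) x) \<le> B" using C_H1_sup_bounded[of T] by blast
    interpret truncated_nls \<alpha> \<sigma> "max 1 B" by unfold_locales (use \<alpha> sign in auto)
    obtain D where D: "\<And>t. \<bar>t\<bar> \<le> T \<Longrightarrow> wl2 sob (fourier_coeff (v t)) D" using C_H1_bounded[of T] by blast
    have c1: "continuous_on UNIV (\<lambda>t. N (fourier_coeff (v t)) k)" for k
      by (rule continuous_N[OF wcont_sob_one[OF C_H1_wcont(1)[OF v]] C_H1_wcont(2)[OF v]])
    have c2: "\<exists>C. \<forall>t. \<bar>t\<bar> \<le> T \<longrightarrow> wl2 sob (N (fourier_coeff (v t))) C"
      using N_sob[OF D] by blast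
    have c3: "N (fourier_coeff (v t)) = power_coeff \<alpha> (v t)" if "\<bar>t\<bar> \<le> T" for t
      by (rule power_coeff_eq_N[OF H, symmetric]) (use B[OF that] in \<open>simp add: le_max_iff_disj\<close>)
    show ?thesis
      by (rule exI[of _ "\<lambda>t. N (fourier_coeff (v t))"]) (use c1 c2 c3 in blast)
  qed
  show "\<exists>C. \<forall>t. \<bar>t\<bar> \<le> T \<longrightarrow> wl2 sob (power_coeff \<alpha> (v t)) C" using loc[of T] by metis
  show "continuous_on UNIV (\<lambda>t. power_coeff \<alpha> (v t) k)"
  proof (rule continuous_at_imp_continuous_on, rule ballI)
    fix t :: real
    obtain w where w: "continuous_on UNIV (\<lambda>t. w t k)" "\<And>s. \<bar>s\<bar> \<le> \<bar>t\<bar> + 1 \<Longrightarrow> w s = power_coeff \<alpha> (v s)"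
      using loc[of "\<bar>t\<bar> + 1"] by blast
    have "continuous_on {-(\<bar>t\<bar> + 1)<..<\<bar>t\<bar> + 1} (\<lambda>t. power_coeff \<alpha> (v t) k)"
      using continuous_on_subset[OF w(1) subset_UNIV]
      by (rule continuous_on_eq) (use w(2) in \<open>auto simp: abs_le_iff\<close>)
    moreover have "t \<in> {-(\<bar>t\<bar> + 1)<..<\<bar>t\<bar> + 1}" by auto
    ultimately show "isCont (\<lambda>t. power_coeff \<alpha> (v t) k) t"
      by (simp add: continuous_on_eq_continuous_at)
  qed
qed

text \<open>Splitting the phase at \<open>t - \<tau>\<close> pulls the group at time
  \<open>t\<close> out of the integral and leaves the interaction picture inside. Stated for any
  curve in \<open>C_H1\<close>, the formula serves uniqueness and existence alike.\<close>

lemma duhamel_trig: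
  fixes t x :: real
  assumes a: "(\<lambda>k. cmod (a k)) summable_on UNIV"
  defines "d \<equiv> \<lambda>k. cis (- (t * (of_int k)\<^sup>2)) * (a k + \<i> * of_real \<sigma> * antider (\<lambda>\<tau>. cis (\<tau> * (of_int k)\<^sup>2) * power_coeff \<alpha> (v \<tau>) k) t)"
  shows "trig (\<lambda>k. cis (- (t * (of_int k)\<^sup>2)) * a k) x + of_real \<sigma> * \<i> *
      (LBINT \<tau>=ereal 0..ereal t. schrodinger_group (t - \<tau>) (\<lambda>y. nonlinearity \<alpha> (v \<tau> y)) x) = trig d x"
    and "(\<lambda>k. cmod (d k)) summable_on UNIV"
proof -
  let ?n = "\<lambda>\<tau> k. cis (- ((t - \<tau>) * (of_int k)\<^sup>2)) * power_coeff \<alpha> (v \<tau>) k"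
  let ?e = "\<lambda>k. cis (- (t * (of_int k)\<^sup>2))"
  obtain C where C: "\<And>\<tau>. \<bar>\<tau>\<bar> \<le> \<bar>t\<bar> \<Longrightarrow> wl2 sob (power_coeff \<alpha> (v \<tau>)) C" using power_coeff_props(2) by metis
  have c: "continuous_on UNIV (\<lambda>\<tau>. ?n \<tau> k)" for k by (intro continuous_intros power_coeff_props)
  have b: "wl2 sob (?n \<tau>) C" if "\<bar>\<tau>\<bar> \<le> \<bar>t\<bar>" for \<tau>
    by (rule wl2_norm_mono[OF C[OF that] sob_nonneg]) (simp add: norm_mult)
  note A = antider_trig[OF c b]
  have n: "antider (\<lambda>\<tau>. ?n \<tau> k) t = ?e k * antider (\<lambda>\<tau>. cis (\<tau> * (of_int k)\<^sup>2) * power_coeff \<alpha> (v \<tau>) k) t" for k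
  proof -
    have "cis (- ((t - \<tau>) * (of_int k)\<^sup>2)) = ?e k * cis (\<tau> * (of_int k)\<^sup>2)" for \<tau>
      by (simp add: cis_mult algebra_simps)
    then show ?thesis by (simp only: mult.assoc antider_cmult)
  qed
  have d: "d = (\<lambda>k. ?e k * a k + (of_real \<sigma> * \<i>) * antider (\<lambda>\<tau>. ?n \<tau> k) t)"
    unfolding d_def n by (simp add: fun_eq_iff algebra_simps)
  have s1: "(\<lambda>k. cmod (?e k * a k)) summable_on UNIV" using a by (simp add: norm_mult)
  have s2: "(\<lambda>k. cmod ((of_real \<sigma> * \<i>) * antider (\<lambda>\<tau>. ?n \<tau> k) t)) summable_on UNIV"
    unfolding norm_mult by (intro summable_on_cmult_right A)
  have "schrodinger_group (t - \<tau>) (\<lambda>y. nonlinearity \<alpha> (v \<tau> y)) = trig (?n \<tau>)" for \<tau>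
    by (simp add: schrodinger_group_trig power_coeff_def)
  then show "trig (\<lambda>k. ?e k * a k) x + of_real \<sigma> * \<i> *
      (LBINT \<tau>=ereal 0..ereal t. schrodinger_group (t - \<tau>) (\<lambda>y. nonlinearity \<alpha> (v \<tau> y)) x) = trig d x"
    unfolding d trig_add[OF s1 s2] trig_cmult by (simp only: A(1))
  show "(\<lambda>k. cmod (d k)) summable_on UNIV"
    unfolding d
    by (rule summable_on_comparison_test[OF summable_on_add[OF s1 s2]]) (auto intro: norm_triangle_ineq)
qed

end

text \<open>For fixed \<open>t\<close> the equation holds almost everywhere in \<open>x\<close>,
  hence exactly for the Fourier coefficients. So \<open>U\<close> is the interaction picture of
  \<open>v\<close>, free of the choice of representatives.\<close>

lemma mild_solution_coeff:
  assumes \<alpha>: "1 \<le> \<alpha>" "\<alpha> \<le> 2" and sign: "\<sigma> = 1 \<or> \<sigma> = -1" and w0: "w0 \<in> H1_torus"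
    and v: "mild_solution \<alpha> \<sigma> w0 v"
  defines "U \<equiv> \<lambda>t k. fourier_coeff w0 k + \<i> * of_real \<sigma> * antider (\<lambda>\<tau>. cis (\<tau> * (of_int k)\<^sup>2) * power_coeff \<alpha> (v \<tau>) k) t"
  shows "AE x in lborel. v t x = trig (evol t (U t)) x"
    and "fourier_coeff (v t) = evol t (U t)"
proof -
  have C: "v \<in> C_H1" using v by (simp add: mild_solution_def)
  obtain B where B: "wl2 sob (fourier_coeff w0) B" using w0 by (auto simp: H1_torus_iff)
  note D = duhamel_trig[OF \<alpha> sign C wl2_sob_abs_summable[OF B]]
  have e: "evol t (U t) = (\<lambda>k. cis (- (t * (of_int k)\<^sup>2)) * U t k)"
    by (simp add: evol_def fun_eq_iff)
  show ae: "AE x in lborel. v t x = trig (evol t (U t)) x"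
  proof -
    have "AE x in lborel. v t x = schrodinger_group t w0 x + of_real \<sigma> * \<i> *
        (LBINT \<tau>=ereal 0..ereal t. schrodinger_group (t - \<tau>) (\<lambda>y. nonlinearity \<alpha> (v \<tau> y)) x)"
      using v unfolding mild_solution_def by blast
    then show ?thesis
    proof eventually_elim
      case (elim x)
      show ?case unfolding elim schrodinger_group_trig[of t w0] D(1) e by (simp only: U_def)
    qed
  qed
  have s: "(\<lambda>k. cmod (evol t (U t) k)) summable_on UNIV"
    unfolding e by (unfold U_def) (rule D(2))
  have "v t \<in> H1_torus" using C by (simp add: C_H1_def)
  then have vm: "v t \<in> borel_measurable tor" by (auto simp: H1_torus_def L2_torus_sqint intro: sqint_measurable)
  have "fourier_coeff (v t) k = fourier_coeff (trig (evol t (U t))) k" for k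
    by (rule fourier_coeff_cong_AE[OF AE_lborel_tor[OF ae] vm sqint_measurable[OF sqint_trig[OF s]]])
  then show "fourier_coeff (v t) = evol t (U t)" by (simp add: fun_eq_iff fourier_coeff_trig[OF s])
qed

text \<open>Up to time \<open>t\<close> both solutions satisfy the same truncated equation once
  \<open>R\<close> exceeds their suprema. A Picard step with the solutions as their own drivers can
  be repeated indefinitely, and the factorials force the difference to 0.\<close>

lemma mild_solution_unique:
  assumes \<alpha>: "1 \<le> \<alpha>" "\<alpha> \<le> 2" and sign: "\<sigma> = 1 \<or> \<sigma> = -1" and w0: "w0 \<in> H1_torus"
    and v1: "mild_solution \<alpha> \<sigma> w0 v1" and v2: "mild_solution \<alpha> \<sigma> w0 v2"
  shows "AE x in lborel. v1 t x = v2 t x"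
proof -
  define U where "U v t k = fourier_coeff w0 k + \<i> * of_real \<sigma> * antider (\<lambda>\<tau>. cis (\<tau> * (of_int k)\<^sup>2) * power_coeff \<alpha> (v \<tau>) k) t"
    for v t k
  note M = mild_solution_coeff[OF \<alpha> sign w0, folded U_def]
  have C: "v1 \<in> C_H1" "v2 \<in> C_H1" using v1 v2 by (simp_all add: mild_solution_def)
  obtain B1 where B1: "\<And>\<tau> x. \<bar>\<tau>\<bar> \<le> \<bar>t\<bar> \<Longrightarrow> cmod (trig (fourier_coeff (v1 \<tau>)) x) \<le> B1" using C_H1_sup_bounded[OF \<alpha> sign C(1), of "\<bar>t\<bar>"] by blast
  obtain B2 where B2: "\<And>\<tau> x. \<bar>\<tau>\<bar> \<le> \<bar>t\<bar> \<Longrightarrow> cmod (trig (fourier_coeff (v2 \<tau>)) x) \<le> B2" using C_H1_sup_bounded[OF \<alpha> sign C(2), of "\<bar>t\<bar>"] by blast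
  define R where "R = max 1 (max B1 B2)"
  interpret truncated_nls \<alpha> \<sigma> R by unfold_locales (use \<alpha> sign in \<open>auto simp: R_def\<close>)
  have dU: "((\<lambda>\<tau>. U v \<tau> k) has_vector_derivative G \<tau> (U v \<tau>) k) (at \<tau>)"
    and cG: "continuous_on {-\<bar>t\<bar>..\<bar>t\<bar>} (\<lambda>\<tau>. G \<tau> (U v \<tau>) k)"
    if v: "mild_solution \<alpha> \<sigma> w0 v" and b: "\<And>\<tau> x. \<bar>\<tau>\<bar> \<le> \<bar>t\<bar> \<Longrightarrow> cmod (trig (fourier_coeff (v \<tau>)) x) \<le> R"
      and \<tau>: "\<bar>\<tau>\<bar> \<le> \<bar>t\<bar>" for v \<tau> k
  proof -
    have Cv: "v \<in> C_H1" using v by (simp add: mild_solution_def)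
    have c: "continuous_on UNIV (\<lambda>\<tau>. cis (\<tau> * (of_int k)\<^sup>2) * power_coeff \<alpha> (v \<tau>) k)"
      by (intro continuous_intros power_coeff_props[OF \<alpha> sign Cv])
    have eq: "G \<tau> (U v \<tau>) k = \<i> * of_real \<sigma> * (cis (\<tau> * (of_int k)\<^sup>2) * power_coeff \<alpha> (v \<tau>) k)" if "\<bar>\<tau>\<bar> \<le> \<bar>t\<bar>" for \<tau>
    proof -
      have "v \<tau> \<in> H1_torus" using Cv by (simp add: C_H1_def)
      from power_coeff_eq_N[OF this b[OF that]] show ?thesis
        by (simp add: G_def M(2)[OF v, symmetric])
    qed
    have "((\<lambda>\<tau>. U v \<tau> k) has_vector_derivative 0 + \<i> * of_real \<sigma> * (cis (\<tau> * (of_int k)\<^sup>2) * power_coeff \<alpha> (v \<tau>) k)) (at \<tau>)"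
      unfolding U_def
      by (intro has_vector_derivative_add has_vector_derivative_const has_vector_derivative_mult_right
        antider_has_vector_derivative c)
    then show "((\<lambda>\<tau>. U v \<tau> k) has_vector_derivative G \<tau> (U v \<tau>) k) (at \<tau>)" by (simp add: eq[OF \<tau>])
    have "continuous_on {-\<bar>t\<bar>..\<bar>t\<bar>} (\<lambda>\<tau>. \<i> * of_real \<sigma> * (cis (\<tau> * (of_int k)\<^sup>2) * power_coeff \<alpha> (v \<tau>) k))"
      by (intro continuous_on_mult_left continuous_on_subset[OF c]) auto
    then show "continuous_on {-\<bar>t\<bar>..\<bar>t\<bar>} (\<lambda>\<tau>. G \<tau> (U v \<tau>) k)"
      by (rule continuous_on_eq) (use eq in \<open>auto simp: abs_le_iff\<close>)
  qed
  have R1: "\<And>\<tau> x. \<bar>\<tau>\<bar> \<le> \<bar>t\<bar> \<Longrightarrow> cmod (trig (fourier_coeff (v1 \<tau>)) x) \<le> R"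
    and R2: "\<And>\<tau> x. \<bar>\<tau>\<bar> \<le> \<bar>t\<bar> \<Longrightarrow> cmod (trig (fourier_coeff (v2 \<tau>)) x) \<le> R"
    using B1 B2 unfolding R_def by (auto simp: le_max_iff_disj)
  have h: "\<exists>B. wl2 sob (U v \<tau>) B" if "mild_solution \<alpha> \<sigma> w0 v" for v \<tau>
  proof -
    have "v \<in> C_H1" using that by (simp add: mild_solution_def)
    from C_H1_wcont(2)[OF this, of \<tau>] show ?thesis unfolding M(2)[OF that] by simp
  qed
  have loc: "\<exists>B. \<forall>\<tau>. \<bar>\<tau>\<bar> \<le> \<bar>t\<bar> \<longrightarrow> wl2 sob (U v \<tau>) B" if "mild_solution \<alpha> \<sigma> w0 v" for v
  proof -
    have "v \<in> C_H1" using that by (simp add: mild_solution_def)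
    from wcont_locally_bounded[OF C_H1_wcont[OF this] sob_nonneg, of "\<bar>t\<bar>"]
    show ?thesis unfolding M(2)[OF that] by simp
  qed
  obtain D1 where D1: "\<And>\<tau>. \<bar>\<tau>\<bar> \<le> \<bar>t\<bar> \<Longrightarrow> wl2 sob (U v1 \<tau>) D1" using loc[OF v1] by blast
  obtain D2 where D2: "\<And>\<tau>. \<bar>\<tau>\<bar> \<le> \<bar>t\<bar> \<Longrightarrow> wl2 sob (U v2 \<tau>) D2" using loc[OF v2] by blast
  define D where "D = 2 * D1 + 2 * D2"
  let ?L = "(2 * R powr (\<alpha> - 1))\<^sup>2"
  have D0: "0 \<le> D" using wl2_nonneg[OF D1[of 0]] wl2_nonneg[OF D2[of 0]] by (simp add: D_def)
  \<comment> \<open>The induction starts from the crude bound \<open>D\<close> for the difference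
    and feeds each bound back into \<open>picard_step\<close>.\<close>
  have iter: "wl2 (\<lambda>_. 1) (\<lambda>k. U v1 \<tau> k - U v2 \<tau> k) (D * (?L * \<tau>\<^sup>2) ^ n / fact n)" if "\<bar>\<tau>\<bar> \<le> \<bar>t\<bar>" for n \<tau>
    using that
  proof (induction n arbitrary: \<tau>)
    case 0
    have "wl2 (\<lambda>_. 1) (\<lambda>k. U v1 \<tau> k - U v2 \<tau> k) D"
      unfolding D_def by (intro wl2_diff wl2_sob_one D1 D2 0) auto
    then show ?case by simp
  next
    case (Suc n)
    show ?case
    proof (rule picard_step[where p = "U v1" and q = "U v2"])
      fix k s assume "\<bar>s\<bar> \<le> \<bar>\<tau>\<bar>"
      then have s: "\<bar>s\<bar> \<le> \<bar>t\<bar>" using Suc.prems by simp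
      show "((\<lambda>\<tau>. U v1 \<tau> k) has_vector_derivative G s (U v1 s) k) (at s)" by (rule dU[OF v1 R1 s])
      show "((\<lambda>\<tau>. U v2 \<tau> k) has_vector_derivative G s (U v2 s) k) (at s)" by (rule dU[OF v2 R2 s])
    next
      show "U v1 0 k = U v2 0 k" for k by (simp add: U_def)
      have sub: "{-\<bar>\<tau>\<bar>..\<bar>\<tau>\<bar>} \<subseteq> {-\<bar>t\<bar>..\<bar>t\<bar>}" using Suc.prems by auto
      show "continuous_on {-\<bar>\<tau>\<bar>..\<bar>\<tau>\<bar>} (\<lambda>\<tau>. G \<tau> (U v1 \<tau>) k)" for k
        by (rule continuous_on_subset[OF cG[OF v1 R1, of 0] sub]) auto
      show "continuous_on {-\<bar>\<tau>\<bar>..\<bar>\<tau>\<bar>} (\<lambda>\<tau>. G \<tau> (U v2 \<tau>) k)" for k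
        by (rule continuous_on_subset[OF cG[OF v2 R2, of 0] sub]) auto
      show "\<exists>B. wl2 sob (U v1 s) B" "\<exists>B. wl2 sob (U v2 s) B" for s by (rule h[OF v1], rule h[OF v2])
      show "wl2 (\<lambda>_. 1) (\<lambda>k. U v1 s k - U v2 s k) (D * (?L * s\<^sup>2) ^ n / fact n)" if "\<bar>s\<bar> \<le> \<bar>\<tau>\<bar>" for s
        by (rule Suc.IH) (use that Suc.prems in simp)
    qed (rule D0)
  qed
  have "U v1 t k = U v2 t k" for k
  proof -
    have "(\<lambda>n. inverse (fact n) *\<^sub>R (?L * t\<^sup>2) ^ n) \<longlonglongrightarrow> 0"
      using summable_LIMSEQ_zero[OF summable_exp_generic[of "?L * t\<^sup>2"]] by simp
    from tendsto_mult_left[OF this, of D]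
    have lim: "(\<lambda>n. D * (?L * t\<^sup>2) ^ n / fact n) \<longlonglongrightarrow> 0" by (simp add: divide_inverse mult_ac)
    have "(cmod (U v1 t k - U v2 t k))\<^sup>2 \<le> D * (?L * t\<^sup>2) ^ n / fact n" for n
      by (rule wl2_one_single[OF iter]) simp
    then have "(cmod (U v1 t k - U v2 t k))\<^sup>2 \<le> 0"
      by (intro LIMSEQ_le_const[OF lim]) auto
    then show ?thesis by simp
  qed
  then have "U v1 t = U v2 t" by (simp add: fun_eq_iff)
  with M(1)[OF v1, of t] M(1)[OF v2, of t] show ?thesis by auto
qed

lemma mild_solution_exists:
  assumes \<alpha>: "1 \<le> \<alpha>" "\<alpha> \<le> 2" and sign: "\<sigma> = 1 \<or> \<sigma> = -1" and w0: "w0 \<in> H1_torus"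
  shows "\<exists>w. mild_solution \<alpha> \<sigma> w0 w \<and> (\<forall>t. energy \<alpha> \<sigma> (w t) = energy \<alpha> \<sigma> w0)"
proof -
  define a where "a = fourier_coeff w0"
  obtain A where A: "wl2 sob a A" using w0 by (auto simp: H1_torus_iff a_def)
  define Y where "Y = (\<Sum>\<^sub>\<infinity>k. sob k * (cmod (a k))\<^sup>2)"
  \<comment> \<open>The bound in \<open>sup_bound\<close> depends on the initial datum alone, so it
    can be taken as truncation height before the flow is constructed; \<open>max 1\<close> meets the
    assumption of the locale.\<close>
  define R where "R = max 1 (sqrt 7 * (sqrt 7 * Y + (3 * Y + Y * sqrt 7 * sqrt Y) + 1))"
  interpret truncated_nls \<alpha> \<sigma> R by unfold_locales (use \<alpha> sign in \<open>auto simp: R_def\<close>)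
  define w where "w t = evol t (sol a t)" for t
  have ws: "\<exists>B. wl2 sob (w t) B" for t using sol_sob[OF A, of t] by (auto simp: w_def)
  have wc: "wcont sob w"
    unfolding w_def using sol_sob[OF A] by (intro wcont_evol sol_wcont_sob[OF A] sob_nonneg) blast
  have w_0: "w 0 = a" by (simp add: w_def evol_def sol_0[OF A] fun_eq_iff)
  have flow: "nls_flow (trunc_m (\<alpha> - 1) R) (trunc_\<Psi> (\<alpha> - 1) R) (2 * R powr (\<alpha> - 1)) \<sigma> w"
  proof unfold_locales
    show "wcont (\<lambda>_. 1) w" by (rule wcont_sob_one[OF wc])
    show "\<exists>B. \<forall>t. \<bar>t\<bar> \<le> T \<longrightarrow> wl2 sob (w t) B" for T
      by (rule wcont_locally_bounded[OF wc ws sob_nonneg])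
    show "((\<lambda>t. w t k) has_vector_derivative - \<i> * (of_int k)\<^sup>2 * w t k + \<i> * of_real \<sigma> * N (w t) k) (at t)" for t k
    proof -
      \<comment> \<open>Leaving the interaction picture restores the term with k^2 through the
        product rule.\<close>
      have "((\<lambda>t. cis (- (of_int k)\<^sup>2 * t) * sol a t k) has_vector_derivative
          cis (- (of_int k)\<^sup>2 * t) * G t (sol a t) k
          + \<i> * of_real (- (of_int k)\<^sup>2) * cis (- (of_int k)\<^sup>2 * t) * sol a t k) (at t)"
        by (rule has_vector_derivative_mult[OF has_vector_derivative_cis sol_deriv[OF A]])
      moreover have "(\<lambda>t. w t k) = (\<lambda>t. cis (- (of_int k)\<^sup>2 * t) * sol a t k)"
        by (simp add: w_def evol_def mult.commute)
      moreover have "cis (- (of_int k)\<^sup>2 * t) * G t (sol a t) k = \<i> * of_real \<sigma> * N (w t) k"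
        by (simp add: G_def w_def cis_mult mult_ac)
      ultimately show ?thesis by (simp add: w_def evol_def mult_ac add.commute)
    qed
  qed
  interpret F: nls_flow "trunc_m (\<alpha> - 1) R" "trunc_\<Psi> (\<alpha> - 1) R" "2 * R powr (\<alpha> - 1)" \<sigma> w by (rule flow)
  have sup: "cmod (trig (w t) x) \<le> R" for t x
  proof -
    have "cmod (trig (w t) x) \<le> (\<Sum>\<^sub>\<infinity>k. cmod (w t k))" by (rule norm_trig_le[OF F.w_abs_summable])
    also have "\<dots> \<le> sqrt 7 * (sqrt 7 * Y + (3 * Y + Y * sqrt 7 * sqrt Y) + 1)"
      by (rule sup_bound[OF flow]) (simp add: w_0 Y_def)
    finally show ?thesis by (simp add: R_def)
  qed
  have H: "trig (w t) \<in> H1_torus" and fc: "fourier_coeff (trig (w t)) = w t" for t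
    using ws[of t] trig_H1_torus by blast+
  have C: "(\<lambda>t. trig (w t)) \<in> C_H1" by (rule trig_C_H1[OF wc ws])
  \<comment> \<open>The solution stays below the height \<open>R\<close>, so the truncated flow only
    ever sees the original power.\<close>
  have pc: "power_coeff \<alpha> (trig (w t)) = N (w t)" for t
    using power_coeff_eq_N[OF H[of t]] sup by (simp add: fc)
  have mild: "mild_solution \<alpha> \<sigma> w0 (\<lambda>t. trig (w t))"
    unfolding mild_solution_def
  proof (intro conjI allI C)
    fix t
    have "sol a t k = a k + \<i> * of_real \<sigma> * antider (\<lambda>\<tau>. cis (\<tau> * (of_int k)\<^sup>2) * N (w \<tau>) k) t" for k
    proof -
      let ?h = "\<lambda>\<tau>. \<i> * of_real \<sigma> * (cis (\<tau> * (of_int k)\<^sup>2) * N (w \<tau>) k)"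
      have c: "continuous_on S ?h" for S
        by (intro continuous_intros continuous_on_subset[OF F.continuous_N_w]) auto
      have G: "G \<tau> (sol a \<tau>) k = ?h \<tau>" for \<tau> by (simp add: G_def w_def)
      have "((\<lambda>\<tau>. sol a \<tau> k) has_vector_derivative ?h \<tau>) (at \<tau>)" for \<tau>
        using sol_deriv[OF A, of k \<tau>] unfolding G .
      then have "antider ?h t = sol a t k - sol a 0 k" by (intro antider_eq_diff c)
      then show ?thesis by (simp only: antider_cmult sol_0[OF A]) simp
    qed
    then have "w t = (\<lambda>k. cis (- (t * (of_int k)\<^sup>2)) * (a k + \<i> * of_real \<sigma> *
        antider (\<lambda>\<tau>. cis (\<tau> * (of_int k)\<^sup>2) * power_coeff \<alpha> (trig (w \<tau>)) k) t))"
      by (simp add: w_def[of t] evol_def pc fun_eq_iff)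
    then show "AE x in lborel. trig (w t) x = schrodinger_group t w0 x + of_real \<sigma> * \<i> *
        (LBINT \<tau>=ereal 0..ereal t. schrodinger_group (t - \<tau>) (\<lambda>y. nonlinearity \<alpha> (trig (w \<tau>) y)) x)"
      using duhamel_trig(1)[OF \<alpha> sign C wl2_sob_abs_summable[OF A], of t]
      by (simp add: schrodinger_group_trig[of t w0] a_def[symmetric])
  qed
  have "energy \<alpha> \<sigma> (trig (w t)) = energy \<alpha> \<sigma> w0" for t
  proof -
    have "energy \<alpha> \<sigma> (trig (w t)) = 2 * pi * ((\<Sum>\<^sub>\<infinity>k. (of_int k)\<^sup>2 * (cmod (w t k))\<^sup>2) / 2 - \<sigma> * pot (w t))"
      using energy_eq_pot[OF H[of t]] sup by (simp add: fc)
    also have "\<dots> = 2 * pi * ((\<Sum>\<^sub>\<infinity>k. (of_int k)\<^sup>2 * (cmod (w 0 k))\<^sup>2) / 2 - \<sigma> * pot (w 0))"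
      by (simp only: F.energy_conserved[of t])
    also have "\<dots> = energy \<alpha> \<sigma> w0"
      using energy_eq_pot[OF w0] sup[of 0] by (simp add: w_0 a_def)
    finally show ?thesis .
  qed
  with mild show ?thesis by blast
qed

theorem theorem30:
  fixes \<alpha> \<sigma> :: real
  assumes "1 \<le> \<alpha>" and "\<alpha> \<le> 2" and "\<sigma> = 1 \<or> \<sigma> = -1"
  shows "\<forall>w0 \<in> H1_torus. \<exists>w. mild_solution \<alpha> \<sigma> w0 w \<and>
    (\<forall>v. mild_solution \<alpha> \<sigma> w0 v \<longrightarrow> (\<forall>t. AE x in lborel. v t x = w t x)) \<and>
    (\<forall>t. energy \<alpha> \<sigma> (w t) = energy \<alpha> \<sigma> w0)"
  using mild_solution_exists[OF assms] mild_solution_unique[OF assms] by meson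

end
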